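(* Let $G$ be a connected graph with maximum degree $3$ which contains an odd cycle and which is not isomorphic to the Petersen graph. Then $$\gamma(G) \;\geq\; 1-\frac{2}{3\,g_{odd}(G)+2}.$$
   Context: All graphs are finite and simple. For a graph $G$ with $m\ge 1$ edges, $\gamma(G)$ denotes the largest fraction of the edges of $G$ that can be $3$-edge-coloured, i.e. $\gamma(G)=\max |E(H)|/m$, where the maximum is over all subgraphs $H$ of $G$ that admit a proper edge-colouring with $3$ colours. The odd girth $g_{odd}(G)$ is the length of a shortest odd cycle of $G$. *)

theory Defs
  imports Main "HOL-Library.Disjoint_Sets" Complex_Main
begin

definition simple_graph :: "'a set \<Rightarrow> 'a set set \<Rightarrow> bool" where
  "simple_graph V E \<longleftrightarrow> finite V \<and>
     (\<forall>e\<in>E. \<exists>u v. u \<in> V \<and> v \<in> V \<and> u \<noteq> v \<and> e = {u, v})"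

definition adj :: "'a set set \<Rightarrow> 'a \<Rightarrow> 'a \<Rightarrow> bool" where
  "adj E u v \<longleftrightarrow> u \<noteq> v \<and> {u, v} \<in> E"

definition degree :: "'a set set \<Rightarrow> 'a \<Rightarrow> nat" where
  "degree E v = card {e \<in> E. v \<in> e}"

definition max_degree :: "'a set \<Rightarrow> 'a set set \<Rightarrow> nat" where
  "max_degree V E = Max (degree E ` V)"

definition connected_graph :: "'a set \<Rightarrow> 'a set set \<Rightarrow> bool" where
  "connected_graph V E \<longleftrightarrow> V \<noteq> {} \<and> (\<forall>u\<in>V. \<forall>v\<in>V. (adj E)\<^sup>*\<^sup>* u v)"

definition is_cycle :: "'a set set \<Rightarrow> 'a list \<Rightarrow> bool" where
  "is_cycle E cs \<longleftrightarrow> length cs \<ge> 3 \<and> distinct cs \<and>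
     (\<forall>i < length cs. adj E (cs ! i) (cs ! ((i + 1) mod length cs)))"

definition has_odd_cycle :: "'a set set \<Rightarrow> bool" where
  "has_odd_cycle E \<longleftrightarrow> (\<exists>cs. is_cycle E cs \<and> odd (length cs))"

definition odd_girth :: "'a set set \<Rightarrow> nat" where
  "odd_girth E = (LEAST k. \<exists>cs. is_cycle E cs \<and> length cs = k \<and> odd k)"

definition three_edge_colourable :: "'a set set \<Rightarrow> bool" where
  "three_edge_colourable F \<longleftrightarrow> (\<exists>c :: 'a set \<Rightarrow> nat.
     (\<forall>e\<in>F. c e < 3) \<and>
     (\<forall>e\<in>F. \<forall>e'\<in>F. e \<noteq> e' \<and> e \<inter> e' \<noteq> {} \<longrightarrow> c e \<noteq> c e'))"

text \<open>gamma(G): the largest fraction of edges of G lying in a 3-edge-colourable subgraph.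
  (A subgraph's colourability depends only on its edge set, so we maximise over edge subsets.)\<close>
definition gamma :: "'a set set \<Rightarrow> real" where
  "gamma E = Max {real (card F) / real (card E) | F. F \<subseteq> E \<and> three_edge_colourable F}"

definition graph_iso :: "'a set \<Rightarrow> 'a set set \<Rightarrow> 'b set \<Rightarrow> 'b set set \<Rightarrow> bool" where
  "graph_iso V E V' E' \<longleftrightarrow> (\<exists>f. bij_betw f V V' \<and>
     (\<forall>u\<in>V. \<forall>v\<in>V. {u, v} \<in> E \<longleftrightarrow> {f u, f v} \<in> E'))"

text \<open>Petersen graph: Kneser graph K(5,2).\<close>
definition petersen_V :: "nat set set" where
  "petersen_V = {S. S \<subseteq> {0..<5} \<and> card S = 2}"

definition petersen_E :: "nat set set set" where
  "petersen_E = {{S, T} | S T. S \<in> petersen_V \<and> T \<in> petersen_V \<and> S \<inter> T = {}}"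

end

theory Submission
  imports Defs
begin

text \<open>Take a 3-edge-colouring with as few uncoloured edges as possible. By a Kempe chain argument an
  uncoloured edge \<open>e\<close> closes an odd cycle whose other edges use two colours, while all edges leaving
  the cycle have the third colour \<open>c\<close>; any edge of the cycle may take over the role of \<open>e\<close>, and cycles
  of different uncoloured edges are disjoint. It remains to show that each uncoloured edge accounts on
  average for a degree sum of at least \<open>3 g + 2\<close>, where \<open>g\<close> is the odd girth.

  If \<open>e\<close> has an end of degree 2, then there are two such cycles and their union has this degree sum.
  Otherwise the colouring can be chosen such that all vertices of the cycle have degree 3, which leaves
  only chordless cycles of length \<open>g\<close>, with degree sum \<open>3 g\<close>. Such a cycle receives the missing two
  units along edges to vertices on no cycle, unless almost all edges leaving it go to the support of one
  other uncoloured edge. If that support is not such a short cycle itself, it has enough surplus to pay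
  for all cycles attached to it. If it is, then either a vertex outside contributes its whole degree, or
  the graph consists of two \<open>g\<close>-cycles joined by a perfect matching. In the latter case consecutive
  vertices of one cycle are matched to vertices at distance 3 on the other, in both directions, so that
  \<open>g\<close> divides 8 or 10 and the graph is the Petersen graph.\<close>

text \<open>The target \<open>3 g + 2\<close> comes from double counting: the degrees add up to
  \<open>2 m\<close>, so if each of \<open>k\<close> uncoloured edges accounts for
  \<open>3 g + 2\<close> of this sum, then \<open>k / m \<le> 2 / (3 g + 2)\<close>. A shortest odd
  cycle all of whose vertices have degree 3 falls short of the target by exactly two units. In the
  Petersen graph two such 5-cycles use up the whole degree sum 30, so the missing units cannot come
  from the cycle itself; they depend on where the edges leaving it go. This is accessible because
  moving an uncoloured edge along its cycle changes colours on that cycle only. As the cycles are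
  disjoint, several of them can be recoloured independently, each so that a prescribed colour
  becomes free at a prescribed vertex. A Kempe chain that enters such a cycle through an edge
  leaving it can thus be made to stop there, and a chain that starts at one end of an uncoloured
  edge and stops before the other end contradicts optimality.\<close>

locale subcubic =
  fixes V :: "'a set" and E :: "'a set set"
  assumes simple: "simple_graph V E" and degree_le: "degree E v \<le> 3"
begin

lemma finite_V: "finite V"
  using simple by (simp add: simple_graph_def)

lemma edgeE:
  assumes "e \<in> E" obtains u w where "u \<noteq> w" "e = {u, w}" "u \<in> V" "w \<in> V"
  using simple assms unfolding simple_graph_def by metis

lemma edge_neq: "{u, w} \<in> E \<Longrightarrow> u \<noteq> w"
  by (metis edgeE doubleton_eq_iff)

lemma edge_in_V: "{u, w} \<in> E \<Longrightarrow> u \<in> V"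
  by (metis edgeE doubleton_eq_iff)

lemma edge_at: assumes "e \<in> E" "x \<in> e" obtains w where "e = {x, w}" "w \<noteq> x"
  using assms by (metis edgeE insert_commute insert_iff singletonD)

lemma finite_E: "finite E"
proof (rule finite_subset)
  show "E \<subseteq> Pow V" by (metis edgeE Pow_iff empty_subsetI insert_subset subsetI)
qed (simp add: finite_V)

lemma card_le_degree: "(\<And>e. e \<in> A \<Longrightarrow> e \<in> E \<and> v \<in> e) \<Longrightarrow> card A \<le> degree E v"
  unfolding degree_def by (rule card_mono) (auto simp: finite_E)

lemma three_edges:
  assumes "e1 \<in> E" "e2 \<in> E" "e3 \<in> E" "e4 \<in> E" "v \<in> e1" "v \<in> e2" "v \<in> e3" "v \<in> e4"
    and "distinct [e1, e2, e3]"
  shows "e4 \<in> {e1, e2, e3}"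
proof (rule ccontr)
  assume "e4 \<notin> {e1, e2, e3}"
  then have "card {e1, e2, e3, e4} = 4"
    using assms(9) distinct_card[of "[e1, e2, e3, e4]"] by (simp add: eq_commute)
  moreover have "card {e1, e2, e3, e4} \<le> degree E v"
    using assms by (intro card_le_degree) auto
  ultimately show False using degree_le[of v] by simp
qed

subsection \<open>Partial edge colourings and Kempe chains\<close>

text \<open>Values of at least 3 stand for "no colour", so a partial colouring is a total function
  and only coincidences of values below 3 are conflicts.\<close>

definition proper :: "('a set \<Rightarrow> nat) \<Rightarrow> bool" where
  "proper \<phi> \<longleftrightarrow> (\<forall>e\<in>E. \<forall>e'\<in>E. e \<noteq> e' \<and> e \<inter> e' \<noteq> {} \<and> \<phi> e < 3 \<longrightarrow> \<phi> e \<noteq> \<phi> e')"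

definition uncoloured :: "('a set \<Rightarrow> nat) \<Rightarrow> 'a set set" where
  "uncoloured \<phi> = {e \<in> E. 3 \<le> \<phi> e}"

definition optimal :: "('a set \<Rightarrow> nat) \<Rightarrow> bool" where
  "optimal \<phi> \<longleftrightarrow> proper \<phi> \<and> (\<forall>\<psi>. proper \<psi> \<longrightarrow> card (uncoloured \<phi>) \<le> card (uncoloured \<psi>))"

definition missing :: "('a set \<Rightarrow> nat) \<Rightarrow> 'a \<Rightarrow> nat \<Rightarrow> bool" where
  "missing \<phi> v c \<longleftrightarrow> (\<forall>e\<in>E. v \<in> e \<longrightarrow> \<phi> e \<noteq> c)"

lemma finite_uncoloured: "finite (uncoloured \<phi>)"
  by (simp add: uncoloured_def finite_E)

lemma proper_at:
  "\<lbrakk>proper \<phi>; e \<in> E; e' \<in> E; v \<in> e; v \<in> e'; \<phi> e = \<phi> e'; \<phi> e < 3\<rbrakk> \<Longrightarrow> e = e'"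
  unfolding proper_def by blast

lemma properI:
  assumes "\<And>e e' v. \<lbrakk>e \<in> E; e' \<in> E; v \<in> e; v \<in> e'; e \<noteq> e'; \<phi> e = \<phi> e'; \<phi> e < 3\<rbrakk> \<Longrightarrow> False"
  shows "proper \<phi>"
  unfolding proper_def using assms by blast

lemma optimal_proper: "optimal \<phi> \<Longrightarrow> proper \<phi>"
  by (simp add: optimal_def)

lemma optimalI: "\<lbrakk>optimal \<phi>; proper \<psi>; card (uncoloured \<psi>) \<le> card (uncoloured \<phi>)\<rbrakk> \<Longrightarrow> optimal \<psi>"
  unfolding optimal_def by (meson order_trans)

lemma proper_recolour:
  assumes "proper \<phi>" "missing \<phi> x a" "missing \<phi> y a"
  shows "proper (\<phi>({x, y} := a))"
proof (rule properI)
  fix e e' v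
  assume *: "e \<in> E" "e' \<in> E" "v \<in> e" "v \<in> e'" "e \<noteq> e'" "(\<phi>({x, y} := a)) e = (\<phi>({x, y} := a)) e'"
    "(\<phi>({x, y} := a)) e < 3"
  consider "e = {x, y}" | "e' = {x, y}" | "e \<noteq> {x, y}" "e' \<noteq> {x, y}" by blast
  then show False
  proof cases
    case 1
    then show False using * assms by (auto simp: missing_def)
  next
    case 2
    then show False using * assms by (auto simp: missing_def)
  next
    case 3
    then show False using * proper_at[OF assms(1)] by auto
  qed
qed

lemma optimal_recolour:
  assumes "optimal \<phi>" "missing \<phi> x a" "missing \<phi> y a" "a < 3"
  shows "optimal (\<phi>({x, y} := a))"
proof (rule optimalI[OF assms(1)])
  show "proper (\<phi>({x, y} := a))"
    by (rule proper_recolour) (use assms optimal_proper in auto)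
  show "card (uncoloured (\<phi>({x, y} := a))) \<le> card (uncoloured \<phi>)"
    by (rule card_mono[OF finite_uncoloured]) (use assms(4) in \<open>auto simp: uncoloured_def\<close>)
qed

text \<open>Giving the edge the colour absent at both ends would leave fewer uncoloured edges. The
  later contradictions with optimality all come down to this.\<close>

lemma no_common_missing:
  assumes "optimal \<phi>" "{x, y} \<in> uncoloured \<phi>" "missing \<phi> x a" "missing \<phi> y a" "a < 3"
  shows False
proof -
  have "proper (\<phi>({x, y} := a))"
    by (rule proper_recolour) (use assms optimal_proper in auto)
  moreover have "uncoloured (\<phi>({x, y} := a)) \<subset> uncoloured \<phi>"
    using assms(2,5) by (auto simp: uncoloured_def)
  ultimately show False
    using assms(1) psubset_card_mono[OF finite_uncoloured] unfolding optimal_def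
    by (meson linorder_not_le)
qed

definition swap_colour :: "nat \<Rightarrow> nat \<Rightarrow> nat \<Rightarrow> nat" where
  "swap_colour a b k = (if k = a then b else if k = b then a else k)"

text \<open>A union of Kempe chains is given by its vertex set \<open>K\<close>. All edges meeting
  \<open>K\<close> are treated alike: for closed \<open>K\<close> those of colours \<open>a\<close>
  and \<open>b\<close> lie inside \<open>K\<close>, and the swap fixes every other value.\<close>

definition kempe :: "('a set \<Rightarrow> nat) \<Rightarrow> nat \<Rightarrow> nat \<Rightarrow> 'a set \<Rightarrow> 'a set \<Rightarrow> nat" where
  "kempe \<phi> a b K e = (if e \<inter> K \<noteq> {} then swap_colour a b (\<phi> e) else \<phi> e)"

definition kempe_closed :: "('a set \<Rightarrow> nat) \<Rightarrow> nat \<Rightarrow> nat \<Rightarrow> 'a set \<Rightarrow> bool" where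
  "kempe_closed \<phi> a b K \<longleftrightarrow>
     (\<forall>e\<in>E. \<phi> e = a \<or> \<phi> e = b \<longrightarrow> e \<inter> K \<noteq> {} \<longrightarrow> e \<subseteq> K)"

lemma swap_colour_eq_iff: "swap_colour a b k = swap_colour a b k' \<longleftrightarrow> k = k'"
  by (auto simp: swap_colour_def)

lemma swap_colour_less: "\<lbrakk>a < 3; b < 3\<rbrakk> \<Longrightarrow> swap_colour a b k < 3 \<longleftrightarrow> k < 3"
  by (auto simp: swap_colour_def)

lemma kempe_closedI:
  assumes "\<And>u w. \<lbrakk>u \<in> K; {u, w} \<in> E; \<phi> {u, w} = a \<or> \<phi> {u, w} = b\<rbrakk> \<Longrightarrow> w \<in> K"
  shows "kempe_closed \<phi> a b K"
  unfolding kempe_closed_def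
proof (intro ballI impI)
  fix e assume *: "e \<in> E" "\<phi> e = a \<or> \<phi> e = b" "e \<inter> K \<noteq> {}"
  then obtain u where u: "u \<in> e" "u \<in> K" by blast
  obtain w where "e = {u, w}" using edge_at[OF *(1) u(1)] by blast
  then show "e \<subseteq> K" using assms[of u w] * u by auto
qed

lemma proper_kempe:
  assumes "proper \<phi>" "kempe_closed \<phi> a b K" "a < 3" "b < 3"
  shows "proper (kempe \<phi> a b K)"
proof (rule properI)
  fix e e' v
  assume *: "e \<in> E" "e' \<in> E" "v \<in> e" "v \<in> e'" "e \<noteq> e'" "kempe \<phi> a b K e = kempe \<phi> a b K e'"
    "kempe \<phi> a b K e < 3"
  have outside: "kempe \<phi> a b K e = \<phi> e" if "v \<notin> K" "e \<in> E" "v \<in> e" for e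
    using that assms(2) by (auto simp: kempe_def kempe_closed_def swap_colour_def)
  have inside: "kempe \<phi> a b K e = swap_colour a b (\<phi> e)" if "v \<in> K" "v \<in> e" for e
    using that by (auto simp: kempe_def)
  show False
  proof (cases "v \<in> K")
    case True
    then have "\<phi> e = \<phi> e'" "\<phi> e < 3"
      using * inside[of e] inside[of e'] assms(3,4) by (simp_all add: swap_colour_eq_iff swap_colour_less)
    then show False using * proper_at[OF assms(1)] by blast
  next
    case False
    then show False using * outside[of e] outside[of e'] proper_at[OF assms(1), of e e' v] by auto
  qed
qed

lemma uncoloured_kempe: "\<lbrakk>a < 3; b < 3\<rbrakk> \<Longrightarrow> uncoloured (kempe \<phi> a b K) = uncoloured \<phi>"
  by (auto simp: uncoloured_def kempe_def swap_colour_def split: if_splits)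

lemma optimal_kempe:
  "\<lbrakk>optimal \<phi>; kempe_closed \<phi> a b K; a < 3; b < 3\<rbrakk> \<Longrightarrow> optimal (kempe \<phi> a b K)"
  by (rule optimalI) (auto simp: uncoloured_kempe intro: proper_kempe optimal_proper)

lemma missing_kempe_inside:
  "\<lbrakk>missing \<phi> v a; v \<in> K\<rbrakk> \<Longrightarrow> missing (kempe \<phi> a b K) v b"
  by (auto simp: missing_def kempe_def swap_colour_def)

lemma missing_kempe_outside:
  "\<lbrakk>missing \<phi> v c; v \<notin> K; kempe_closed \<phi> a b K\<rbrakk> \<Longrightarrow> missing (kempe \<phi> a b K) v c"
  by (auto simp: missing_def kempe_def swap_colour_def kempe_closed_def)

text \<open>The swap on \<open>K\<close> makes \<open>b\<close> absent at \<open>x\<close> and does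
  not affect \<open>y\<close>, so both ends of the uncoloured edge would miss
  \<open>b\<close>.\<close>

lemma kempe_separation:
  assumes "optimal \<phi>" "{x, y} \<in> uncoloured \<phi>" "missing \<phi> x a" "missing \<phi> y b" "a < 3" "b < 3"
    and "kempe_closed \<phi> a b K" "x \<in> K" "y \<notin> K"
  shows False
proof (rule no_common_missing)
  show "optimal (kempe \<phi> a b K)" using assms optimal_kempe by blast
  show "{x, y} \<in> uncoloured (kempe \<phi> a b K)" using assms by (simp add: uncoloured_kempe)
  show "missing (kempe \<phi> a b K) x b" using assms missing_kempe_inside by blast
  show "missing (kempe \<phi> a b K) y b" using assms missing_kempe_outside by blast
qed (rule assms)


subsection \<open>Odd cycles and their rotation\<close>

text \<open>A cycle is a map on the integers that is injective modulo its length, so that indices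
  never wrap around and shifts and reflections are substitutions. Odd length is built in.\<close>

definition cyc :: "nat \<Rightarrow> (int \<Rightarrow> 'a) \<Rightarrow> bool" where
  "cyc l v \<longleftrightarrow> odd l \<and> 3 \<le> l \<and> (\<forall>i j. v i = v j \<longleftrightarrow> i mod int l = j mod int l) \<and>
     (\<forall>i. {v i, v (i + 1)} \<in> E)"

definition cedges :: "(int \<Rightarrow> 'a) \<Rightarrow> 'a set set" where
  "cedges v = range (\<lambda>i. {v i, v (i + 1)})"

lemma cycD:
  assumes "cyc l v"
  shows "odd l" "3 \<le> l" "v i = v j \<longleftrightarrow> i mod int l = j mod int l" "{v i, v (i + 1)} \<in> E"
    "{v (i - 1), v i} \<in> E"
  using assms unfolding cyc_def by (auto dest: spec[of _ "i - 1"])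

lemma cyc_eq_dvd: "cyc l v \<Longrightarrow> v i = v j \<longleftrightarrow> int l dvd i - j"
  by (simp add: cycD(3) mod_eq_dvd_iff)

lemma cyc_neq: assumes "cyc l v" "0 < j" "j < int l" shows "v (i + j) \<noteq> v i"
  using assms by (auto simp: cyc_eq_dvd dest: zdvd_imp_le)

lemma cyc_neq1: "cyc l v \<Longrightarrow> v (i + 1) \<noteq> v i"
  by (rule cyc_neq) (auto simp: cyc_def)

lemma cyc_neq2: "cyc l v \<Longrightarrow> v (i + 1) \<noteq> v (i - 1)"
  using cyc_neq[of l v 2 "i - 1"] cycD(2)[of l v] by (simp add: algebra_simps)

lemma cyc_mod: "cyc l v \<Longrightarrow> v (i mod int l) = v i"
  by (simp add: cycD(3))

lemma cedges_iff: "e \<in> cedges v \<longleftrightarrow> (\<exists>i. e = {v i, v (i + 1)})"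
  by (auto simp: cedges_def)

lemma cedges_subset: "cyc l v \<Longrightarrow> cedges v \<subseteq> E"
  by (auto simp: cedges_def cycD)

lemma cedges_range: "e \<in> cedges v \<Longrightarrow> e \<subseteq> range v"
  by (auto simp: cedges_def)

lemma cedge_in: "{v i, v (i + 1)} \<in> cedges v" "{v (i - 1), v i} \<in> cedges v"
  unfolding cedges_iff by (blast, rule exI[of _ "i - 1"], simp)

text \<open>Edges are thus indexed by residues modulo \<open>l\<close>, which is what makes a
  colouring by index well defined. Agreement in reverse order would force \<open>l\<close> to divide
  2.\<close>

lemma cedge_eq_iff:
  assumes "cyc l v"
  shows "{v i, v (i + 1)} = {v j, v (j + 1)} \<longleftrightarrow> i mod int l = j mod int l"
proof
  assume eq: "{v i, v (i + 1)} = {v j, v (j + 1)}"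
  have "\<not> (v i = v (j + 1) \<and> v (i + 1) = v j)"
  proof
    assume *: "v i = v (j + 1) \<and> v (i + 1) = v j"
    then have "int l dvd i - (j + 1)" "int l dvd (i + 1) - j" using assms cyc_eq_dvd by auto
    then have "int l dvd ((i + 1) - j) - (i - (j + 1))" by (rule dvd_diff[rotated])
    then have "int l dvd 2" by simp
    then show False using assms zdvd_imp_le[of "int l" 2] by (simp add: cyc_def)
  qed
  then have "v i = v j" using eq by (auto simp: doubleton_eq_iff)
  then show "i mod int l = j mod int l" using assms cycD by blast
next
  assume "i mod int l = j mod int l"
  then have "v i = v j" "v (i + 1) = v (j + 1)"
    by (simp_all only: cyc_eq_dvd[OF assms] mod_eq_dvd_iff add_diff_cancel_right)
  then show "{v i, v (i + 1)} = {v j, v (j + 1)}" by simp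
qed

lemma cedges_at:
  assumes "cyc l v" "e \<in> cedges v" "v i \<in> e"
  shows "e = {v i, v (i + 1)} \<or> e = {v (i - 1), v i}"
proof -
  obtain j where j: "e = {v j, v (j + 1)}" using assms(2) cedges_iff by auto
  consider "v i = v j" | "v i = v (j + 1)" using j assms(3) by blast
  then show ?thesis
  proof cases
    case 1
    then have "e = {v i, v (i + 1)}" using j assms(1) cedge_eq_iff cycD(3) by metis
    then show ?thesis by simp
  next
    case 2
    then have "int l dvd i - (j + 1)" using assms(1) cyc_eq_dvd by blast
    then have "v (i - 1) = v j" using cyc_eq_dvd[OF assms(1), of "i - 1" j] by (simp add: algebra_simps)
    then show ?thesis using 2 j by simp
  qed
qed

lemma range_cyc: assumes "cyc l v" shows "range v = v ` {0..<int l}"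
proof -
  have "v i \<in> v ` {0..<int l}" for i
    using assms cyc_mod[OF assms, of i] by (intro image_eqI[of _ _ "i mod int l"]) (auto simp: cyc_def)
  then show ?thesis by auto
qed

lemma inj_on_cyc: "cyc l v \<Longrightarrow> inj_on v {0..<int l}"
  by (auto simp: inj_on_def cycD(3))

lemma card_range_cyc: "cyc l v \<Longrightarrow> card (range v) = l"
  by (simp add: range_cyc card_image inj_on_cyc)

lemma finite_range_cyc: "cyc l v \<Longrightarrow> finite (range v)"
  by (simp add: range_cyc)

lemma range_cyc_V: "cyc l v \<Longrightarrow> range v \<subseteq> V"
  using cycD(4) edge_in_V by blast

lemma cyc_shift:
  assumes "cyc l v"
  shows "cyc l (\<lambda>i. v (i + k))" "range (\<lambda>i. v (i + k)) = range v" "cedges (\<lambda>i. v (i + k)) = cedges v"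
proof -
  have "v (i + k) = v (j + k) \<longleftrightarrow> i mod int l = j mod int l" for i j
    using assms by (simp add: cyc_eq_dvd mod_eq_dvd_iff)
  moreover have "{v (i + k), v (i + 1 + k)} \<in> E" for i
    using cycD(4)[OF assms, of "i + k"] by (simp add: algebra_simps)
  ultimately show "cyc l (\<lambda>i. v (i + k))" using assms unfolding cyc_def by blast
  show "range (\<lambda>i. v (i + k)) = range v"
  proof (intro set_eqI iffI; elim rangeE)
    fix x i assume "x = v i"
    then have "x = v ((i - k) + k)" by simp
    then show "x \<in> range (\<lambda>i. v (i + k))" by blast
  qed auto
  show "cedges (\<lambda>i. v (i + k)) = cedges v"
    unfolding cedges_def
  proof (intro set_eqI iffI; elim imageE)
    fix e i assume "e = {v (i + k), v (i + 1 + k)}"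
    then have "e = {v (i + k), v ((i + k) + 1)}" by (simp add: algebra_simps)
    then show "e \<in> range (\<lambda>i. {v i, v (i + 1)})" by blast
  next
    fix e i assume "e = {v i, v (i + 1)}"
    then have "e = {v ((i - k) + k), v ((i - k) + 1 + k)}" by (simp add: algebra_simps)
    then show "e \<in> range (\<lambda>i. {v (i + k), v (i + 1 + k)})" by blast
  qed
qed

lemma cyc_reflect:
  assumes "cyc l v"
  shows "cyc l (\<lambda>i. v (- i))" "range (\<lambda>i. v (- i)) = range v" "cedges (\<lambda>i. v (- i)) = cedges v"
proof -
  have "v (- i) = v (- j) \<longleftrightarrow> i mod int l = j mod int l" for i j
  proof -
    have "- i - - j = - (i - j)" by simp
    then show ?thesis using assms by (simp only: cyc_eq_dvd mod_eq_dvd_iff dvd_minus_iff)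
  qed
  moreover have "{v (- i), v (- (i + 1))} \<in> E" for i
    using cycD(5)[OF assms, of "- i"] by (simp add: insert_commute)
  ultimately show "cyc l (\<lambda>i. v (- i))" using assms unfolding cyc_def by blast
  show "range (\<lambda>i. v (- i)) = range v"
  proof (intro set_eqI iffI; elim rangeE)
    fix x i assume "x = v i"
    then have "x = v (- (- i))" by simp
    then show "x \<in> range (\<lambda>i. v (- i))" by blast
  qed auto
  show "cedges (\<lambda>i. v (- i)) = cedges v"
    unfolding cedges_def
  proof (intro set_eqI iffI; elim imageE)
    fix e i assume "e = {v (- i), v (- (i + 1))}"
    then have "e = {v (- i - 1), v ((- i - 1) + 1)}" by (simp add: insert_commute)
    then show "e \<in> range (\<lambda>i. {v i, v (i + 1)})" by blast
  next
    fix e i assume "e = {v i, v (i + 1)}"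
    then have "e = {v (- (- i - 1)), v (- ((- i - 1) + 1))}" by (simp add: insert_commute add.commute)
    then show "e \<in> range (\<lambda>i. {v (- i), v (- (i + 1))})" by blast
  qed
qed

text \<open>A shift suffices if the prescribed direction is that of the cycle; otherwise the shifted
  cycle is reflected.\<close>

lemma cyc_normalise:
  assumes "cyc l v" "{x, x'} \<in> cedges v"
  obtains w where "cyc l w" "range w = range v" "cedges w = cedges v" "w 0 = x" "w 1 = x'"
proof -
  obtain i where i: "{x, x'} = {v i, v (i + 1)}" using assms(2) cedges_iff by auto
  consider "x = v i" "x' = v (i + 1)" | "x = v (i + 1)" "x' = v i" using i by (auto simp: doubleton_eq_iff)
  then show ?thesis
  proof cases
    case 1
    then show ?thesis using that[of "\<lambda>j. v (j + i)"] cyc_shift[OF assms(1), of i] by (simp add: add.commute)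
  next
    case 2
    let ?u = "\<lambda>j. v (j + (i + 1))"
    have "cyc l ?u" "range ?u = range v" "cedges ?u = cedges v" using cyc_shift[OF assms(1)] by auto
    then show ?thesis using that[of "\<lambda>j. ?u (- j)"] cyc_reflect[of l ?u] 2 by simp
  qed
qed

text \<open>Edge number 0 loses its colour and the others alternate, beginning with \<open>a\<close>
  at number 1. As \<open>l\<close> is odd, the last one, number \<open>l - 1\<close>, gets
  \<open>b\<close>; so on the cycle \<open>v 0\<close> sees only \<open>b\<close> and
  \<open>v 1\<close> only \<open>a\<close>.\<close>

definition alternating :: "('a set \<Rightarrow> nat) \<Rightarrow> nat \<Rightarrow> (int \<Rightarrow> 'a) \<Rightarrow> nat \<Rightarrow> nat \<Rightarrow> 'a set \<Rightarrow> nat" where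
  "alternating \<phi> l v a b e = (if e \<in> cedges v
     then (let i = (SOME i. e = {v i, v (i + 1)}) mod int l in if i = 0 then 3 else if odd i then a else b)
     else \<phi> e)"

lemma alternating_outside: "e \<notin> cedges v \<Longrightarrow> alternating \<phi> l v a b e = \<phi> e"
  by (simp add: alternating_def)

lemma alternating_cedge:
  assumes "cyc l v"
  shows "alternating \<phi> l v a b {v i, v (i + 1)} =
    (if i mod int l = 0 then 3 else if odd (i mod int l) then a else b)"
proof -
  have "{v i, v (i + 1)} \<in> cedges v" by (simp add: cedge_in)
  moreover have "(SOME j. {v i, v (i + 1)} = {v j, v (j + 1)}) mod int l = i mod int l"
    by (rule someI2[of _ i]) (use assms cedge_eq_iff in auto)
  ultimately show ?thesis by (simp add: alternating_def Let_def)
qed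

text \<open>Unlike \<open>fcyc\<close> below, \<open>wcyc\<close> tolerates further uncoloured edges at the cycle.\<close>

definition wcyc :: "('a set \<Rightarrow> nat) \<Rightarrow> nat \<Rightarrow> nat \<Rightarrow> nat \<Rightarrow> (int \<Rightarrow> 'a) \<Rightarrow> 'a set \<Rightarrow> bool" where
  "wcyc \<phi> a b l v e \<longleftrightarrow> cyc l v \<and> e \<in> cedges v \<and> 3 \<le> \<phi> e \<and> a < 3 \<and> b < 3 \<and> a \<noteq> b \<and>
     (\<forall>t\<in>cedges v. t \<noteq> e \<longrightarrow> \<phi> t = a \<or> \<phi> t = b) \<and>
     (\<forall>t\<in>E - cedges v. t \<inter> range v \<noteq> {} \<longrightarrow> \<phi> t \<noteq> a \<and> \<phi> t \<noteq> b)"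

text \<open>The case that matters is \<open>i mod l = 0\<close>: the preceding edge has index
  \<open>l - 1\<close>, which is even because \<open>l\<close> is odd, and therefore has colour
  \<open>b\<close>.\<close>

lemma alternating_prev:
  assumes "cyc l v"
  shows "alternating \<phi> l v a b {v (i - 1), v i} =
    (if i mod int l = 1 then 3 else if i mod int l = 0 \<or> odd (i mod int l) then b else a)"
proof -
  have l: "odd l" "3 \<le> l" using assms by (auto simp: cyc_def)
  define k where "k = i mod int l"
  have k: "0 \<le> k" "k < int l" using l unfolding k_def by auto
  have *: "(i - 1) mod int l = (if k = 0 then int l - 1 else k - 1)"
  proof -
    have "(i - 1) mod int l = (k - 1) mod int l" unfolding k_def by (simp add: mod_diff_left_eq)
    also have "\<dots> = (if k = 0 then int l - 1 else k - 1)"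
    proof (cases "k = 0")
      case True
      then show ?thesis using l by (simp add: zmod_minus1)
    next
      case False
      then show ?thesis using k by (simp add: mod_pos_pos_trivial)
    qed
    finally show ?thesis .
  qed
  have "alternating \<phi> l v a b {v (i - 1), v (i - 1 + 1)} =
    (if (i - 1) mod int l = 0 then 3 else if odd ((i - 1) mod int l) then a else b)"
    by (rule alternating_cedge[OF assms])
  then show ?thesis using * k l by (auto simp: k_def[symmetric])
qed

text \<open>The recolouring trades \<open>e\<close> for \<open>{v 0, v 1}\<close>. Edges leaving the
  cycle avoid \<open>a\<close> and \<open>b\<close>, so no conflict arises, and the number of
  uncoloured edges does not grow.\<close>

lemma wcyc_alternating:
  assumes opt: "optimal \<phi>" and w: "wcyc \<phi> a b l v e"
  defines "\<psi> \<equiv> alternating \<phi> l v a b"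
  shows "optimal \<psi>" "wcyc \<psi> a b l v {v 0, v 1}" "missing \<psi> (v 0) a" "missing \<psi> (v 1) b"
proof -
  have c: "cyc l v" and ab: "a < 3" "b < 3" "a \<noteq> b" and e: "e \<in> cedges v" "3 \<le> \<phi> e"
    and spoke: "\<And>t. \<lbrakk>t \<in> E; t \<notin> cedges v; t \<inter> range v \<noteq> {}\<rbrakk> \<Longrightarrow> \<phi> t \<noteq> a \<and> \<phi> t \<noteq> b"
    and oncyc: "\<And>t. \<lbrakk>t \<in> cedges v; t \<noteq> e\<rbrakk> \<Longrightarrow> \<phi> t = a \<or> \<phi> t = b"
    using w unfolding wcyc_def by auto
  have l: "odd l" "3 \<le> l" using c by (auto simp: cyc_def)
  have out: "\<psi> t = \<phi> t" if "t \<notin> cedges v" for t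
    using that by (simp add: \<psi>_def alternating_outside)
  have nxt: "\<psi> {v i, v (i + 1)} = (if i mod int l = 0 then 3 else if odd (i mod int l) then a else b)" for i
    unfolding \<psi>_def by (rule alternating_cedge[OF c])
  have prv: "\<psi> {v (i - 1), v i} =
      (if i mod int l = 1 then 3 else if i mod int l = 0 \<or> odd (i mod int l) then b else a)" for i
    unfolding \<psi>_def by (rule alternating_prev[OF c])
  have inn: "\<psi> t = 3 \<or> \<psi> t = a \<or> \<psi> t = b" if "t \<in> cedges v" for t
    using that nxt unfolding cedges_iff by auto
  have differ: "\<psi> {v i, v (i + 1)} \<noteq> \<psi> {v (i - 1), v i}" for i
    using nxt[of i] prv[of i] ab by (auto split: if_splits)
  have psi_proper: "proper \<psi>"
  proof (rule properI)
    fix t t' z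
    assume *: "t \<in> E" "t' \<in> E" "z \<in> t" "z \<in> t'" "t \<noteq> t'" "\<psi> t = \<psi> t'" "\<psi> t < 3"
    consider "t \<in> cedges v" "t' \<in> cedges v" | "t \<in> cedges v" "t' \<notin> cedges v"
      | "t \<notin> cedges v" "t' \<in> cedges v" | "t \<notin> cedges v" "t' \<notin> cedges v" by blast
    then show False
    proof cases
      case 1
      then obtain i where i: "z = v i" using * cedges_range by blast
      then have "{t, t'} = {{v i, v (i + 1)}, {v (i - 1), v i}}"
        using cedges_at[OF c] 1 * by blast
      then show False using differ[of i] *(6) by (auto simp: doubleton_eq_iff)
    next
      case 2
      then have "z \<in> range v" using * cedges_range by blast
      then show False using spoke[of t'] inn[OF 2(1)] out[OF 2(2)] * 2 by auto
    next
      case 3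
      then have "z \<in> range v" using * cedges_range by blast
      then show False using spoke[of t] inn[OF 3(2)] out[OF 3(1)] * 3 by auto
    next
      case 4
      then show False using out * proper_at[OF optimal_proper[OF opt]] by metis
    qed
  qed
  have "uncoloured \<psi> \<subseteq> insert {v 0, v 1} (uncoloured \<phi> - {e})"
  proof
    fix t assume t: "t \<in> uncoloured \<psi>"
    show "t \<in> insert {v 0, v 1} (uncoloured \<phi> - {e})"
    proof (cases "t \<in> cedges v")
      case True
      then obtain i where i: "t = {v i, v (i + 1)}" using cedges_iff by auto
      then have "i mod int l = 0 mod int l" using t nxt[of i] ab by (auto simp: uncoloured_def split: if_splits)
      then have "t = {v 0, v 1}" using cedge_eq_iff[OF c, of i 0] i by simp
      then show ?thesis by simp
    next
      case False
      then show ?thesis using t e out by (auto simp: uncoloured_def)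
    qed
  qed
  then have "card (uncoloured \<psi>) \<le> card (insert {v 0, v 1} (uncoloured \<phi> - {e}))"
    by (intro card_mono) (auto simp: finite_uncoloured)
  also have "\<dots> \<le> Suc (card (uncoloured \<phi> - {e}))"
    by (rule card_insert_le_m1) auto
  also have "\<dots> = card (uncoloured \<phi>)"
    using e cedges_subset[OF c] by (intro card_Suc_Diff1) (auto simp: uncoloured_def finite_E)
  finally show opt': "optimal \<psi>" using optimalI[OF opt psi_proper] by blast
  have v01: "{v 0, v 1} \<in> cedges v" using cedge_in(1)[of v 0] by simp
  have "\<psi> {v 0, v 1} = 3" using nxt[of 0] by simp
  moreover have "\<psi> t = a \<or> \<psi> t = b" if t: "t \<in> cedges v" "t \<noteq> {v 0, v 1}" for t
  proof -
    obtain i where i: "t = {v i, v (i + 1)}" using t(1) unfolding cedges_iff by blast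
    then have "i mod int l \<noteq> 0" using cedge_eq_iff[OF c, of i 0] t(2) by auto
    then show ?thesis using nxt[of i] i by auto
  qed
  ultimately show "wcyc \<psi> a b l v {v 0, v 1}"
    unfolding wcyc_def using c v01 ab spoke out by auto
  have miss: "missing \<psi> (v i) k" if "k = a \<or> k = b" "\<psi> {v i, v (i + 1)} \<noteq> k" "\<psi> {v (i - 1), v i} \<noteq> k" for i k
    unfolding missing_def
  proof (intro ballI impI)
    fix t assume t: "t \<in> E" "v i \<in> t"
    show "\<psi> t \<noteq> k"
    proof (cases "t \<in> cedges v")
      case True
      then show ?thesis using cedges_at[OF c True t(2)] that by auto
    next
      case False
      then show ?thesis using spoke[OF t(1) False] t(2) that(1) out by auto
    qed
  qed
  show "missing \<psi> (v 0) a"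
    by (rule miss) (use nxt[of 0] prv[of 0] ab l in auto)
  show "missing \<psi> (v 1) b"
    by (rule miss) (use nxt[of 1] prv[of 1] ab l in auto)
qed

text \<open>The freedom to reverse the cycle decides which end of the new uncoloured edge misses
  which of the two colours.\<close>

lemma wcyc_rotate:
  assumes "optimal \<phi>" "wcyc \<phi> a b l v e" "{x, x'} \<in> cedges v"
  obtains \<psi> where "optimal \<psi>" "\<And>t. t \<notin> cedges v \<Longrightarrow> \<psi> t = \<phi> t" "wcyc \<psi> a b l v {x, x'}"
    "missing \<psi> x a" "missing \<psi> x' b"
proof -
  have "cyc l v" using assms(2) by (simp add: wcyc_def)
  then obtain w where w: "cyc l w" "range w = range v" "cedges w = cedges v" "w 0 = x" "w 1 = x'"
    using cyc_normalise assms(3) by metis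
  then have "wcyc \<phi> a b l w e" using assms(2) by (simp add: wcyc_def)
  from wcyc_alternating[OF assms(1) this] show ?thesis
    using that[of "alternating \<phi> l w a b"] w \<open>cyc l v\<close> by (simp add: alternating_outside wcyc_def)
qed


subsection \<open>The cycle of an uncoloured edge\<close>

lemma missingD: "\<lbrakk>missing \<phi> v c; {v, w} \<in> E\<rbrakk> \<Longrightarrow> \<phi> {v, w} \<noteq> c"
  by (auto simp: missing_def)

text \<open>If \<open>y\<close> were not reachable from \<open>x\<close> along colours
  \<open>a\<close> and \<open>b\<close>, the reachable vertices would form a closed set separating
  the two ends. A walk of least length repeats no vertex.\<close>

lemma kempe_path:
  assumes "optimal \<phi>" "{x, y} \<in> uncoloured \<phi>" "missing \<phi> x a" "missing \<phi> y b" "a < 3" "b < 3"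
  obtains n f where "f 0 = x" "f n = y" "inj_on f {..n}"
    "\<And>i. i < n \<Longrightarrow> {f i, f (Suc i)} \<in> E \<and> (\<phi> {f i, f (Suc i)} = a \<or> \<phi> {f i, f (Suc i)} = b)"
proof -
  define R where "R u w \<longleftrightarrow> {u, w} \<in> E \<and> (\<phi> {u, w} = a \<or> \<phi> {u, w} = b)" for u w
  have "kempe_closed \<phi> a b {z. R\<^sup>*\<^sup>* x z}"
    by (rule kempe_closedI) (auto simp: R_def intro: rtranclp.rtrancl_into_rtrancl)
  then have "R\<^sup>*\<^sup>* x y"
    using kempe_separation[OF assms, of "{z. R\<^sup>*\<^sup>* x z}"] by auto
  then have ex: "\<exists>n. (R ^^ n) x y" by (simp add: rtranclp_power)
  define n where "n = (LEAST n. (R ^^ n) x y)"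
  have least: "n \<le> m" if "(R ^^ m) x y" for m using that unfolding n_def by (rule Least_le)
  have "(R ^^ n) x y" using ex unfolding n_def by (rule LeastI_ex)
  then obtain f where f: "f 0 = x" "f n = y" "\<forall>i<n. R (f i) (f (Suc i))"
    by (auto simp: relpowp_fun_conv)
  have "f i \<noteq> f j" if "i < j" "j \<le> n" for i j
  proof
    assume eq: "f i = f j"
    have "(R ^^ i) x (f i)" unfolding relpowp_fun_conv
      by (rule exI[of _ f]) (use f that in auto)
    moreover have "(R ^^ (n - j)) (f j) y" unfolding relpowp_fun_conv
      by (rule exI[of _ "\<lambda>k. f (j + k)"]) (use f that in auto)
    ultimately have "(R ^^ (i + (n - j))) x y"
      using eq by (auto simp: relpowp_add)
    then show False using least[of "i + (n - j)"] that by simp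
  qed
  then have "inj_on f {..n}" by (intro linorder_inj_onI) auto
  then show ?thesis using that[of f n] f by (auto simp: R_def)
qed

text \<open>The path begins with \<open>b\<close>, since \<open>x\<close> misses \<open>a\<close>,
  and alternates; it ends with \<open>a\<close>, since \<open>y\<close> misses \<open>b\<close>. So
  it has an even number of edges and \<open>{x, y}\<close> closes it to an odd cycle.\<close>

lemma kempe_cycle:
  assumes "optimal \<phi>" "{x, y} \<in> uncoloured \<phi>" "missing \<phi> x a" "missing \<phi> y b" "a < 3" "b < 3"
  obtains l v where "wcyc \<phi> a b l v {x, y}" "kempe_closed \<phi> a b (range v)" "x \<in> range v" "y \<in> range v"
    "\<forall>z\<in>range v. z \<noteq> x \<and> z \<noteq> y \<longrightarrow> \<not> missing \<phi> z a \<and> \<not> missing \<phi> z b"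
proof -
  obtain n f where f: "f 0 = x" "f n = y" "inj_on f {..n}"
    and fe: "\<And>i. i < n \<Longrightarrow> {f i, f (Suc i)} \<in> E"
      "\<And>i. i < n \<Longrightarrow> \<phi> {f i, f (Suc i)} = a \<or> \<phi> {f i, f (Suc i)} = b"
    using kempe_path[OF assms] by metis
  note pr = optimal_proper[OF assms(1)]
  have xy: "x \<noteq> y" "{x, y} \<in> E" "\<not> \<phi> {x, y} < 3"
    using assms(2) edge_neq by (auto simp: uncoloured_def)
  have ab: "a \<noteq> b" using no_common_missing[OF assms(1-3) _ assms(5)] assms(4) by auto
  have n0: "n > 0" using f xy by (cases n) auto
  have col: "\<phi> {f i, f (Suc i)} = (if even i then b else a)" if "i < n" for i
    using that
  proof (induction i)
    case 0
    then show ?case using fe[of 0] missingD[OF assms(3)] f by fastforce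
  next
    case (Suc i)
    have "f i \<noteq> f (Suc (Suc i))"
      using inj_on_eq_iff[OF f(3), of i "Suc (Suc i)"] Suc.prems by auto
    moreover have "f (Suc i) \<noteq> f i"
      using inj_on_eq_iff[OF f(3), of "Suc i" i] Suc.prems by auto
    ultimately have ne: "{f i, f (Suc i)} \<noteq> {f (Suc i), f (Suc (Suc i))}" by (auto simp: doubleton_eq_iff)
    have "\<phi> {f i, f (Suc i)} \<noteq> \<phi> {f (Suc i), f (Suc (Suc i))}"
    proof
      assume "\<phi> {f i, f (Suc i)} = \<phi> {f (Suc i), f (Suc (Suc i))}"
      moreover have "\<phi> {f i, f (Suc i)} < 3" using fe(2)[of i] Suc.prems assms(5,6) by auto
      ultimately show False
        using ne proper_at[OF pr fe(1)[of i] fe(1)[of "Suc i"], of "f (Suc i)"] Suc.prems by auto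
    qed
    then show ?case using Suc fe(2)[of "Suc i"] by auto
  qed
  have "even n"
  proof (rule ccontr)
    assume "odd n"
    then obtain k where k: "n = Suc k" "even k" using n0 by (cases n) auto
    then have "\<phi> {f k, f n} = b" "{f k, f n} \<in> E" using col[of k] fe(1)[of k] by auto
    then show False using assms(4) f(2) by (auto simp: missing_def)
  qed
  \<comment> \<open>The \<open>n\<close> edges of the path and the closing edge
    \<open>{x, y}\<close>, which gets index \<open>n\<close>.\<close>
  define l where "l = Suc n"
  have l: "odd l" "3 \<le> l" using \<open>even n\<close> n0 by (auto simp: l_def elim: evenE)
  define v where "v i = f (nat (i mod int l))" for i
  have vf: "v (int k) = f k" if "k \<le> n" for k using that by (simp add: v_def l_def)
  have mod_range: "0 \<le> i mod int l" "i mod int l < int l" for i using l by auto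
  have v_edge: "{v i, v (i + 1)} = (if nat (i mod int l) < n
      then {f (nat (i mod int l)), f (Suc (nat (i mod int l)))} else {x, y})" for i
  proof -
    have *: "(i + 1) mod int l = (i mod int l + 1) mod int l" by (simp add: mod_add_left_eq)
    have next_mod: "(i + 1) mod int l = (if i mod int l = int n then 0 else i mod int l + 1)"
    proof (cases "i mod int l = int n")
      case True
      moreover have "(int n + 1) mod int l = 0" by (simp add: l_def add.commute)
      ultimately show ?thesis using * by simp
    next
      case False
      then have "0 \<le> i mod int l + 1" "i mod int l + 1 < int l"
        using mod_range[of i] unfolding l_def by linarith+
      then show ?thesis using * False by (metis mod_pos_pos_trivial)
    qed
    have **: "i mod int l \<le> int n" using mod_range[of i] unfolding l_def by linarith
    show ?thesis
    proof (cases "i mod int l = int n")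
      case True
      then show ?thesis using next_mod f by (auto simp: v_def)
    next
      case False
      then have "nat (i mod int l) < n" "nat ((i + 1) mod int l) = Suc (nat (i mod int l))"
        using next_mod ** mod_range[of i] by (auto simp: nat_add_distrib)
      then show ?thesis by (simp add: v_def)
    qed
  qed
  have v_inj: "v i = v j \<longleftrightarrow> i mod int l = j mod int l" for i j
  proof
    assume "v i = v j"
    moreover have "nat (i mod int l) \<le> n" for i using mod_range[of i] unfolding l_def by linarith
    ultimately have "nat (i mod int l) = nat (j mod int l)"
      using inj_onD[OF f(3)] unfolding v_def by (metis atMost_iff)
    then show "i mod int l = j mod int l" using mod_range by (metis eq_nat_nat_iff)
  qed (simp add: v_def)
  have cyc: "cyc l v"
    unfolding cyc_def using l v_inj v_edge fe(1) xy(2) by auto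
  have f_edge: "{f k, f (Suc k)} \<in> cedges v" if "k < n" for k
    using v_edge[of "int k"] that unfolding cedges_iff by (auto intro!: exI[of _ "int k"] simp: l_def)
  have xy_edge: "{x, y} \<in> cedges v"
    using v_edge[of "int n"] unfolding cedges_iff by (auto intro!: exI[of _ "int n"] simp: l_def)
  have rng: "z \<in> range v \<longleftrightarrow> (\<exists>k\<le>n. z = f k)" for z
  proof
    assume "z \<in> range v"
    then obtain i where "z = v i" by blast
    moreover have "nat (i mod int l) \<le> n" using mod_range[of i] unfolding l_def by linarith
    ultimately show "\<exists>k\<le>n. z = f k" unfolding v_def by blast
  qed (use vf in \<open>metis rangeI\<close>)
  \<comment> \<open>Apart from \<open>a\<close> at \<open>x\<close> and \<open>b\<close> at
    \<open>y\<close>, every cycle vertex sees both colours on the cycle itself. By properness, an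
    edge of colour \<open>a\<close> or \<open>b\<close> at a cycle vertex is then an edge of the
    cycle.\<close>
  have at: "(k = 0 \<and> c = a) \<or> (k = n \<and> c = b) \<or> (\<exists>t\<in>cedges v. f k \<in> t \<and> \<phi> t = c)"
    if kc: "k \<le> n" "c = a \<or> c = b" for k c
  proof -
    have nxt: "\<exists>t\<in>cedges v. f k \<in> t \<and> \<phi> t = (if even k then b else a)" if "k < n"
      using f_edge[OF that] col[OF that] by blast
    have prv: "\<exists>t\<in>cedges v. f k \<in> t \<and> \<phi> t = (if even k then a else b)" if "k > 0"
    proof -
      obtain j where "k = Suc j" using \<open>k > 0\<close> by (cases k) auto
      then show ?thesis using f_edge[of j] col[of j] \<open>k \<le> n\<close> by (intro bexI[of _ "{f j, f (Suc j)}"]) auto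
    qed
    consider "k = 0" | "k = n" "k > 0" | "0 < k" "k < n" using kc(1) by linarith
    then show ?thesis
    proof cases
      case 1
      then show ?thesis using kc nxt n0 by auto
    next
      case 2
      then show ?thesis using kc prv \<open>even n\<close> by auto
    next
      case 3
      then show ?thesis using kc nxt prv by (cases "even k") auto
    qed
  qed
  have spoke: "t \<in> cedges v" if sp: "t \<in> E" "z \<in> t" "z \<in> range v" "\<phi> t = a \<or> \<phi> t = b" for t z
  proof -
    obtain k where k: "k \<le> n" "z = f k" using rng \<open>z \<in> range v\<close> by auto
    have "\<not> (k = 0 \<and> \<phi> t = a)" "\<not> (k = n \<and> \<phi> t = b)"
      using assms(3,4) sp k f by (auto simp: missing_def)
    then obtain t' where "t' \<in> cedges v" "z \<in> t'" "\<phi> t' = \<phi> t" using at[OF k(1) sp(4)] k by auto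
    then show ?thesis using proper_at[OF pr sp(1), of t' z] sp cedges_subset[OF cyc] assms(5,6) by auto
  qed
  have "wcyc \<phi> a b l v {x, y}"
    unfolding wcyc_def
  proof (intro conjI ballI impI)
    fix t assume t: "t \<in> cedges v" "t \<noteq> {x, y}"
    then obtain i where "t = {v i, v (i + 1)}" unfolding cedges_iff by blast
    then show "\<phi> t = a \<or> \<phi> t = b" using v_edge[of i] t(2) fe(2) by (auto split: if_splits)
  next
    fix t assume t: "t \<in> E - cedges v" "t \<inter> range v \<noteq> {}"
    then obtain z where "z \<in> t" "z \<in> range v" by blast
    then show "\<phi> t \<noteq> a" "\<phi> t \<noteq> b" using spoke[of t z] t(1) by auto
  qed (simp_all add: cyc xy_edge xy(3) assms(5,6) ab leI)
  moreover have "kempe_closed \<phi> a b (range v)"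
  proof (rule kempe_closedI)
    fix u w assume "u \<in> range v" "{u, w} \<in> E" "\<phi> {u, w} = a \<or> \<phi> {u, w} = b"
    then have "{u, w} \<in> cedges v" using spoke[of "{u, w}" u] by blast
    then show "w \<in> range v" using cedges_range by blast
  qed
  moreover have "\<not> missing \<phi> z a \<and> \<not> missing \<phi> z b" if z: "z \<in> range v" "z \<noteq> x" "z \<noteq> y" for z
  proof -
    obtain k where k: "k \<le> n" "z = f k" using rng z(1) by auto
    then have "k \<noteq> 0" "k \<noteq> n" using z(2,3) f(1,2) by metis+
    then have "\<exists>t\<in>cedges v. z \<in> t \<and> \<phi> t = c" if "c = a \<or> c = b" for c
      using at[OF k(1) that] k(2) by blast
    then have "\<exists>t\<in>E. z \<in> t \<and> \<phi> t = c" if "c = a \<or> c = b" for c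
      using that cedges_subset[OF cyc] by blast
    then show ?thesis unfolding missing_def by blast
  qed
  moreover have "x \<in> range v" "y \<in> range v" using rng f by auto
  ultimately show ?thesis using that by blast
qed

lemma kempe_closed_commute: "kempe_closed \<phi> a b K = kempe_closed \<phi> b a K"
  by (auto simp: kempe_closed_def)

text \<open>At most two of the at most three edges at \<open>y\<close> are coloured.\<close>

lemma exists_missing:
  assumes "e \<in> uncoloured \<phi>" "y \<in> e"
  obtains k where "k < 3" "missing \<phi> y k"
proof (rule ccontr)
  assume no: "\<not> thesis"
  note goal = that
  have *: "\<exists>t\<in>E. y \<in> t \<and> \<phi> t = k" if "k < 3" for k
    using no goal[OF that] by (auto simp: missing_def)
  obtain t0 t1 t2 where t: "t0 \<in> E" "y \<in> t0" "\<phi> t0 = 0" "t1 \<in> E" "y \<in> t1" "\<phi> t1 = 1"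
    "t2 \<in> E" "y \<in> t2" "\<phi> t2 = 2" using *[of 0] *[of 1] *[of 2] by auto
  then have "distinct [t0, t1, t2]" by auto
  then have "e \<in> {t0, t1, t2}" using three_edges t assms by (auto simp: uncoloured_def)
  then show False using assms t by (auto simp: uncoloured_def)
qed

text \<open>With two uncoloured edges at \<open>x\<close>, the vertex \<open>x\<close> sees at most
  one colour \<open>a\<close>, so both far ends \<open>y\<close> and \<open>z\<close> must miss
  \<open>a\<close>. The chain joining \<open>y\<close> to \<open>x\<close> in \<open>a\<close> and
  another colour \<open>b\<close> has inner vertices that see both colours; hence it avoids
  \<open>z\<close> and separates \<open>x\<close> from \<open>z\<close>.\<close>

lemma uncoloured_disjoint:
  assumes "optimal \<phi>" "e \<in> uncoloured \<phi>" "e' \<in> uncoloured \<phi>" "x \<in> e" "x \<in> e'"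
  shows "e = e'"
proof (rule ccontr)
  assume "e \<noteq> e'"
  have E: "e \<in> E" "e' \<in> E" using assms by (auto simp: uncoloured_def)
  obtain y z where y: "e = {x, y}" and z: "e' = {x, z}" using E assms(4,5) edge_at by metis
  have ne: "y \<noteq> z" "x \<noteq> z" using \<open>e \<noteq> e'\<close> y z E edge_neq by auto
  obtain a where a: "\<And>k. \<lbrakk>k < 3; k \<noteq> a\<rbrakk> \<Longrightarrow> missing \<phi> x k" 
  proof (cases "\<exists>t\<in>E. x \<in> t \<and> t \<noteq> e \<and> t \<noteq> e'")
    case True
    then obtain t where t: "t \<in> E" "x \<in> t" "t \<noteq> e" "t \<noteq> e'" by blast
    have "missing \<phi> x k" if "k < 3" "k \<noteq> \<phi> t" for k
      unfolding missing_def
    proof (intro ballI impI)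
      fix s assume "s \<in> E" "x \<in> s"
      then have "s \<in> {e, e', t}" using three_edges[of e e' t s x] t E assms \<open>e \<noteq> e'\<close> by auto
      then show "\<phi> s \<noteq> k" using that assms(2,3) by (auto simp: uncoloured_def)
    qed
    then show ?thesis using that by blast
  next
    case False
    then have "missing \<phi> x k" if "k < 3" for k
      using that assms(2,3) unfolding missing_def uncoloured_def by fastforce
    then show ?thesis using that by blast
  qed
  have far: "missing \<phi> u a \<and> a < 3" if unc: "{x, u} \<in> uncoloured \<phi>" for u
  proof -
    obtain k where k: "k < 3" "missing \<phi> u k" using exists_missing[OF unc, of u] by auto
    then have "k = a" using no_common_missing[OF assms(1) unc _ k(2)] a k(1) by blast
    then show ?thesis using k by simp
  qed
  have ya: "missing \<phi> y a" "a < 3" and za: "missing \<phi> z a" using far[of y] far[of z] assms y z by auto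
  obtain b where b: "b < 3" "b \<noteq> a" using that[of 0] that[of 1] by fastforce
  then have xb: "missing \<phi> x b" using a by blast
  have "{y, x} \<in> uncoloured \<phi>" using assms y by (simp add: insert_commute)
  then obtain l v where "wcyc \<phi> a b l v {y, x}" and
    closed: "kempe_closed \<phi> a b (range v)" and "y \<in> range v" and xv: "x \<in> range v" and
    inner: "\<forall>w\<in>range v. w \<noteq> y \<and> w \<noteq> x \<longrightarrow> \<not> missing \<phi> w a \<and> \<not> missing \<phi> w b"
    by (rule kempe_cycle[OF assms(1) _ ya(1) xb ya(2) b(1)])
  have "z \<notin> range v" using inner za ne by auto
  moreover have "{x, z} \<in> uncoloured \<phi>" using assms(3) z by simp
  moreover have "kempe_closed \<phi> b a (range v)" using closed kempe_closed_commute by blast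
  ultimately show False
    using kempe_separation[OF assms(1) _ xb za b(1) ya(2)] xv by blast
qed

text \<open>Otherwise the uncoloured edge of the cycle could be moved next to \<open>t\<close>,
  giving two uncoloured edges at one vertex.\<close>

lemma wcyc_spoke_coloured:
  assumes "optimal \<phi>" "wcyc \<phi> a b l v e" "t \<in> E" "t \<notin> cedges v" "t \<inter> range v \<noteq> {}"
  shows "\<phi> t < 3"
proof (rule ccontr)
  assume *: "\<not> \<phi> t < 3"
  obtain i where i: "v i \<in> t" using assms(5) by blast
  obtain \<psi> where \<psi>: "optimal \<psi>" "\<And>t. t \<notin> cedges v \<Longrightarrow> \<psi> t = \<phi> t" "wcyc \<psi> a b l v {v i, v (i + 1)}"
    using wcyc_rotate[OF assms(1,2), of "v i" "v (i + 1)"] cedge_in by metis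
  have "t \<in> uncoloured \<psi>" "{v i, v (i + 1)} \<in> uncoloured \<psi>"
    using * assms(3,4) \<psi>(2,3) cedges_subset by (auto simp: uncoloured_def wcyc_def)
  then have "t = {v i, v (i + 1)}" using uncoloured_disjoint[OF \<psi>(1)] i by auto
  then show False using assms(4) cedge_in by auto
qed

text \<open>Only the colour \<open>c\<close> of the edges leaving the cycle is recorded; the two
  colours on the cycle are the remaining ones, in either order.\<close>

definition fcyc :: "('a set \<Rightarrow> nat) \<Rightarrow> nat \<Rightarrow> nat \<Rightarrow> (int \<Rightarrow> 'a) \<Rightarrow> 'a set \<Rightarrow> bool" where
  "fcyc \<phi> c l v e \<longleftrightarrow> cyc l v \<and> e \<in> cedges v \<and> 3 \<le> \<phi> e \<and> c < 3 \<and>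
     (\<forall>t\<in>cedges v. t \<noteq> e \<longrightarrow> \<phi> t < 3 \<and> \<phi> t \<noteq> c) \<and>
     (\<forall>t\<in>E - cedges v. t \<inter> range v \<noteq> {} \<longrightarrow> \<phi> t = c)"

lemma fcycD:
  assumes "fcyc \<phi> c l v e"
  shows "cyc l v" "e \<in> cedges v" "e \<in> uncoloured \<phi>" "c < 3" "e \<in> E"
    "\<lbrakk>t \<in> cedges v; t \<noteq> e\<rbrakk> \<Longrightarrow> \<phi> t < 3 \<and> \<phi> t \<noteq> c"
    "\<lbrakk>t \<in> E; t \<notin> cedges v; x \<in> t; x \<in> range v\<rbrakk> \<Longrightarrow> \<phi> t = c"
proof -
  show "\<lbrakk>t \<in> E; t \<notin> cedges v; x \<in> t; x \<in> range v\<rbrakk> \<Longrightarrow> \<phi> t = c"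
    using assms unfolding fcyc_def by blast
qed (use assms cedges_subset in \<open>auto simp: fcyc_def uncoloured_def\<close>)

lemma wcyc_imp_fcyc:
  assumes "optimal \<phi>" "wcyc \<phi> a b l v e" "c < 3" "c \<noteq> a" "c \<noteq> b"
  shows "fcyc \<phi> c l v e"
proof -
  have *: "a < 3" "b < 3" "a \<noteq> b" using assms(2) by (auto simp: wcyc_def)
  have "\<phi> t = c" if "t \<in> E" "t \<notin> cedges v" "t \<inter> range v \<noteq> {}" for t
  proof -
    have "\<phi> t \<noteq> a" "\<phi> t \<noteq> b" using assms(2) that by (auto simp: wcyc_def)
    then show ?thesis using wcyc_spoke_coloured[OF assms(1,2) that] * assms(3-5) by linarith
  qed
  moreover have "\<phi> t < 3 \<and> \<phi> t \<noteq> c" if "t \<in> cedges v" "t \<noteq> e" for t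
  proof -
    have "\<phi> t = a \<or> \<phi> t = b" using assms(2) that unfolding wcyc_def by blast
    then show ?thesis using * assms(4,5) by auto
  qed
  moreover have "cyc l v \<and> e \<in> cedges v \<and> 3 \<le> \<phi> e" using assms(2) unfolding wcyc_def by blast
  ultimately show ?thesis using assms(3) unfolding fcyc_def by blast
qed

lemma fcyc_imp_wcyc:
  assumes "fcyc \<phi> c l v e" "a < 3" "b < 3" "distinct [a, b, c]"
  shows "wcyc \<phi> a b l v e"
proof -
  have ne: "c \<noteq> a" "c \<noteq> b" "a \<noteq> b" using assms(4) by auto
  have "k = a \<or> k = b" if "k < 3" "k \<noteq> c" for k
    using that assms(2,3) fcycD(4)[OF assms(1)] ne by linarith
  moreover note ne
  ultimately show ?thesis using assms(1-3) unfolding fcyc_def wcyc_def by metis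
qed

lemma fcyc_rotate:
  assumes "optimal \<phi>" "fcyc \<phi> c l v e" "{x, x'} \<in> cedges v" "a < 3" "b < 3" "distinct [a, b, c]"
  obtains \<psi> where "optimal \<psi>" "\<And>t. t \<notin> cedges v \<Longrightarrow> \<psi> t = \<phi> t" "fcyc \<psi> c l v {x, x'}"
    "missing \<psi> x a" "missing \<psi> x' b"
proof -
  have w: "wcyc \<phi> a b l v e" using fcyc_imp_wcyc assms by blast
  show ?thesis
    using wcyc_rotate[OF assms(1) w assms(3)] that wcyc_imp_fcyc[of _ a b l v "{x, x'}" c]
      fcycD(4)[OF assms(2)] assms(6) by (metis distinct_length_2_or_more)
qed

lemma fcyc_exists:
  assumes "optimal \<phi>" "{x, y} \<in> uncoloured \<phi>" "missing \<phi> x a" "missing \<phi> y b"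
    "a < 3" "b < 3" "c < 3" "c \<noteq> a" "c \<noteq> b"
  obtains l v where "fcyc \<phi> c l v {x, y}"
  using kempe_cycle[OF assms(1-6)] wcyc_imp_fcyc[OF assms(1) _ assms(7-9)] by metis

lemma fcyc_cong:
  assumes "fcyc \<phi> c l v e" "\<And>t. t \<inter> range v \<noteq> {} \<Longrightarrow> \<psi> t = \<phi> t"
  shows "fcyc \<psi> c l v e"
proof -
  have "\<psi> t = \<phi> t" if "t \<in> cedges v" for t using that assms(2) cedges_range by (auto simp: cedges_def)
  then show ?thesis using assms unfolding fcyc_def by auto
qed

lemma fcyc_uncoloured_unique:
  assumes "fcyc \<phi> c l v e" "t \<in> uncoloured \<phi>" "x \<in> t" "x \<in> range v"
  shows "t = e"
  using assms fcycD[OF assms(1)] unfolding uncoloured_def by fastforce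

lemma fcyc_end_missing:
  assumes "optimal \<phi>" "fcyc \<phi> c l v e" "x \<in> e" "a < 3" "b < 3" "distinct [a, b, c]"
  shows "missing \<phi> x a \<or> missing \<phi> x b"
proof -
  note f = fcycD[OF assms(2)]
  obtain i where i: "x = v i" using f(2) assms(3) cedges_range by blast
  have "e = {v i, v (i + 1)} \<or> e = {v (i - 1), v i}" using cedges_at[OF f(1,2)] i assms(3) by blast
  then obtain t where t: "\<And>s. \<lbrakk>s \<in> cedges v; x \<in> s\<rbrakk> \<Longrightarrow> s = e \<or> s = t"
    using cedges_at[OF f(1)] i by metis
  have "missing \<phi> x k" if "k < 3" "k \<noteq> c" "k \<noteq> \<phi> t" for k
    unfolding missing_def using f(3,7) t that i by (fastforce simp: uncoloured_def)
  then show ?thesis using assms(4-6) by (metis distinct_length_2_or_more)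
qed

text \<open>Follow the second cycle from the end \<open>x'\<close> of its uncoloured edge until it
  first meets the first cycle. After the first cycle is recoloured to free the third colour at the
  meeting vertex, this segment becomes a whole Kempe chain that contains \<open>x'\<close> but not
  \<open>x\<close>.\<close>

lemma fcyc_disjoint:
  assumes opt: "optimal \<phi>" and v: "fcyc \<phi> c l v e" and w: "fcyc \<phi> d m w e'" and "e \<noteq> e'"
  shows "range v \<inter> range w = {}"
proof (rule ccontr)
  assume meet: "range v \<inter> range w \<noteq> {}"
  obtain x x' where e': "e' = {x, x'}" using fcycD(5)[OF w] by (metis edgeE)
  obtain u where u: "cyc m u" "range u = range w" "cedges u = cedges w" "u 0 = x" "u 1 = x'"
    using cyc_normalise fcycD(1,2)[OF w] e' by metis
  have fu: "fcyc \<phi> d m u e'" using w u unfolding fcyc_def by simp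
  note fvD = fcycD[OF v] and fuD = fcycD[OF fu]
  have e'v: "z \<notin> range v" if "z \<in> e'" for z
    using fcyc_uncoloured_unique[OF v fuD(3) that] \<open>e \<noteq> e'\<close> by auto
  define n where "n = (LEAST n. 1 \<le> n \<and> u (int n) \<in> range v)"
  obtain i where i: "i \<in> {0..<int m}" "u i \<in> range v" 
  proof -
    obtain z where z: "z \<in> range v" "z \<in> u ` {0..<int m}"
      using meet u(2) range_cyc[OF u(1)] by auto
    from z(2) obtain i where "i \<in> {0..<int m}" "z = u i" ..
    then show ?thesis using that z(1) by metis
  qed
  have i0: "i \<noteq> 0" using i(2) e'v u(4) e' by auto
  have ex: "1 \<le> nat i \<and> u (int (nat i)) \<in> range v" using i i0 by auto
  have n: "1 \<le> n" "u (int n) \<in> range v" using LeastI[of "\<lambda>n. 1 \<le> n \<and> u (int n) \<in> range v", OF ex] n_def by auto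
  have "n \<le> nat i" unfolding n_def by (rule Least_le[of "\<lambda>n. 1 \<le> n \<and> u (int n) \<in> range v", OF ex])
  then have nm: "int n < int m" using i by auto
  have before: "u j \<notin> range v" if j: "1 \<le> j" "j < int n" for j
  proof
    assume "u j \<in> range v"
    then have "1 \<le> nat j \<and> u (int (nat j)) \<in> range v" using j by auto
    then have "n \<le> nat j" unfolding n_def by (rule Least_le)
    then show False using j by auto
  qed
  have "n \<noteq> 1" using n(2) e'v[of x'] u(5) e' by auto
  then have n2: "2 \<le> int n" using n(1) by auto
  have pre: "u (int n - 1) \<notin> range v" using before n2 by simp
  have last: "{u (int n - 1), u (int n)} \<in> E" "{u (int n - 1), u (int n)} \<notin> cedges v"
    using cycD(5)[OF u(1)] pre cedges_range by blast+
  then have lastc: "\<phi> {u (int n - 1), u (int n)} = c" using fvD(7) n(2) by blast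
  \<comment> \<open>This edge leaves the first cycle, which gives it colour \<open>c\<close>, and is
    a coloured edge of the second, which excludes \<open>d\<close>.\<close>
  have "{u (int n - 1), u (int n)} \<noteq> e'" using n(2) e'v by auto
  then have "c \<noteq> d" using fuD(6)[OF cedge_in(2)] lastc by auto
  then obtain a where a: "a < 3" "distinct [a, c, d]" "distinct [a, d, c]"
    using that[of 0] that[of 1] that[of 2] fvD(4) fuD(4) by fastforce
  obtain k where k: "u (int n) = v k" using n(2) by auto
  obtain \<psi> where \<psi>: "optimal \<psi>" "\<And>t. t \<notin> cedges v \<Longrightarrow> \<psi> t = \<phi> t"
    "fcyc \<psi> c l v {u (int n), v (k + 1)}" "missing \<psi> (u (int n)) a"
    using fcyc_rotate[OF opt v, of "v k" "v (k + 1)" a d] cedge_in a fuD(4) k by metis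
  have off: "\<psi> t = \<phi> t" if "z \<in> t" "z \<notin> range v" for t z
    using \<psi>(2) that cedges_range by blast
  \<comment> \<open>The chain in colours \<open>a\<close> and \<open>c\<close> ends at
    \<open>u n\<close>, where \<open>a\<close> is now missing and the only edge of colour
    \<open>c\<close> is the one just traversed. At \<open>x'\<close> it ends because
    \<open>{x, x'}\<close> is uncoloured.\<close>
  define K where "K = u ` {1..int n}"
  have closed: "kempe_closed \<psi> a c K"
  proof (rule kempe_closedI)
    fix z t assume z: "z \<in> K" and zt: "{z, t} \<in> E" "\<psi> {z, t} = a \<or> \<psi> {z, t} = c"
    then obtain j where j: "1 \<le> j" "j \<le> int n" "z = u j" unfolding K_def by auto
    show "t \<in> K"
    proof (cases "j = int n")
      case True
      have "\<psi> {z, t} \<noteq> a" using \<psi>(4) zt(1) j True by (auto simp: missing_def)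
      then have zc: "\<psi> {z, t} = c" using zt by auto
      have "{z, t} \<notin> cedges v"
        using zc fcycD(6)[OF \<psi>(3), of "{z, t}"] fcycD(3,4)[OF \<psi>(3)]
        by (cases "{z, t} = {u (int n), v (k + 1)}") (auto simp: uncoloured_def)
      then have "\<phi> {z, t} = c" using \<psi>(2) zc by auto
      then have "{z, t} = {u (int n - 1), u (int n)}"
        using proper_at[OF optimal_proper[OF opt] zt(1) last(1), of "u (int n)"] j True lastc fvD(4) by auto
      then have "t = u (int n - 1)" using True j edge_neq[OF zt(1)] by (auto simp: doubleton_eq_iff)
      then show ?thesis unfolding K_def using n2 by auto
    next
      case False
      then have jn: "u j \<notin> range v" using before j by auto
      then have "\<phi> {z, t} = a \<or> \<phi> {z, t} = c" using off[of z "{z, t}"] zt(2) j by auto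
      then have "\<phi> {z, t} \<noteq> d" and col: "\<phi> {z, t} < 3" using a fvD(4) by auto
      then have "{z, t} \<in> cedges u" using fuD(7)[OF zt(1)] j by blast
      then consider "{z, t} = {u j, u (j + 1)}" | "{z, t} = {u (j - 1), u j}"
        using cedges_at[OF u(1)] j by blast
      then show ?thesis
      proof cases
        case 1
        then have "t = u (j + 1)" using j edge_neq[OF zt(1)] by (auto simp: doubleton_eq_iff)
        then show ?thesis unfolding K_def using j False by auto
      next
        case 2
        then have "t = u (j - 1)" using j edge_neq[OF zt(1)] by (auto simp: doubleton_eq_iff)
        moreover have "j \<noteq> 1" using 2 col u(4,5) e' fuD(3) by (auto simp: uncoloured_def)
        ultimately show ?thesis unfolding K_def using j by auto
      qed
    qed
  qed
  have x'K: "x' \<in> K" unfolding K_def using u(5) n2 by auto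
  have xK: "x \<notin> K"
  proof
    assume "x \<in> K"
    then obtain j where "1 \<le> j" "j \<le> int n" "u j = u 0" unfolding K_def using u(4) by auto
    then show False using cyc_neq[OF u(1), of j 0] nm by auto
  qed
  have unc: "{x, x'} \<in> uncoloured \<psi>" "{x', x} \<in> uncoloured \<psi>"
    using fuD(3) e' off[of x e'] e'v[of x] by (auto simp: uncoloured_def insert_commute)
  have miss: "missing \<psi> z b" if "missing \<phi> z b" "z \<in> e'" for z b
    using that off[OF _ e'v[OF that(2)]] by (auto simp: missing_def)
  have mx: "missing \<psi> x a \<or> missing \<psi> x c" and mx': "missing \<psi> x' a \<or> missing \<psi> x' c"
    using fcyc_end_missing[OF opt fu, of _ a c] a fvD(4) e' miss by auto
  have closed': "kempe_closed \<psi> c a K" using closed by (simp add: kempe_closed_commute)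
  show False
    using mx mx' no_common_missing[OF \<psi>(1) unc(1)] kempe_separation[OF \<psi>(1) unc(2) _ _ _ _ closed x'K xK]
      kempe_separation[OF \<psi>(1) unc(2) _ _ _ _ closed' x'K xK] a(1) fvD(4) by blast
qed


subsection \<open>Odd girth, chords and vertices of degree two\<close>

lemma odd_girth_le: "\<lbrakk>is_cycle E cs; odd (length cs)\<rbrakk> \<Longrightarrow> odd_girth E \<le> length cs"
  unfolding odd_girth_def by (rule Least_le) blast

text \<open>An arc with \<open>k\<close> edges together with the edge joining its ends is a cycle of
  length \<open>k + 1\<close>.\<close>

lemma arc_closing:
  assumes "cyc l v" "2 \<le> k" "k < l" "even k" "{v (i + int k), v i} \<in> E"
  shows "odd_girth E \<le> k + 1"
proof -
  define cs where "cs = map (\<lambda>j. v (i + int j)) [0..<k+1]"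
  have len: "length cs = k + 1" by (simp add: cs_def)
  have nth: "cs ! j = v (i + int j)" if "j < k + 1" for j
    using that by (simp add: cs_def del: upt_Suc)
  have inj: "v (i + int j) = v (i + int j') \<longleftrightarrow> j = j'" if "j < k + 1" "j' < k + 1" for j j'
  proof -
    have "v (i + int j) = v (i + int j') \<longleftrightarrow> int l dvd int j - int j'"
      by (simp add: cyc_eq_dvd[OF assms(1)])
    also have "\<dots> \<longleftrightarrow> int j mod int l = int j' mod int l" by (simp add: mod_eq_dvd_iff)
    also have "\<dots> \<longleftrightarrow> j = j'" using that assms(3) by (simp flip: zmod_int)
    finally show ?thesis .
  qed
  have adj: "adj E a b" if "{a, b} \<in> E" for a b using that edge_neq by (auto simp: adj_def)
  have "is_cycle E cs"
    unfolding is_cycle_def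
  proof (intro conjI allI impI)
    show "3 \<le> length cs" using len assms(2) by simp
    show "distinct cs" unfolding distinct_conv_nth len using nth inj by auto
    fix j assume j: "j < length cs"
    show "adj E (cs ! j) (cs ! ((j + 1) mod length cs))"
    proof (cases "j = k")
      case True
      then show ?thesis using nth[of k] nth[of 0] len adj[OF assms(5)] by simp
    next
      case False
      then have "(j + 1) mod length cs = j + 1" "j + 1 < k + 1" using j len by auto
      then show ?thesis using nth[of j] nth[of "j + 1"] adj[OF cycD(4)[OF assms(1), of "i + int j"]]
        by (simp add: algebra_simps)
    qed
  qed
  then show ?thesis using odd_girth_le[of cs] len assms(4) by simp
qed

lemma cyc_odd_girth: assumes "cyc l v" shows "odd_girth E \<le> l"
proof -
  have "v (0 + int (l - 1)) = v (- 1)" using assms by (simp add: cyc_eq_dvd cyc_def of_nat_diff)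
  then have "{v (0 + int (l - 1)), v 0} \<in> E" using cycD(5)[OF assms, of 0] by simp
  moreover have "2 \<le> l - 1" "l - 1 < l" "even (l - 1)" using cycD(1,2)[OF assms] by auto
  ultimately show ?thesis using arc_closing[OF assms, of "l - 1" 0] by simp
qed

text \<open>A chord divides the odd cycle into two arcs of at least two edges each, one of them
  even. The even arc has at most \<open>l - 2\<close> edges, so with the chord it forms a shorter
  odd cycle.\<close>

lemma cyc_chordless:
  assumes "cyc l v" "l = odd_girth E" "{v i, v j} \<in> E"
  shows "{v i, v j} \<in> cedges v"
proof (rule ccontr)
  assume not: "{v i, v j} \<notin> cedges v"
  have l: "odd l" "3 \<le> l" using assms(1) by (auto simp: cyc_def)
  define k where "k = nat ((j - i) mod int l)"
  have k: "int k = (j - i) mod int l" "k < l" using l by (auto simp: k_def nat_less_iff)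
  have vj: "v (i + int k) = v j"
    using cycD(3)[OF assms(1)] k(1) by (simp add: mod_add_right_eq)
  have vi: "v (j + int (l - k)) = v i"
  proof -
    have "int l dvd (i + int k) - j" using vj cyc_eq_dvd[OF assms(1)] by blast
    then have "int l dvd int l - ((i + int k) - j)" by (rule dvd_diff[OF dvd_refl])
    moreover have "int l - ((i + int k) - j) = (j + int (l - k)) - i" using k(2) by (simp add: of_nat_diff)
    ultimately show ?thesis using cyc_eq_dvd[OF assms(1)] by metis
  qed
  have "k \<noteq> 0" using vj edge_neq[OF assms(3)] by (intro notI) simp
  moreover have "k \<noteq> 1" using vj not cedge_in(1)[of v i] by auto
  moreover have "l - k \<noteq> 1" using vi not cedge_in(1)[of v j] by (auto simp: insert_commute)
  ultimately have "2 \<le> k" "2 \<le> l - k" using k(2) by auto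
  then show False
    using arc_closing[OF assms(1), of k i] arc_closing[OF assms(1), of "l - k" j] vi vj assms(2,3) l k(2)
    by (cases "even k") (auto simp: insert_commute)
qed

lemma cyc_two_le_degree: assumes "cyc l v" "x \<in> range v" shows "2 \<le> degree E x"
proof -
  obtain i where i: "x = v i" using assms(2) by blast
  have "{v i, v (i + 1)} \<noteq> {v (i - 1), v i}"
    using cyc_neq1[OF assms(1), of i] cyc_neq2[OF assms(1), of i] by (auto simp: doubleton_eq_iff)
  then have "card {{v i, v (i + 1)}, {v (i - 1), v i}} = 2" by simp
  moreover have "card {{v i, v (i + 1)}, {v (i - 1), v i}} \<le> degree E x"
    using i cycD(4,5)[OF assms(1)] by (intro card_le_degree) auto
  ultimately show ?thesis by simp
qed

lemma two_cedges:
  assumes "cyc l v" "x \<in> range v"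
  obtains t t' where "t \<in> cedges v" "t' \<in> cedges v" "t \<noteq> t'" "x \<in> t" "x \<in> t'"
    "\<forall>s\<in>cedges v. x \<in> s \<longrightarrow> s = t \<or> s = t'"
proof -
  obtain i where i: "x = v i" using assms(2) by blast
  have "{v i, v (i + 1)} \<noteq> {v (i - 1), v i}"
    using cyc_neq1[OF assms(1), of i] cyc_neq2[OF assms(1), of i] by (auto simp: doubleton_eq_iff)
  then show ?thesis
    using that[of "{v i, v (i + 1)}" "{v (i - 1), v i}"] cedge_in cedges_at[OF assms(1)] i by auto
qed

lemma spoke_unique:
  assumes "cyc l v" "x \<in> range v" "s \<in> E - cedges v" "s' \<in> E - cedges v" "x \<in> s" "x \<in> s'"
  shows "s = s'"
proof -
  obtain t t' where t: "t \<in> cedges v" "t' \<in> cedges v" "t \<noteq> t'" "x \<in> t" "x \<in> t'"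
    by (rule two_cedges[OF assms(1,2)])
  then have "s' \<in> {t, t', s}"
    using assms cedges_subset[OF assms(1)] by (intro three_edges[of _ _ _ _ x]) auto
  then show ?thesis using assms t by auto
qed

lemma degree_eq_3I:
  assumes "t1 \<in> E" "t2 \<in> E" "t3 \<in> E" "x \<in> t1" "x \<in> t2" "x \<in> t3" "distinct [t1, t2, t3]"
  shows "degree E x = 3"
proof -
  have "card {t1, t2, t3} \<le> degree E x" using assms by (intro card_le_degree) auto
  moreover have "card {t1, t2, t3} = 3" using assms(7) by simp
  ultimately show ?thesis using degree_le[of x] by simp
qed

lemma spoke_iff_degree:
  assumes "cyc l v" "x \<in> range v"
  shows "degree E x = 3 \<longleftrightarrow> (\<exists>w. {x, w} \<in> E - cedges v)"
proof -
  obtain t t' where t: "t \<in> cedges v" "t' \<in> cedges v" "t \<noteq> t'" "x \<in> t" "x \<in> t'"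
    "\<forall>s\<in>cedges v. x \<in> s \<longrightarrow> s = t \<or> s = t'"
    by (rule two_cedges[OF assms])
  have tE: "t \<in> E" "t' \<in> E" using t cedges_subset[OF assms(1)] by auto
  show ?thesis
  proof
    assume "degree E x = 3"
    moreover have "card {t, t'} = 2" using t(3) by simp
    ultimately have "\<not> card {e \<in> E. x \<in> e} \<le> card {t, t'}" by (simp add: degree_def)
    then have "\<not> {e \<in> E. x \<in> e} \<subseteq> {t, t'}"
      using card_mono[of "{t, t'}" "{e \<in> E. x \<in> e}"] by blast
    then obtain s where s: "s \<in> E" "x \<in> s" "s \<noteq> t" "s \<noteq> t'" by blast
    then obtain w where "s = {x, w}" using edge_at by metis
    then show "\<exists>w. {x, w} \<in> E - cedges v" using s t(6) by auto
  next
    assume "\<exists>w. {x, w} \<in> E - cedges v"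
    then obtain w where "{x, w} \<in> E" "{x, w} \<notin> cedges v" by blast
    then show "degree E x = 3" using t tE by (intro degree_eq_3I[of t t' "{x, w}"]) auto
  qed
qed

lemma low_degree_cedge:
  assumes "cyc l v" "x \<in> range v" "degree E x \<noteq> 3" "t \<in> E" "x \<in> t"
  shows "t \<in> cedges v"
  using spoke_iff_degree[OF assms(1,2)] assms(3-5) edge_at by (metis DiffI)

lemma fcyc_has_colour:
  assumes "proper \<phi>" "fcyc \<phi> c l v e" "x \<in> range v" "x \<notin> e" "k < 3" "k \<noteq> c"
  obtains w where "{x, w} \<in> cedges v" "\<phi> {x, w} = k" "w \<in> range v"
proof -
  note f = fcycD[OF assms(2)]
  obtain t t' where t: "t \<in> cedges v" "t' \<in> cedges v" "t \<noteq> t'" "x \<in> t" "x \<in> t'"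
    by (rule two_cedges[OF f(1) assms(3)])
  have tE: "t \<in> E" "t' \<in> E" using t cedges_subset[OF f(1)] by auto
  have "\<phi> t < 3 \<and> \<phi> t \<noteq> c" "\<phi> t' < 3 \<and> \<phi> t' \<noteq> c" using f(6) t assms(4) by auto
  moreover have "\<phi> t \<noteq> \<phi> t'" using proper_at[OF assms(1) tE t(4,5)] t(3) calculation by auto
  ultimately have "\<phi> t = k \<or> \<phi> t' = k" using assms(5,6) f(4) by linarith
  then obtain s where s: "s \<in> cedges v" "x \<in> s" "\<phi> s = k" using t by auto
  then obtain w where "s = {x, w}" using edge_at cedges_subset[OF f(1)] by (metis subsetD)
  then show ?thesis using that[of w] s cedges_range[of s v] by auto
qed

lemma fcyc_end_colour:
  assumes "proper \<phi>" "fcyc \<phi> c l v e" "x \<in> e" "a < 3" "b < 3" "distinct [a, b, c]" "missing \<phi> x a"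
  obtains w where "{x, w} \<in> cedges v" "\<phi> {x, w} = b" "w \<in> range v"
proof -
  note f = fcycD[OF assms(2)]
  have xv: "x \<in> range v" using assms(3) f(2) cedges_range by blast
  obtain t t' where t: "t \<in> cedges v" "t' \<in> cedges v" "t \<noteq> t'" "x \<in> t" "x \<in> t'"
    by (rule two_cedges[OF f(1) xv])
  then obtain s where s: "s \<in> cedges v" "x \<in> s" "s \<noteq> e" by metis
  have sE: "s \<in> E" using s cedges_subset[OF f(1)] by auto
  have "\<phi> s < 3" "\<phi> s \<noteq> c" "\<phi> s \<noteq> a" using f(6) s assms(7) sE by (auto simp: missing_def)
  then have "\<phi> s = b" using assms(4-6) f(4) by auto
  moreover obtain w where "s = {x, w}" using edge_at[OF sE s(2)] by metis
  ultimately show ?thesis using that[of w] s cedges_range[of s v] by auto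
qed

text \<open>No edge leaves the cycle at a vertex of degree 2, so such vertices miss
  \<open>c\<close>. If two were adjacent, the uncoloured edge could be moved between them and
  receive \<open>c\<close>.\<close>

lemma low_degree_not_adjacent:
  assumes "optimal \<phi>" "fcyc \<phi> c l v e" "{x, x'} \<in> cedges v" "degree E x \<noteq> 3"
  shows "degree E x' = 3"
proof (rule ccontr)
  assume d: "degree E x' \<noteq> 3"
  note f = fcycD[OF assms(2)]
  obtain a b where ab: "a < 3" "b < 3" "distinct [a, b, c]"
    using f(4) that[of 0 1] that[of 0 2] that[of 1 2] by fastforce
  obtain \<psi> where \<psi>: "optimal \<psi>" "fcyc \<psi> c l v {x, x'}"
    using fcyc_rotate[OF assms(1-3) ab] by metis
  have rng: "x \<in> range v" "x' \<in> range v" using assms(3) cedges_range by auto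
  have "missing \<psi> z c" if "z \<in> range v" "degree E z \<noteq> 3" for z
    unfolding missing_def
  proof (intro ballI impI)
    fix t assume "t \<in> E" "z \<in> t"
    then have "t \<in> cedges v" using low_degree_cedge[OF f(1)] that by blast
    then show "\<psi> t \<noteq> c" using fcycD[OF \<psi>(2)] by (cases "t = {x, x'}") (auto simp: uncoloured_def)
  qed
  then have "missing \<psi> x c" "missing \<psi> x' c" using rng d assms(4) by auto
  then show False using no_common_missing[OF \<psi>(1) fcycD(3)[OF \<psi>(2)]] f(4) by blast
qed

lemma ex_optimal: "\<exists>\<phi>. optimal \<phi>"
proof -
  have "proper (\<lambda>_. 3)" by (simp add: proper_def)
  then show ?thesis
    using ex_has_least_nat[of proper _ "\<lambda>\<phi>. card (uncoloured \<phi>)"] unfolding optimal_def by blast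
qed

text \<open>Read contrapositively: if both ends of an uncoloured edge have degree 3, then so has
  every vertex of its cycle.\<close>

definition good :: "('a set \<Rightarrow> nat) \<Rightarrow> bool" where
  "good \<phi> \<longleftrightarrow> optimal \<phi> \<and> (\<forall>c l v e. fcyc \<phi> c l v e \<longrightarrow> (\<exists>z\<in>range v. degree E z \<noteq> 3) \<longrightarrow>
     (\<exists>u\<in>e. degree E u \<noteq> 3))"

text \<open>Maximise the number of uncoloured edges that have an end of degree 2: otherwise
  rotating a cycle would increase it.\<close>

lemma ex_good: "\<exists>\<phi>. good \<phi>"
proof -
  define A where "A \<phi> = {e \<in> uncoloured \<phi>. \<exists>u\<in>e. degree E u \<noteq> 3}" for \<phi>
  have "card (A \<phi>) \<le> card E" for \<phi>
    by (rule card_mono) (auto simp: A_def uncoloured_def finite_E)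
  then have bound: "\<forall>\<phi>. optimal \<phi> \<longrightarrow> card (A \<phi>) < Suc (card E)" by (simp add: less_Suc_eq_le)
  obtain \<phi>0 where "optimal \<phi>0" using ex_optimal by blast
  from ex_has_greatest_nat[OF this bound] obtain \<phi> where \<phi>: "optimal \<phi>"
    and max: "\<And>\<psi>. optimal \<psi> \<Longrightarrow> card (A \<psi>) \<le> card (A \<phi>)" by blast
  have "\<exists>u\<in>e. degree E u \<noteq> 3" if f: "fcyc \<phi> c l v e" and z: "z \<in> range v" "degree E z \<noteq> 3" for c l v e z
  proof (rule ccontr)
    assume no: "\<not> (\<exists>u\<in>e. degree E u \<noteq> 3)"
    note fD = fcycD[OF f]
    obtain i where i: "z = v i" using z(1) by blast
    let ?t = "{v i, v (i + 1)}"
    obtain a b where ab: "a < 3" "b < 3" "distinct [a, b, c]"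
      using fD(4) that[of 0 1] that[of 0 2] that[of 1 2] by fastforce
    obtain \<psi> where \<psi>: "optimal \<psi>" "\<And>t. t \<notin> cedges v \<Longrightarrow> \<psi> t = \<phi> t" "fcyc \<psi> c l v ?t"
      using fcyc_rotate[OF \<phi> f cedge_in(1)[of v i] ab] by metis
    have "?t \<noteq> e" using no z(2) i by auto
    then have "\<phi> ?t < 3" using fD(6)[OF cedge_in(1)[of v i]] by blast
    then have "?t \<notin> A \<phi>" by (simp add: A_def uncoloured_def)
    moreover have "?t \<in> A \<psi>" using fcycD(3)[OF \<psi>(3)] z(2) i by (auto simp: A_def)
    moreover have "t \<in> A \<psi>" if t: "t \<in> A \<phi>" for t
    proof -
      have "t \<noteq> e" using t no by (auto simp: A_def)
      then have "t \<notin> cedges v" using t fD(6)[of t] by (auto simp: A_def uncoloured_def)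
      then show ?thesis using t \<psi>(2) by (simp add: A_def uncoloured_def)
    qed
    ultimately have "A \<phi> \<subset> A \<psi>" by blast
    then have "card (A \<phi>) < card (A \<psi>)"
      by (rule psubset_card_mono[rotated]) (auto simp: A_def finite_uncoloured)
    then show False using max[OF \<psi>(1)] by simp
  qed
  then show ?thesis using \<phi> unfolding good_def by blast
qed


subsection \<open>Supports at vertices of degree two\<close>

text \<open>This covers a single cycle as well as the union of two cycles of \<open>e\<close> with
  different colours on the edges leaving them.\<close>

definition supported :: "('a set \<Rightarrow> nat) \<Rightarrow> 'a set \<Rightarrow> 'a set \<Rightarrow> bool" where
  "supported \<phi> e S \<longleftrightarrow> (\<forall>z\<in>S. \<exists>c l v. fcyc \<phi> c l v e \<and> z \<in> range v \<and> range v \<subseteq> S)"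

lemma low_degree_misses_two:
  assumes "optimal \<phi>" "e \<in> uncoloured \<phi>" "u \<in> e" "degree E u \<noteq> 3"
  obtains a where "a < 3" "\<forall>k<3. k \<noteq> a \<longrightarrow> missing \<phi> u k"
proof (cases "\<exists>t\<in>E. u \<in> t \<and> t \<noteq> e")
  case True
  then obtain t where t: "t \<in> E" "u \<in> t" "t \<noteq> e" by blast
  have "e \<in> E" using assms(2) by (simp add: uncoloured_def)
  then have *: "s = e \<or> s = t" if "s \<in> E" "u \<in> s" for s
    using degree_eq_3I[of e t s u] t assms(3,4) that by auto
  have "\<phi> t < 3" using uncoloured_disjoint[OF assms(1,2) _ assms(3) t(2)] t by (auto simp: uncoloured_def)
  moreover have "missing \<phi> u k" if "k < 3" "k \<noteq> \<phi> t" for k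
    unfolding missing_def
  proof (intro ballI impI)
    fix s assume "s \<in> E" "u \<in> s"
    then have "s = e \<or> s = t" by (rule *)
    then show "\<phi> s \<noteq> k" using that assms(2) by (auto simp: uncoloured_def)
  qed
  ultimately show ?thesis using that by blast
next
  case False
  then have "missing \<phi> u k" if "k < 3" for k
    using assms(2) that unfolding missing_def uncoloured_def by fastforce
  then show ?thesis using that[of 0] by simp
qed

lemma other_colours:
  assumes "(a::nat) < 3" obtains b c where "b < 3" "c < 3" "distinct [a, b, c]"
proof -
  consider "a = 0" | "a = 1" | "a = 2" using assms by linarith
  then show ?thesis using that[of 1 2] that[of 0 2] that[of 0 1] by cases auto
qed

lemma cedge_subset_E: "cyc l v \<Longrightarrow> t \<in> cedges v \<Longrightarrow> t \<in> E"
  using cedges_subset by blast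

lemma sum_degree_ge:
  assumes "finite A" "\<And>x. x \<in> A \<Longrightarrow> k \<le> degree E x"
  shows "k * card A \<le> (\<Sum>x\<in>A. degree E x)"
  using sum_bounded_below[of A k "degree E"] assms by (simp add: mult.commute)

text \<open>As \<open>u\<close> sees at most one colour \<open>a\<close>, it misses \<open>b\<close>
  and \<open>c\<close>, while \<open>x\<close> misses \<open>a\<close>. So \<open>e\<close> closes a
  cycle in colours \<open>a\<close>, \<open>b\<close> and another in colours \<open>a\<close>,
  \<open>c\<close>. The set \<open>I\<close> is what later keeps part of the degree sum away from
  attached cycles.\<close>

lemma low_degree_support:
  assumes opt: "optimal \<phi>" and e: "e \<in> uncoloured \<phi>" "u \<in> e" and du: "degree E u \<noteq> 3"
  obtains S I where "supported \<phi> e S" "3 * odd_girth E + 2 \<le> (\<Sum>z\<in>S. degree E z)"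
    "I \<subseteq> S" "card I = 3" "\<forall>z\<in>I. \<forall>t\<in>E. z \<in> t \<longrightarrow> t \<subseteq> S"
proof -
  note pr = optimal_proper[OF opt]
  have eE: "e \<in> E" using e by (simp add: uncoloured_def)
  obtain x where ex: "e = {u, x}" "x \<noteq> u" using edge_at[OF eE e(2)] by metis
  obtain a where a: "a < 3" "\<forall>k<3. k \<noteq> a \<longrightarrow> missing \<phi> u k"
    by (rule low_degree_misses_two[OF opt e du])
  obtain k where "k < 3" "missing \<phi> x k" using exists_missing[OF e(1), of x] ex by auto
  then have xa: "missing \<phi> x a" using no_common_missing[OF opt, of u x k] e(1) ex(1) a(2) by metis
  obtain b c where bc: "b < 3" "c < 3" "distinct [a, b, c]" by (rule other_colours[OF a(1)])
  then have ub: "missing \<phi> u b" and uc: "missing \<phi> u c" using a(2) by auto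
  have ux: "{u, x} \<in> uncoloured \<phi>" using e ex by simp
  have ne: "c \<noteq> b" "c \<noteq> a" "b \<noteq> c" "b \<noteq> a" using bc(3) by auto
  obtain l v where "fcyc \<phi> c l v {u, x}"
    by (rule fcyc_exists[OF opt ux ub xa bc(1) a(1) bc(2) ne(1,2)])
  then have v: "fcyc \<phi> c l v e" using ex by simp
  obtain m w where "fcyc \<phi> b m w {u, x}"
    by (rule fcyc_exists[OF opt ux uc xa bc(2) a(1) bc(1) ne(3,4)])
  then have w: "fcyc \<phi> b m w e" using ex by simp
  note vD = fcycD[OF v] and wD = fcycD[OF w]
  note vE = cedge_subset_E[OF vD(1)] and wE = cedge_subset_E[OF wD(1)]
  let ?C = "range v" and ?D = "range w"
  define S where "S = ?C \<union> ?D"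
  have ev: "e \<subseteq> ?C" and ew: "e \<subseteq> ?D" using vD(2) wD(2) cedges_range by auto
  have dx: "degree E x = 3"
    using low_degree_not_adjacent[OF opt v, of u x] vD(2) ex du by simp
  have sup: "supported \<phi> e S"
    unfolding supported_def S_def using v w by blast
  have in_w: "t \<in> cedges w" if "t \<in> E" "z \<in> t" "z \<in> ?D" "\<phi> t \<noteq> b" for t z
    using wD(7)[OF that(1) _ that(2,3)] that(4) by blast
  have in_v: "t \<in> cedges v" if "t \<in> E" "z \<in> t" "z \<in> ?C" "\<phi> t \<noteq> c" for t z
    using vD(7)[OF that(1) _ that(2,3)] that(4) by blast
  \<comment> \<open>\<open>u\<close>, \<open>x\<close> and the second neighbour of \<open>u\<close> lie on both cycles, so that no edge leaves \<open>S\<close> there.\<close>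
  obtain u2 where u2: "{u, u2} \<in> cedges v" "\<phi> {u, u2} = a" "u2 \<in> ?C"
    by (rule fcyc_end_colour[OF pr v e(2) bc(1) a(1) _ ub]) (use bc(3) in auto)
  have u2w: "{u, u2} \<in> cedges w" using in_w[OF vE[OF u2(1)], of u] ew ex u2(2) ne by auto
  then have u2D: "u2 \<in> ?D" using cedges_range by blast
  have u2e: "u2 \<notin> e" using u2(1,2) a(1) e(1) ex edge_neq[OF vE[OF u2(1)]] by (auto simp: uncoloured_def)
  have closed3: "t \<subseteq> S" if "t \<in> E" "z \<in> t" "t1 \<in> cedges v" "z \<in> t1" "t2 \<in> cedges v" "z \<in> t2"
    "t3 \<in> cedges w" "z \<in> t3" "distinct [t1, t2, t3]" for z t t1 t2 t3
  proof -
    have "t \<in> {t1, t2, t3}" using that vE wE by (intro three_edges[of t1 t2 t3 t z]) auto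
    then show ?thesis using that cedges_range unfolding S_def by blast
  qed
  obtain x1 where x1: "{x, x1} \<in> cedges v" "\<phi> {x, x1} = b"
    by (rule fcyc_end_colour[OF pr v _ a(1) bc(1) bc(3) xa]) (use ex in auto)
  obtain x2 where x2: "{x, x2} \<in> cedges w" "\<phi> {x, x2} = c"
    by (rule fcyc_end_colour[OF pr w _ a(1) bc(2) _ xa]) (use ex bc(3) in auto)
  obtain y1 where y1: "{u2, y1} \<in> cedges v" "\<phi> {u2, y1} = b"
    by (rule fcyc_has_colour[OF pr v u2(3) u2e bc(1) ne(3)])
  obtain y2 where y2: "{u2, y2} \<in> cedges w" "\<phi> {u2, y2} = c"
    by (rule fcyc_has_colour[OF pr w u2D u2e bc(2) ne(1)])
  define I where "I = {u, x, u2}"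
  have I: "I \<subseteq> S" "card I = 3"
    using ev ex u2 u2e by (auto simp: I_def S_def)
  have "t \<subseteq> S" if zt: "z \<in> I" "t \<in> E" "z \<in> t" for z t
  proof -
    consider "z = u" | "z = x" | "z = u2" using zt(1) I_def by auto
    then show ?thesis
    proof cases
      case 1
      then have "t \<in> cedges v" using low_degree_cedge[OF vD(1) _ du, of t] ev ex zt by auto
      then show ?thesis using cedges_range unfolding S_def by blast
    next
      case 2
      have "e \<noteq> {x, x1}" "e \<noteq> {x, x2}" "{x, x1} \<noteq> {x, x2}"
        using e(1) x1(2) x2(2) bc ne(3) by (auto simp: uncoloured_def)
      then show ?thesis using closed3[OF zt(2,3) vD(2) _ x1(1) _ x2(1)] ex 2 by auto
    next
      case 3
      have "{u, u2} \<noteq> {u2, y1}" "{u, u2} \<noteq> {u2, y2}" "{u2, y1} \<noteq> {u2, y2}"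
        using u2(2) y1(2) y2(2) ne by auto
      then show ?thesis using closed3[OF zt(2,3) u2(1) _ y1(1) _ y2(1)] 3 by auto
    qed
  qed
  then have I': "\<forall>z\<in>I. \<forall>t\<in>E. z \<in> t \<longrightarrow> t \<subseteq> S" by blast
  have fin: "finite ?C" "finite ?D" using finite_range_cyc vD(1) wD(1) by auto
  \<comment> \<open>Each vertex of degree 2 loses one unit against 3. In
    \<open>?C \<inter> ?D\<close> only \<open>u\<close> does so, in \<open>?C - ?D\<close> at most
    half of the vertices do, and in \<open>?D - ?C\<close> only 2 per vertex is claimed.\<close>
  define p q r where "p = card (?C \<inter> ?D)" and "q = card (?C - ?D)" and "r = card (?D - ?C)"
  define n where "n = card {z \<in> ?C - ?D. degree E z \<noteq> 3}"
  have ge2C: "2 \<le> degree E z" if "z \<in> ?C" for z using cyc_two_le_degree[OF vD(1) that] .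
  have ge2D: "2 \<le> degree E z" if "z \<in> ?D" for z using cyc_two_le_degree[OF wD(1) that] .
  have pq: "p + q = l" using card_range_cyc[OF vD(1)] card_Un_disjoint[of "?C \<inter> ?D" "?C - ?D"] fin
    by (simp add: p_def q_def Int_Diff_Un Int_Diff_disjoint)
  have "card ((?D \<inter> ?C) \<union> (?D - ?C)) = card (?D \<inter> ?C) + card (?D - ?C)"
    by (rule card_Un_disjoint) (use fin in auto)
  moreover have "(?D \<inter> ?C) \<union> (?D - ?C) = ?D" by blast
  ultimately have prm: "p + r = m" using card_range_cyc[OF wD(1)]
    by (metis Int_commute p_def r_def)
  \<comment> \<open>A vertex of degree 2 on both cycles has the same two edges on both. Away from
    \<open>e\<close> one of them has colour \<open>b\<close>, which does not occur on the second
    cycle.\<close>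
  have pdeg: "degree E z = 3" if z: "z \<in> ?C \<inter> ?D" "z \<noteq> u" for z
  proof (rule ccontr)
    assume dz: "degree E z \<noteq> 3"
    then have "z \<notin> e" using z(2) dx ex by auto
    then obtain y where y: "{z, y} \<in> cedges v" "\<phi> {z, y} = b"
      using fcyc_has_colour[OF pr v, of z b] z(1) bc(1) ne(3) by blast
    have "{z, y} \<in> cedges w"
      by (rule low_degree_cedge[OF wD(1) _ dz vE[OF y(1)]]) (use z(1) in auto)
    then have "\<phi> {z, y} \<noteq> b" using wD(6)[of "{z, y}"] \<open>z \<notin> e\<close> by blast
    then show False using y(2) by simp
  qed
  have sumP: "3 * p \<le> (\<Sum>z\<in>?C \<inter> ?D. degree E z) + 1"
  proof -
    have uP: "u \<in> ?C \<inter> ?D" using ev ew ex by auto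
    have "(\<Sum>z\<in>?C \<inter> ?D - {u}. degree E z) = (\<Sum>z\<in>?C \<inter> ?D - {u}. 3)"
      by (rule sum.cong) (use pdeg in auto)
    also have "\<dots> = 3 * (p - 1)" using uP by (simp add: p_def)
    finally have "(\<Sum>z\<in>?C \<inter> ?D. degree E z) = degree E u + 3 * (p - 1)"
      using sum.remove[of "?C \<inter> ?D" u "degree E"] fin uP by simp
    moreover have "2 \<le> degree E u" using ge2C uP by blast
    moreover have "p \<ge> 1" using uP fin card_gt_0_iff[of "?C \<inter> ?D"] unfolding p_def
      by (metis One_nat_def Suc_leI empty_iff finite_Int)
    ultimately show ?thesis by simp
  qed
  \<comment> \<open>An edge of colour \<open>a\<close> at a vertex of \<open>?D\<close> belongs to
    the second cycle, so the edge of colour \<open>a\<close> at \<open>z\<close> stays within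
    \<open>?C - ?D\<close>. It pairs \<open>z\<close> with a vertex of degree 3, whence
    \<open>2 * n \<le> q\<close>.\<close>
  have mate: "\<exists>y. {z, y} \<in> E \<and> \<phi> {z, y} = a \<and> y \<in> ?C - ?D \<and> degree E y = 3"
    if z: "z \<in> ?C - ?D" "degree E z \<noteq> 3" for z
  proof -
    have "z \<notin> e" using z(1) ew by blast
    then obtain y where y: "{z, y} \<in> cedges v" "\<phi> {z, y} = a" "y \<in> ?C"
      using fcyc_has_colour[OF pr v, of z a] z(1) a(1) ne(2) by blast
    have "y \<notin> ?D"
    proof
      assume "y \<in> ?D"
      then have "{z, y} \<in> cedges w" using in_w[OF vE[OF y(1)], of y] y(2) ne(4) by auto
      then show False using z(1) cedges_range by blast
    qed
    moreover have "degree E y = 3" by (rule low_degree_not_adjacent[OF opt v y(1) z(2)])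
    ultimately show ?thesis using y vE by blast
  qed
  have nq: "2 * n \<le> q"
  proof -
    let ?L = "{z \<in> ?C - ?D. degree E z \<noteq> 3}" and ?H = "{z \<in> ?C - ?D. degree E z = 3}"
    have "\<forall>z\<in>?L. \<exists>y. {z, y} \<in> E \<and> \<phi> {z, y} = a \<and> y \<in> ?H" using mate by blast
    from bchoice[OF this] obtain f
      where f: "\<forall>z\<in>?L. {z, f z} \<in> E \<and> \<phi> {z, f z} = a \<and> f z \<in> ?H" ..
    have "inj_on f ?L"
    proof (rule inj_onI)
      fix z z' assume z: "z \<in> ?L" "z' \<in> ?L" "f z = f z'"
      have fz: "{z, f z} \<in> E" "\<phi> {z, f z} = a" "{z', f z'} \<in> E" "\<phi> {z', f z'} = a"
        using f z(1,2) by blast+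
      then have "{z, f z} = {z', f z'}" using proper_at[OF pr fz(1,3), of "f z"] z(3) a(1) by simp
      then show "z = z'" using z(3) by (metis doubleton_eq_iff)
    qed
    moreover have "f ` ?L \<subseteq> ?H" by (rule image_subsetI) (use f in simp)
    ultimately have "card ?L \<le> card ?H" using fin by (intro card_inj_on_le) auto
    moreover have "card (?L \<union> ?H) = card ?L + card ?H" by (rule card_Un_disjoint) (use fin in auto)
    moreover have "q = card (?L \<union> ?H)" unfolding q_def by (rule arg_cong[of _ _ card]) blast
    ultimately show ?thesis unfolding n_def by linarith
  qed
  have sumQ: "3 * q \<le> (\<Sum>z\<in>?C - ?D. degree E z) + n"
  proof -
    have "3 \<le> degree E z + (if degree E z \<noteq> 3 then 1 else 0)" if "z \<in> ?C - ?D" for z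
      using ge2C[of z] that by auto
    then have "(\<Sum>z\<in>?C - ?D. 3) \<le> (\<Sum>z\<in>?C - ?D. degree E z + (if degree E z \<noteq> 3 then 1 else 0))"
      by (rule sum_mono)
    also have "\<dots> = (\<Sum>z\<in>?C - ?D. degree E z) + n"
      using fin by (simp add: sum.distrib n_def sum.If_cases Int_def conj_commute)
    finally show ?thesis by (simp add: q_def mult.commute)
  qed
  have sumR: "2 * r \<le> (\<Sum>z\<in>?D - ?C. degree E z)"
    unfolding r_def using fin ge2D by (intro sum_degree_ge) auto
  \<comment> \<open>The edges of colour \<open>a\<close> match \<open>?D - ?C\<close> within itself,
    so it is not a single vertex.\<close>
  have r2: "r = 0 \<or> 2 \<le> r"
  proof (rule ccontr)
    assume no: "\<not> ?thesis"
    then obtain z where z: "?D - ?C = {z}" unfolding r_def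
      by (metis One_nat_def card_1_singletonE less_2_cases not_le)
    have "z \<notin> e" using z ev by blast
    then obtain y where y: "{z, y} \<in> cedges w" "\<phi> {z, y} = a" "y \<in> ?D"
      using fcyc_has_colour[OF pr w, of z a] z a(1) ne(4) by blast
    have "y \<notin> ?C"
    proof
      assume "y \<in> ?C"
      then have "{z, y} \<in> cedges v" using in_v[OF wE[OF y(1)], of y] y(2) ne(2) by auto
      then show False using z cedges_range by blast
    qed
    then have "y = z" using z y(3) by blast
    then show False using edge_neq[OF wE[OF y(1)]] by simp
  qed
  have "(\<Sum>z\<in>S. degree E z) = (\<Sum>z\<in>?C. degree E z) + (\<Sum>z\<in>?D - ?C. degree E z)"
    unfolding S_def using fin by (metis Diff_disjoint Un_Diff_cancel finite_Diff sum.union_disjoint)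
  moreover have "(\<Sum>z\<in>?C. degree E z) = (\<Sum>z\<in>?C \<inter> ?D. degree E z) + (\<Sum>z\<in>?C - ?D. degree E z)"
    using fin by (simp add: sum.Int_Diff[of ?C _ ?D])
  ultimately have total: "3 * p + 3 * q + 2 * r \<le> (\<Sum>z\<in>S. degree E z) + 1 + n"
    using sumP sumQ sumR by linarith
  have g: "odd_girth E \<le> p + q" "odd_girth E \<le> p + r"
    using cyc_odd_girth vD(1) wD(1) pq prm by metis+
  \<comment> \<open>If both cycles had the same \<open>odd_girth E\<close> vertices, the edge
    \<open>{x, x2}\<close> of colour \<open>c\<close> would be a chord of a shortest odd
    cycle.\<close>
  have not_tight: "\<not> (q = 0 \<and> r = 0 \<and> p = odd_girth E)"
  proof
    assume h: "q = 0 \<and> r = 0 \<and> p = odd_girth E"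
    then have CD: "?D \<subseteq> ?C" using fin by (simp add: r_def)
    have "x \<in> ?C" "x2 \<in> ?C" using ev ex cedges_range[OF x2(1)] CD by auto
    then obtain i j where ij: "x = v i" "x2 = v j" by blast
    then have "{x, x2} \<in> cedges v"
      using cyc_chordless[OF vD(1), of i j] wE[OF x2(1)] pq h by simp
    moreover have "{x, x2} \<noteq> e" using x2(2) bc e(1) by (auto simp: uncoloured_def)
    ultimately show False using vD(6) x2(2) by blast
  qed
  \<comment> \<open>For \<open>r = 0\<close> the surplus comes from \<open>q\<close>, or from
    \<open>p > odd_girth E\<close> if \<open>q = 0\<close>. For \<open>r \<ge> 2\<close> it comes
    from \<open>r\<close> via \<open>odd_girth E \<le> p + q\<close> if \<open>q \<le> r\<close>,
    and from \<open>q\<close> via \<open>odd_girth E \<le> p + r\<close> otherwise.\<close>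
  have "3 * odd_girth E + 2 \<le> (\<Sum>z\<in>S. degree E z)"
  proof (cases "r = 0")
    case True
    then show ?thesis using total g not_tight nq by (cases "q = 0") linarith+
  next
    case False
    then have "2 \<le> r" using r2 by simp
    then show ?thesis using total g nq by (cases "q \<le> r") linarith+
  qed
  then show ?thesis using that[OF sup _ I I'] by blast
qed


subsection \<open>Spokes between cycles\<close>

lemma missing_kempe_other:
  "\<lbrakk>missing \<phi> v k; k \<noteq> a; k \<noteq> b\<rbrakk> \<Longrightarrow> missing (kempe \<phi> a b K) v k"
  by (auto simp: missing_def kempe_def swap_colour_def)

lemma kempe_eq_other: "\<lbrakk>k \<noteq> a; k \<noteq> b\<rbrakk> \<Longrightarrow> kempe \<phi> a b K t = k \<longleftrightarrow> \<phi> t = k"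
  by (auto simp: kempe_def swap_colour_def)

text \<open>Let the uncoloured edge of the cycle be \<open>{x, x'}\<close>, with \<open>x'\<close> the other neighbour of \<open>x\<close>.
  Swapping colours \<open>a\<close> and \<open>c\<close> on \<open>K \<union> {x}\<close> frees \<open>c\<close> at \<open>x\<close>, and the \<open>b\<close>-\<open>c\<close> chain starting
  in \<open>x\<close> then stops after \<open>x''\<close> at \<open>y\<close> instead of reaching \<open>x'\<close>.\<close>

lemma spoke_chain_contradiction:
  assumes opt: "optimal \<phi>" and v: "fcyc \<phi> c l v e" and xx: "{x, x''} \<in> cedges v"
    and w: "{x, w} \<in> E" "w \<notin> range v" and y: "{x'', y} \<in> E" "y \<notin> range v"
    and ab: "a < 3" "b < 3" "distinct [a, b, c]" and yb: "missing \<phi> y b"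
    and K: "w \<in> K" "y \<notin> K" "K \<inter> range v = {}"
    and closed: "\<And>z t. \<lbrakk>z \<in> K; {z, t} \<in> E; \<phi> {z, t} = a \<or> \<phi> {z, t} = c\<rbrakk> \<Longrightarrow> t \<in> insert x K"
  shows False
proof -
  note f = fcycD[OF v]
  obtain u where u: "cyc l u" "range u = range v" "cedges u = cedges v" "u 0 = x" "u 1 = x''"
    using cyc_normalise[OF f(1) xx] by metis
  define x' where "x' = u (- 1)"
  have e1: "{x, x'} \<in> cedges v" using cedge_in(2)[of u 0] u by (simp add: x'_def insert_commute)
  have ne: "x \<noteq> x''" "x \<noteq> x'" "x'' \<noteq> x'"
    using cyc_neq1[OF u(1), of 0] cyc_neq1[OF u(1), of "- 1"] cyc_neq2[OF u(1), of 0] u by (auto simp: x'_def)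
  have ce: "t = {x, x''} \<or> t = {x, x'}" if "t \<in> cedges v" "x \<in> t" for t
    using cedges_at[OF u(1), of t 0] that u by (auto simp: x'_def insert_commute)
  have rng: "x \<in> range v" "x' \<in> range v" "x'' \<in> range v" using e1 xx cedges_range by auto
  obtain \<psi> where \<psi>: "optimal \<psi>" "\<And>t. t \<notin> cedges v \<Longrightarrow> \<psi> t = \<phi> t" "fcyc \<psi> c l v {x, x'}"
    "missing \<psi> x a" "missing \<psi> x' b"
    using fcyc_rotate[OF opt v e1 ab] by metis
  note g = fcycD[OF \<psi>(3)] and pr = optimal_proper[OF \<psi>(1)]
  have off: "\<psi> t = \<phi> t" if "z \<in> t" "z \<notin> range v" for t z
    using \<psi>(2) that cedges_range by blast
  have notc: "\<psi> t \<noteq> c" if "t \<in> cedges v" for t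
    using g(6)[OF that] g(3,4) by (cases "t = {x, x'}") (auto simp: uncoloured_def)
  have wc: "{x, w} \<notin> cedges v" "{x'', y} \<notin> cedges v" using w y cedges_range by blast+
  have xb: "\<psi> {x, x''} = b"
  proof -
    have "{x, x''} \<noteq> {x, x'}" using ne by (auto simp: doubleton_eq_iff)
    then have "\<psi> {x, x''} < 3" "\<psi> {x, x''} \<noteq> c" using g(6) xx by auto
    moreover have "\<psi> {x, x''} \<noteq> a" using \<psi>(4) xx cedge_subset_E[OF f(1)] by (auto simp: missing_def)
    ultimately show ?thesis using ab f(4) by auto
  qed
  let ?K = "insert x K"
  have cl: "kempe_closed \<psi> a c ?K"
  proof (rule kempe_closedI)
    fix z t assume z: "z \<in> ?K" "{z, t} \<in> E" "\<psi> {z, t} = a \<or> \<psi> {z, t} = c"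
    show "t \<in> ?K"
    proof (cases "z = x")
      case True
      then have "\<psi> {x, t} = c" using z \<psi>(4) by (auto simp: missing_def)
      then have "{x, t} \<notin> cedges v" using notc by blast
      then have "{x, t} = {x, w}" using spoke_unique[OF f(1) rng(1)] z True w wc by auto
      then have "t = w" using ne(1) by (auto simp: doubleton_eq_iff)
      then show ?thesis using K by simp
    next
      case False
      then have zK: "z \<in> K" using z by simp
      then have "z \<notin> range v" using K by blast
      then have "\<psi> {z, t} = \<phi> {z, t}" using off by blast
      then show ?thesis using closed[OF zK z(2)] z(3) by simp
    qed
  qed
  define \<theta> where "\<theta> = kempe \<psi> a c ?K"
  have th: "optimal \<theta>" unfolding \<theta>_def by (rule optimal_kempe[OF \<psi>(1) cl ab(1) f(4)])
  have bne: "b \<noteq> a" "b \<noteq> c" using ab by auto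
  have thb: "\<theta> t = b \<longleftrightarrow> \<psi> t = b" for t unfolding \<theta>_def using bne by (rule kempe_eq_other)
  have xc: "missing \<theta> x c" unfolding \<theta>_def by (rule missing_kempe_inside[OF \<psi>(4)]) simp
  have x'b: "missing \<theta> x' b" unfolding \<theta>_def using \<psi>(5) bne by (rule missing_kempe_other)
  have "missing \<psi> y b" using yb off[OF _ y(2)] by (auto simp: missing_def)
  then have yb': "missing \<theta> y b" unfolding \<theta>_def using bne by (rule missing_kempe_other)
  have unc: "{x, x'} \<in> uncoloured \<theta>" unfolding \<theta>_def using g(3) by (simp add: uncoloured_kempe ab f(4))
  have yx: "\<psi> {x'', y} = c" using g(7)[OF y(1) wc(2) _ rng(3)] by simp
  have "kempe_closed \<theta> c b {x, x'', y}"
  proof (rule kempe_closedI)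
    fix z t assume z: "z \<in> {x, x'', y}" "{z, t} \<in> E" "\<theta> {z, t} = c \<or> \<theta> {z, t} = b"
    consider "z = x" | "z = x''" | "z = y" using z(1) by blast
    then show "t \<in> {x, x'', y}"
    proof cases
      case 1
      then have "\<psi> {x, t} = b" using z xc thb by (auto simp: missing_def)
      then have "{x, t} = {x, x''}" using proper_at[OF pr, of "{x, t}" "{x, x''}" x] z(2) 1 xb ab(2)
        xx cedge_subset_E[OF f(1)] by auto
      then show ?thesis using 1 by (auto simp: doubleton_eq_iff)
    next
      case 2
      show ?thesis
      proof (cases "{x'', t} \<in> cedges v")
        case True
        have "t \<in> range v" using True cedges_range by blast
        show ?thesis
        proof (cases "t = x")
          case False
          then have "{x'', t} \<inter> ?K = {}" using \<open>t \<in> range v\<close> rng(3) K ne by auto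
          then have "\<theta> {x'', t} = \<psi> {x'', t}" unfolding \<theta>_def by (simp add: kempe_def)
          then have "\<psi> {x'', t} = b" using z(3) 2 notc[OF True] by auto
          then have "{x'', t} = {x, x''}" using proper_at[OF pr, of "{x'', t}" "{x, x''}" x''] z(2) 2 xb ab(2)
            xx cedge_subset_E[OF f(1)] by auto
          then show ?thesis by (auto simp: doubleton_eq_iff)
        qed simp
      next
        case False
        then have "{x'', t} = {x'', y}" using spoke_unique[OF f(1) rng(3)] z(2) 2 y wc by auto
        then show ?thesis using 2 by (auto simp: doubleton_eq_iff)
      qed
    next
      case 3
      then have tc: "\<theta> {y, t} = c" using z yb' by (auto simp: missing_def)
      have "y \<notin> ?K" using K y rng by auto
      show ?thesis
      proof (cases "t \<in> ?K")
        \<comment> \<open>Colour \<open>c\<close> on this edge would result from swapping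
          \<open>a\<close>; but an edge of colour \<open>a\<close> meeting the closed set lies
          inside it, and \<open>y\<close> does not.\<close>
        case True
        then have "\<psi> {y, t} = a" using tc unfolding \<theta>_def by (auto simp: kempe_def swap_colour_def split: if_splits)
        then have "{y, t} \<subseteq> ?K" using cl True z(2) 3 unfolding kempe_closed_def by auto
        then show ?thesis using \<open>y \<notin> ?K\<close> by simp
      next
        case False
        then have "\<psi> {y, t} = c" using tc \<open>y \<notin> ?K\<close> unfolding \<theta>_def by (auto simp: kempe_def)
        then have "{y, t} = {x'', y}" using proper_at[OF pr, of "{y, t}" "{x'', y}" y] z(2) 3 y(1) yx f(4) by auto
        then show ?thesis by (auto simp: doubleton_eq_iff)
      qed
    qed
  qed
  moreover have "x' \<notin> {x, x'', y}" using ne y rng by auto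
  ultimately show False
    using kempe_separation[OF th unc xc x'b f(4) ab(2), of "{x, x'', y}"] by blast
qed

text \<open>Either cycle colour can be freed at any vertex of the cycle without changes elsewhere. A
  chain in \<open>c\<close> and \<open>k\<close> that enters the cycle at \<open>z\<close> then ends
  there.\<close>

lemma fcyc_absorb:
  assumes "optimal \<phi>" "fcyc \<phi> c l v e" "z \<in> range v" "k < 3" "k \<noteq> c"
  obtains \<psi> where "optimal \<psi>" "\<And>t. t \<notin> cedges v \<Longrightarrow> \<psi> t = \<phi> t" "missing \<psi> z k"
proof -
  obtain i where i: "z = v i" using assms(3) by blast
  obtain b where "b < 3" "distinct [k, b, c]"
    using other_colours[OF fcycD(4)[OF assms(2)]] assms(4,5) fcycD(4)[OF assms(2)]
    by (metis (full_types) distinct_length_2_or_more distinct_singleton)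
  then show ?thesis
    using fcyc_rotate[OF assms(1,2), of z "v (i + 1)" k b] cedge_in(1)[of v i] i assms(4) that by metis
qed

text \<open>Disjointness of the cycles allows them to be recoloured one after the other without
  spoiling earlier choices.\<close>

lemma fcyc_undisturbed:
  assumes "optimal \<phi>" "fcyc \<phi> c l v e" "fcyc \<phi> d m w f" "e \<noteq> f" "\<And>t. t \<notin> cedges w \<Longrightarrow> \<psi> t = \<phi> t"
  shows "fcyc \<psi> c l v e"
proof (rule fcyc_cong[OF assms(2)])
  fix t assume "t \<inter> range v \<noteq> {}"
  then have "t \<notin> cedges w" using fcyc_disjoint[OF assms(1-4)] cedges_range by blast
  then show "\<psi> t = \<phi> t" by (rule assms(5))
qed

lemma missing_undisturbed:
  "\<lbrakk>missing \<phi> z k; z \<notin> range w; \<And>t. t \<notin> cedges w \<Longrightarrow> \<psi> t = \<phi> t\<rbrakk> \<Longrightarrow> missing \<psi> z k"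
  unfolding missing_def using cedges_range by (metis subsetD)

end

section \<open>Edges between supports of different uncoloured edges\<close>

locale charged = subcubic +
  fixes \<phi> :: "'a set \<Rightarrow> nat" and S :: "'a set \<Rightarrow> 'a set"
  assumes opt: "optimal \<phi>" and supp: "e \<in> uncoloured \<phi> \<Longrightarrow> supported \<phi> e (S e)"
begin

definition rest :: "'a set" where
  "rest = {w \<in> V. \<forall>e\<in>uncoloured \<phi>. w \<notin> S e}"

lemma S_cyc:
  assumes "e \<in> uncoloured \<phi>" "z \<in> S e"
  obtains c l v where "fcyc \<phi> c l v e" "z \<in> range v" "range v \<subseteq> S e"
  using supp[OF assms(1)] assms(2) unfolding supported_def by blast

lemma S_subset_V: assumes "e \<in> uncoloured \<phi>" shows "S e \<subseteq> V"
proof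
  fix z assume "z \<in> S e"
  then obtain c l v where "fcyc \<phi> c l v e" "z \<in> range v" using S_cyc[OF assms] by metis
  then show "z \<in> V" using range_cyc_V fcycD(1) by blast
qed

lemma S_disjoint:
  assumes "e \<in> uncoloured \<phi>" "f \<in> uncoloured \<phi>" "z \<in> S e" "z \<in> S f"
  shows "e = f"
proof (rule ccontr)
  assume ne: "e \<noteq> f"
  obtain c l v where v: "fcyc \<phi> c l v e" "z \<in> range v" using S_cyc[OF assms(1,3)] by metis
  obtain d m w where w: "fcyc \<phi> d m w f" "z \<in> range w" using S_cyc[OF assms(2,4)] by metis
  show False using fcyc_disjoint[OF opt v(1) w(1) ne] v(2) w(2) by blast
qed

text \<open>Two edges at \<open>y\<close> belong to a cycle inside the support, so at most the third
  one can leave it.\<close>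

lemma leaving_edge:
  assumes "f \<in> uncoloured \<phi>" "y \<in> S f" "{y, x} \<in> E" "x \<notin> S f"
  shows "degree E y = 3" "\<lbrakk>{y, x'} \<in> E; x' \<notin> S f\<rbrakk> \<Longrightarrow> x' = x"
proof -
  obtain c l v where v: "fcyc \<phi> c l v f" "y \<in> range v" "range v \<subseteq> S f" using S_cyc[OF assms(1,2)] by metis
  have *: "{y, t} \<notin> cedges v" if "t \<notin> S f" for t using that v(3) cedges_range by blast
  show "degree E y = 3"
    using spoke_iff_degree[OF fcycD(1)[OF v(1)] v(2)] *[OF assms(4)] assms(3) by blast
  show "x' = x" if "{y, x'} \<in> E" "x' \<notin> S f"
  proof -
    have "{y, x'} = {y, x}"
      using spoke_unique[OF fcycD(1)[OF v(1)] v(2), of "{y, x'}" "{y, x}"] *[OF assms(4)] *[OF that(2)] that assms(3)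
      by blast
    then show ?thesis using edge_neq[OF that(1)] by (auto simp: doubleton_eq_iff)
  qed
qed

text \<open>A support may contain cycles with different outer colours, but an edge leaving the
  support leaves every such cycle through its end \<open>y\<close>, and so has the outer colour of
  that cycle.\<close>

lemma S_cyc_leaving:
  assumes "f \<in> uncoloured \<phi>" "y \<in> S f" "{y, x} \<in> E" "x \<notin> S f"
  obtains l v where "fcyc \<phi> (\<phi> {y, x}) l v f" "y \<in> range v" "range v \<subseteq> S f"
proof -
  obtain c l v where v: "fcyc \<phi> c l v f" "y \<in> range v" "range v \<subseteq> S f" using S_cyc[OF assms(1,2)] by metis
  have "{y, x} \<notin> cedges v" using v(3) cedges_range assms(4) by blast
  then have "\<phi> {y, x} = c" using fcycD(7)[OF v(1) assms(3) _ _ v(2)] by simp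
  then show ?thesis using that v by simp
qed

lemma third_colour:
  fixes a c :: nat assumes "a < 3" "c < 3" "a \<noteq> c" obtains b where "b < 3" "distinct [a, b, c]"
  using that[of 0] that[of 1] that[of 2] assms by fastforce

text \<open>If the supports differed, \<open>a\<close> could be freed at \<open>y\<close> and,
  independently, \<open>b\<close> at \<open>z\<close>. Then \<open>{y}\<close> already serves as the
  set \<open>K\<close> of the chain argument.\<close>

lemma spokes_same_support:
  assumes e: "e \<in> uncoloured \<phi>" and v: "fcyc \<phi> c l v e" "range v = S e" and xx: "{x, x''} \<in> cedges v"
    and y: "{x, y} \<in> E" "f \<in> uncoloured \<phi>" "y \<in> S f" "f \<noteq> e"
    and z: "{x'', z} \<in> E" "h \<in> uncoloured \<phi>" "z \<in> S h" "h \<noteq> e"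
  shows "h = f"
proof (rule ccontr)
  assume ne: "h \<noteq> f"
  note vD = fcycD[OF v(1)]
  have rng: "x \<in> range v" "x'' \<in> range v" using xx cedges_range by auto
  have yv: "y \<notin> range v" and zv: "z \<notin> range v" using S_disjoint e y z v(2) by metis+
  have xf: "x \<notin> S f" and xh: "x'' \<notin> S h" using S_disjoint e y z v(2) rng by metis+
  have yx: "{y, x} \<in> E" "{z, x''} \<in> E" using y z by (simp_all add: insert_commute)
  have col: "\<phi> {y, x} = c" "\<phi> {z, x''} = c"
    using vD(7)[OF yx(1) _ _ rng(1)] vD(7)[OF yx(2) _ _ rng(2)] yv zv cedges_range by blast+
  obtain m u where u: "fcyc \<phi> c m u f" "y \<in> range u" "range u \<subseteq> S f"
    using S_cyc_leaving[OF y(2,3) yx(1) xf] col by metis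
  obtain n w where w: "fcyc \<phi> c n w h" "z \<in> range w" "range w \<subseteq> S h"
    using S_cyc_leaving[OF z(2,3) yx(2) xh] col by metis
  obtain a b where ab: "a < 3" "b < 3" "distinct [c, a, b]" by (rule other_colours[OF vD(4)])
  have ne': "a \<noteq> c" "b \<noteq> c" "distinct [a, b, c]" using ab by auto
  obtain \<psi> where \<psi>: "optimal \<psi>" "\<And>t. t \<notin> cedges u \<Longrightarrow> \<psi> t = \<phi> t" "missing \<psi> y a"
    using fcyc_absorb[OF opt u(1,2) ab(1) ne'(1)] by metis
  have v1: "fcyc \<psi> c l v e" by (rule fcyc_undisturbed[OF opt v(1) u(1) y(4)[symmetric] \<psi>(2)])
  have w1: "fcyc \<psi> c n w h" by (rule fcyc_undisturbed[OF opt w(1) u(1) ne \<psi>(2)])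
  obtain \<theta> where \<theta>: "optimal \<theta>" "\<And>t. t \<notin> cedges w \<Longrightarrow> \<theta> t = \<psi> t" "missing \<theta> z b"
    using fcyc_absorb[OF \<psi>(1) w1 w(2) ab(2) ne'(2)] by metis
  have v2: "fcyc \<theta> c l v e" by (rule fcyc_undisturbed[OF \<psi>(1) v1 w1 z(4)[symmetric] \<theta>(2)])
  have yw: "y \<notin> range w" using S_disjoint[OF y(2) z(2) y(3)] w(3) ne by blast
  have ya: "missing \<theta> y a" by (rule missing_undisturbed[OF \<psi>(3) yw \<theta>(2)])
  have yz: "z \<noteq> y" using w(2) yw by blast
  have "{y, x} \<notin> cedges v" using yv cedges_range by blast
  then have yc: "\<theta> {y, x} = c" using fcycD(7)[OF v2 yx(1) _ _ rng(1)] by simp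
  show False
  proof (rule spoke_chain_contradiction[OF \<theta>(1) v2 xx y(1) yv z(1) zv ab(1,2) ne'(3) \<theta>(3), of "{y}"])
    fix z' t assume z': "z' \<in> {y}" "{z', t} \<in> E" "\<theta> {z', t} = a \<or> \<theta> {z', t} = c"
    then have "\<theta> {y, t} = c" using ya by (auto simp: missing_def)
    then have "{y, t} = {y, x}"
      using proper_at[OF optimal_proper[OF \<theta>(1)], of "{y, t}" "{y, x}" y] z' yc yx vD(4) by auto
    then show "t \<in> insert x {y}" by (auto simp: doubleton_eq_iff)
  qed (use yz yv in auto)
qed

text \<open>After freeing \<open>b\<close> at \<open>y\<close>, the chain in \<open>a\<close> and
  \<open>c\<close> from \<open>x\<close> through \<open>w\<close> must not be made to stop. It stops
  at \<open>w\<close> if \<open>w\<close> misses \<open>a\<close>, and at the next vertex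
  \<open>w1\<close> if that lies in a support, where \<open>c\<close> can be freed.\<close>

lemma rest_neighbour:
  assumes e: "e \<in> uncoloured \<phi>" and v: "fcyc \<phi> c l v e" "range v = S e" and xx: "{x, x''} \<in> cedges v"
    and w: "{x, w} \<in> E" "w \<in> rest"
    and y: "{x'', y} \<in> E" "f \<in> uncoloured \<phi>" "y \<in> S f" "f \<noteq> e"
    and u: "fcyc \<phi> d m u f" "range u = S f" and a: "a < 3" "a \<noteq> c"
  shows "\<exists>w1\<in>rest. {w, w1} \<in> E \<and> \<phi> {w, w1} = a"
proof (rule ccontr)
  assume no: "\<not> ?thesis"
  note vD = fcycD[OF v(1)]
  obtain b where b: "b < 3" "distinct [a, b, c]" by (rule third_colour[OF a(1) vD(4) a(2)])
  have bc: "b \<noteq> c" using b by auto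
  have rng: "x \<in> range v" "x'' \<in> range v" using xx cedges_range by auto
  have yv: "y \<notin> range v" using S_disjoint e y v(2) by metis
  have wS: "w \<notin> S h" if "h \<in> uncoloured \<phi>" for h using w(2) that by (simp add: rest_def)
  have wv: "w \<notin> range v" and wu: "w \<notin> range u" using wS e y(2) v(2) u(2) by auto
  have xu: "x'' \<notin> range u" using S_disjoint[OF e y(2)] v(2) u(2) rng y(4) by metis
  have yx: "{y, x''} \<in> E" "{w, x} \<in> E" using y w by (simp_all add: insert_commute)
  have "\<phi> {y, x''} = c" using vD(7)[OF yx(1) _ _ rng(2)] yv cedges_range by blast
  moreover have "\<phi> {y, x''} = d" using fcycD(7)[OF u(1) yx(1), of y] xu cedges_range y(3) u(2) by blast
  ultimately have dc: "d = c" by simp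
  have yu: "y \<in> range u" using y(3) u(2) by simp
  obtain \<psi> where \<psi>: "optimal \<psi>" "\<And>t. t \<notin> cedges u \<Longrightarrow> \<psi> t = \<phi> t" "missing \<psi> y b"
    using fcyc_absorb[OF opt u(1) yu b(1)] bc dc by metis
  have v1: "fcyc \<psi> c l v e" by (rule fcyc_undisturbed[OF opt v(1) u(1) y(4)[symmetric] \<psi>(2)])
  have wedge: "\<psi> t = \<phi> t" if "w \<in> t" for t using \<psi>(2)[of t] that wu cedges_range by blast
  have wnc: "{w, x} \<notin> cedges v" using wv cedges_range by blast
  show False
  proof (cases "missing \<phi> w a")
    case True
    then have wa: "missing \<psi> w a" using wedge by (auto simp: missing_def)
    have wc: "\<psi> {w, x} = c" using fcycD(7)[OF v1 yx(2) wnc _ rng(1)] by simp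
    have "y \<noteq> w" using wS y by auto
    show False
    proof (rule spoke_chain_contradiction[OF \<psi>(1) v1 xx w(1) wv y(1) yv a(1) b \<psi>(3), of "{w}"])
      fix z' t assume z': "z' \<in> {w}" "{z', t} \<in> E" "\<psi> {z', t} = a \<or> \<psi> {z', t} = c"
      then have "\<psi> {w, t} = c" using wa by (auto simp: missing_def)
      then have "{w, t} = {w, x}"
        using proper_at[OF optimal_proper[OF \<psi>(1)], of "{w, t}" "{w, x}" w] z' wc yx vD(4) by auto
      then show "t \<in> insert x {w}" by (auto simp: doubleton_eq_iff)
    qed (use \<open>y \<noteq> w\<close> wv in auto)
  next
    case False
    then obtain s where s: "s \<in> E" "w \<in> s" "\<phi> s = a" by (auto simp: missing_def)
    then obtain w1 where w1: "{w, w1} \<in> E" "\<phi> {w, w1} = a" using edge_at by metis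
    then have w1': "{w1, w} \<in> E" "\<phi> {w1, w} = a" by (simp_all add: insert_commute)
    then have "w1 \<notin> rest" "w1 \<in> V" using no w1 edge_in_V by blast+
    then obtain h where h: "h \<in> uncoloured \<phi>" "w1 \<in> S h" by (auto simp: rest_def)
    obtain n p where p: "fcyc \<phi> a n p h" "w1 \<in> range p" "range p \<subseteq> S h"
      using S_cyc_leaving[OF h w1'(1) wS[OF h(1)]] w1'(2) by metis
    have w1v: "w1 \<notin> range v"
    proof
      assume "w1 \<in> range v"
      then have "\<phi> {w1, w} = c" using vD(7)[OF w1'(1), of w1] wv cedges_range by blast
      then show False using w1' a by simp
    qed
    have w1u: "w1 \<notin> range u"
    proof
      assume "w1 \<in> range u"
      then have "\<phi> {w1, w} = d" using fcycD(7)[OF u(1) w1'(1), of w1] wu cedges_range by blast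
      then show False using w1' a dc by simp
    qed
    \<comment> \<open>The edge \<open>{w1, w}\<close> has colour \<open>a\<close>, whereas edges
      leaving the cycles of \<open>e\<close> and \<open>f\<close> have colour \<open>c\<close>. So
      freeing \<open>c\<close> at \<open>w1\<close> disturbs neither of them.\<close>
    have he: "h \<noteq> e" "h \<noteq> f" using w1v w1u h v(2) u(2) by auto
    have p1: "fcyc \<psi> a n p h" by (rule fcyc_undisturbed[OF opt p(1) u(1) he(2) \<psi>(2)])
    obtain \<theta> where \<theta>: "optimal \<theta>" "\<And>t. t \<notin> cedges p \<Longrightarrow> \<theta> t = \<psi> t" "missing \<theta> w1 c"
      using fcyc_absorb[OF \<psi>(1) p1 p(2) vD(4)] a(2) by metis
    have v2: "fcyc \<theta> c l v e" by (rule fcyc_undisturbed[OF \<psi>(1) v1 p1 he(1)[symmetric] \<theta>(2)])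
    have yp: "y \<notin> range p" using S_disjoint[OF y(2) h(1) y(3)] p(3) he by blast
    have yb: "missing \<theta> y b" by (rule missing_undisturbed[OF \<psi>(3) yp \<theta>(2)])
    have wp: "w \<notin> range p" using wS[OF h(1)] p(3) by blast
    have wedge': "\<theta> t = \<phi> t" if "w \<in> t" for t
    proof -
      have "t \<notin> cedges p" using that wp cedges_range by blast
      then show ?thesis using \<theta>(2) wedge[OF that] by simp
    qed
    have wc: "\<theta> {w, x} = c" using fcycD(7)[OF v2 yx(2) wnc _ rng(1)] by simp
    have wa: "\<theta> {w, w1} = a" using wedge' w1 by simp
    have yne: "y \<noteq> w" "y \<noteq> w1" using wS y yp p(2) by auto
    show False
    proof (rule spoke_chain_contradiction[OF \<theta>(1) v2 xx w(1) wv y(1) yv a(1) b yb, of "{w, w1}"])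
      fix z' t assume z': "z' \<in> {w, w1}" "{z', t} \<in> E" "\<theta> {z', t} = a \<or> \<theta> {z', t} = c"
      have same: "{z', t} = s" if "s \<in> E" "\<theta> {z', t} = \<theta> s" "z' \<in> s" for s
        using proper_at[OF optimal_proper[OF \<theta>(1)] z'(2) that(1), of z'] that z'(3) a(1) vD(4) by auto
      consider "z' = w" "\<theta> {z', t} = a" | "z' = w" "\<theta> {z', t} = c" | "z' = w1" "\<theta> {z', t} = a"
        using z' \<theta>(3) by (auto simp: missing_def)
      then show "t \<in> insert x {w, w1}"
      proof cases
        case 1
        then have "{w, t} = {w, w1}" using same[of "{w, w1}"] w1 wa by simp
        then show ?thesis by (auto simp: doubleton_eq_iff)
      next
        case 2
        then have "{w, t} = {w, x}" using same[of "{w, x}"] yx wc by simp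
        then show ?thesis by (auto simp: doubleton_eq_iff)
      next
        case 3
        then have "{w1, t} = {w, w1}" using same[of "{w, w1}"] w1 wa by simp
        then show ?thesis by (auto simp: doubleton_eq_iff)
      qed
    qed (use yne wv w1v in auto)
  qed
qed

text \<open>Both colours other than \<open>c\<close> lead from \<open>w\<close> into
  \<open>rest\<close>; together with \<open>{w, x}\<close> these are all edges at
  \<open>w\<close>.\<close>

lemma rest_exclusive:
  assumes e: "e \<in> uncoloured \<phi>" and v: "fcyc \<phi> c l v e" "range v = S e" and xx: "{x, x''} \<in> cedges v"
    and w: "{x, w} \<in> E" "w \<in> rest"
    and y: "{x'', y} \<in> E" "f \<in> uncoloured \<phi>" "y \<in> S f" "f \<noteq> e"
    and u: "fcyc \<phi> d m u f" "range u = S f"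
  shows "degree E w = 3" "{w, z} \<in> E \<Longrightarrow> z = x \<or> z \<in> rest"
proof -
  note vD = fcycD[OF v(1)]
  obtain a b where ab: "a < 3" "b < 3" "distinct [c, a, b]" by (rule other_colours[OF vD(4)])
  have ne: "a \<noteq> c" "b \<noteq> c" "a \<noteq> b" using ab by auto
  obtain w1 where w1: "w1 \<in> rest" "{w, w1} \<in> E" "\<phi> {w, w1} = a"
    using rest_neighbour[OF e v xx w y u ab(1) ne(1)] by blast
  obtain w2 where w2: "w2 \<in> rest" "{w, w2} \<in> E" "\<phi> {w, w2} = b"
    using rest_neighbour[OF e v xx w y u ab(2) ne(2)] by blast
  have wv: "w \<notin> range v" using w(2) e v(2) by (auto simp: rest_def)
  have wx: "{w, x} \<in> E" using w by (simp add: insert_commute)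
  have "x \<in> range v" using xx cedges_range by auto
  then have "\<phi> {w, x} = c" using vD(7)[OF wx, of x] wv cedges_range by blast
  then have d: "distinct [{w, x}, {w, w1}, {w, w2}]" using w1 w2 ne by auto
  show "degree E w = 3" using degree_eq_3I[OF wx w1(2) w2(2) _ _ _ d] by simp
  show "z = x \<or> z \<in> rest" if "{w, z} \<in> E"
  proof -
    have "{w, z} \<in> {{w, x}, {w, w1}, {w, w2}}"
      by (rule three_edges[of _ _ _ _ w]) (use wx w1(2) w2(2) that d in auto)
    then show ?thesis using w1(1) w2(1) by (auto simp: doubleton_eq_iff)
  qed
qed


end

subsection \<open>Two linked shortest odd cycles\<close>

context subcubic begin

lemma closed_walk_odd_girth:
  assumes "odd n" "3 \<le> n" "inj_on h {..<n}" "\<And>i. Suc i < n \<Longrightarrow> {h i, h (Suc i)} \<in> E"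
    "{h (n - 1), h 0} \<in> E"
  shows "odd_girth E \<le> n"
proof -
  have adj: "adj E a b" if "{a, b} \<in> E" for a b using that edge_neq by (auto simp: adj_def)
  let ?cs = "map h [0..<n]"
  have "is_cycle E ?cs"
    unfolding is_cycle_def
  proof (intro conjI allI impI)
    show "distinct ?cs" using assms(3) by (simp add: distinct_map atLeast0LessThan)
    fix i assume i: "i < length ?cs"
    show "adj E (?cs ! i) (?cs ! ((i + 1) mod length ?cs))"
    proof (cases "Suc i = n")
      case True
      then show ?thesis using assms(2,5) adj by auto
    next
      case False
      then show ?thesis using i assms(4)[of i] adj by auto
    qed
  qed (use assms in auto)
  then show ?thesis using odd_girth_le[of ?cs] assms(1) by simp
qed

text \<open>The closed walk \<open>x\<close>, \<open>u j\<close>, ..., \<open>u (j + k)\<close>,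
  \<open>x''\<close> has \<open>k + 3\<close> distinct vertices, an odd number.\<close>

lemma detour_odd_girth:
  assumes "cyc l u" "even k" "k < l" "{x, x''} \<in> E" "{x, u j} \<in> E" "{x'', u (j + int k)} \<in> E"
    "x \<notin> range u" "x'' \<notin> range u"
  shows "odd_girth E \<le> k + 3"
proof -
  define h where "h i = (if i = 0 then x else if i = k + 2 then x'' else u (j + (int i - 1)))" for i
  have "inj_on h {..<k + 3}"
  proof (rule inj_onI)
    fix i i' assume i: "i \<in> {..<k + 3}" "i' \<in> {..<k + 3}" "h i = h i'"
    have ne: "x \<noteq> x''" using assms(4) edge_neq by blast
    have "i = i'" if "i \<noteq> 0" "i' \<noteq> 0" "i \<noteq> k + 2" "i' \<noteq> k + 2"
    proof -
      have "int l dvd int i - int i'"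
        using i(3) that by (simp add: h_def cyc_eq_dvd[OF assms(1)])
      then have "int i mod int l = int i' mod int l" by (simp add: mod_eq_dvd_iff)
      then have "(int i - 1) mod int l = (int i' - 1) mod int l" by (metis mod_diff_left_eq)
      moreover have "0 \<le> int i - 1" "int i - 1 < int l" "0 \<le> int i' - 1" "int i' - 1 < int l"
        using that i(1,2) assms(3) by auto
      ultimately show ?thesis by simp
    qed
    then show "i = i'" using i(3) ne assms(7,8) unfolding h_def by (metis rangeI)
  qed
  moreover have "{h i, h (Suc i)} \<in> E" if "Suc i < k + 3" for i
  proof -
    consider "i = 0" | "i = k + 1" | "0 < i" "i < k + 1" using \<open>Suc i < k + 3\<close> by linarith
    then show ?thesis
    proof cases
      case 3
      then have "h i = u (j + (int i - 1))" "h (Suc i) = u ((j + (int i - 1)) + 1)"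
        by (simp_all add: h_def algebra_simps)
      then show ?thesis using cycD(4)[OF assms(1)] by metis
    qed (use assms(5,6) in \<open>auto simp: h_def insert_commute\<close>)
  qed
  moreover have "{h (k + 3 - 1), h 0} \<in> E" using assms(4) by (simp add: h_def insert_commute)
  ultimately show ?thesis using closed_walk_odd_girth[of "k + 3" h] assms(2) by simp
qed

lemma cross_not_cedge:
  assumes "range v \<inter> range u = {}"
  shows "{v i, u j} \<notin> cedges v" "{v i, u j} \<notin> cedges u" "{u j, v i} \<notin> cedges v" "{u j, v i} \<notin> cedges u"
proof -
  have ne: "v i' \<noteq> u j'" for i' j' using assms by blast
  show "{v i, u j} \<notin> cedges v" "{u j, v i} \<notin> cedges v"
    using ne[symmetric] by (auto simp: cedges_def doubleton_eq_iff)
  show "{v i, u j} \<notin> cedges u" "{u j, v i} \<notin> cedges u"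
    using ne by (auto simp: cedges_def doubleton_eq_iff)
qed

lemma cross_unique:
  fixes u v :: "int \<Rightarrow> 'a"
  assumes "cyc l v" "range v \<inter> range u = {}" "{v i, u j} \<in> E" "{v i, u j'} \<in> E"
  shows "u j = u j'"
proof -
  have "{v i, u j} = {v i, u j'}"
    by (rule spoke_unique[OF assms(1), of "v i"]) (use assms(3,4) cross_not_cedge(1)[OF assms(2)] in auto)
  then show ?thesis by (auto simp: doubleton_eq_iff)
qed

text \<open>Otherwise \<open>x\<close>, \<open>y\<close>, \<open>y''\<close>, \<open>x''\<close>
  form a 4-cycle, and both uncoloured edges can be moved onto it so that \<open>x\<close>,
  \<open>y\<close> miss \<open>a\<close> and \<open>x''\<close>, \<open>y''\<close> miss
  \<open>b\<close>. Recolouring \<open>{x, y}\<close> with \<open>a\<close> and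
  \<open>{x'', y''}\<close> with \<open>b\<close> frees \<open>c\<close> at \<open>x\<close> and
  \<open>x''\<close>, so \<open>{x, x''}\<close> could be coloured.\<close>

lemma no_parallel_spokes:
  assumes opt: "optimal \<phi>" and v: "fcyc \<phi> c l v e" and u: "fcyc \<phi> c m u f" and ef: "e \<noteq> f"
    and xx: "{x, x''} \<in> cedges v" and xy: "{x, y} \<in> E" "{x'', y''} \<in> E"
  shows "{y, y''} \<notin> cedges u"
proof
  assume yy: "{y, y''} \<in> cedges u"
  note vD = fcycD[OF v] and uD = fcycD[OF u]
  obtain a b where ab: "a < 3" "b < 3" "distinct [c, a, b]" by (rule other_colours[OF vD(4)])
  then have ab': "distinct [a, b, c]" by auto
  have dis: "range v \<inter> range u = {}" by (rule fcyc_disjoint[OF opt v u ef])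
  have rng: "x \<in> range v" "x'' \<in> range v" "y \<in> range u" "y'' \<in> range u" using xx yy cedges_range by auto
  have ne: "x \<noteq> x''" "y \<noteq> y''" using xx yy edge_neq cedge_subset_E vD(1) uD(1) by blast+
  obtain \<psi> where \<psi>: "optimal \<psi>" "\<And>t. t \<notin> cedges v \<Longrightarrow> \<psi> t = \<phi> t" "fcyc \<psi> c l v {x, x''}"
    "missing \<psi> x a" "missing \<psi> x'' b"
    using fcyc_rotate[OF opt v xx ab(1,2) ab'] by metis
  have u1: "fcyc \<psi> c m u f" by (rule fcyc_undisturbed[OF opt u v ef[symmetric] \<psi>(2)])
  obtain \<theta> where \<theta>: "optimal \<theta>" "\<And>t. t \<notin> cedges u \<Longrightarrow> \<theta> t = \<psi> t" "missing \<theta> y a" "missing \<theta> y'' b"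
    using fcyc_rotate[OF \<psi>(1) u1 yy ab(1,2) ab'] by metis
  have "{x, x''} \<noteq> f" using cedges_range[OF uD(2)] dis rng by auto
  then have v1: "fcyc \<theta> c l v {x, x''}" by (rule fcyc_undisturbed[OF \<psi>(1,3) u1 _ \<theta>(2)])
  have xu: "x \<notin> range u" "x'' \<notin> range u" using dis rng by auto
  have xa: "missing \<theta> x a" by (rule missing_undisturbed[OF \<psi>(4) xu(1) \<theta>(2)])
  have xb: "missing \<theta> x'' b" by (rule missing_undisturbed[OF \<psi>(5) xu(2) \<theta>(2)])
  have sp: "{x, y} \<notin> cedges v" "{x'', y''} \<notin> cedges v" using rng dis cedges_range by blast+
  define \<theta>1 where "\<theta>1 = \<theta>({x, y} := a)"
  have o1: "optimal \<theta>1" unfolding \<theta>1_def by (rule optimal_recolour[OF \<theta>(1) xa \<theta>(3) ab(1)])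
  have m1: "missing \<theta>1 x'' b" "missing \<theta>1 y'' b"
    using xb \<theta>(4) ab' unfolding \<theta>1_def missing_def by auto
  define \<theta>2 where "\<theta>2 = \<theta>1({x'', y''} := b)"
  have o2: "optimal \<theta>2" unfolding \<theta>2_def by (rule optimal_recolour[OF o1 m1 ab(2)])
  have same: "\<theta>2 t = \<theta> t" if "t \<in> cedges v" for t
    using that sp unfolding \<theta>2_def \<theta>1_def by auto
  have notc: "\<theta> t \<noteq> c" if "t \<in> cedges v" for t
    using fcycD(6)[OF v1 that] fcycD(3,4)[OF v1] by (cases "t = {x, x''}") (auto simp: uncoloured_def)
  have free: "missing \<theta>2 z c" if z: "z = x \<or> z = x''" for z
    unfolding missing_def
  proof (intro ballI impI)
    fix t assume t: "t \<in> E" "z \<in> t"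
    show "\<theta>2 t \<noteq> c"
    proof (cases "t \<in> cedges v")
      case True
      then show ?thesis using same notc by simp
    next
      case False
      then have "t = {x, y} \<or> t = {x'', y''}"
        using spoke_unique[OF vD(1), of x t "{x, y}"] spoke_unique[OF vD(1), of x'' t "{x'', y''}"]
          t z rng xy sp by auto
      moreover have "{x, y} \<noteq> {x'', y''}" using ne rng dis by (auto simp: doubleton_eq_iff)
      ultimately show ?thesis using ab' unfolding \<theta>2_def \<theta>1_def by auto
    qed
  qed
  have "{x, x''} \<in> uncoloured \<theta>2" using fcycD(3)[OF v1] same[OF xx] by (simp add: uncoloured_def)
  then show False using no_common_missing[OF o2 _ free free vD(4)] by blast
qed

end

section \<open>Coordinates on the Petersen graph and its recognition\<close>

definition outer_pair :: "int \<Rightarrow> nat set" where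
  "outer_pair i = {nat (2 * i mod 5), nat ((2 * i + 1) mod 5)}"

text \<open>In the Kneser model the outer pairs \<open>{2i, 2i + 1}\<close> form a pentagon, since
  consecutive ones are disjoint. The inner pair with index \<open>i\<close> is disjoint from the
  outer pair with index \<open>i\<close> and from the inner pairs with indices \<open>i - 2\<close>
  and \<open>i + 2\<close>, so the inner pairs form a pentagram.\<close>

definition inner_pair :: "int \<Rightarrow> nat set" where
  "inner_pair i = {nat ((2 * i + 2) mod 5), nat ((2 * i + 4) mod 5)}"

lemma nat_mod_5_eq_iff: "nat (i mod 5) = nat (j mod 5) \<longleftrightarrow> (5 :: int) dvd i - j"
  by (simp add: mod_eq_dvd_iff[symmetric] eq_nat_nat_iff)

lemma pairs_table:
  "outer_pair i \<inter> outer_pair j = {} \<longleftrightarrow> 5 dvd i - j - 1 \<or> 5 dvd i - j + 1"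
  "outer_pair i \<inter> inner_pair j = {} \<longleftrightarrow> 5 dvd i - j"
  "inner_pair i \<inter> inner_pair j = {} \<longleftrightarrow> 5 dvd i - j - 2 \<or> 5 dvd i - j + 2"
  "outer_pair i = outer_pair j \<longleftrightarrow> 5 dvd i - j"
  "inner_pair i = inner_pair j \<longleftrightarrow> 5 dvd i - j"
  "outer_pair i \<noteq> inner_pair j"
proof -
  have meet: "{a, b} \<inter> {c, d} = {} \<longleftrightarrow> a \<noteq> c \<and> a \<noteq> d \<and> b \<noteq> c \<and> b \<noteq> d" for a b c d :: nat
    by auto
  note unfold = outer_pair_def inner_pair_def meet doubleton_eq_iff nat_mod_5_eq_iff
  show "outer_pair i \<inter> outer_pair j = {} \<longleftrightarrow> 5 dvd i - j - 1 \<or> 5 dvd i - j + 1"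
    unfolding unfold by presburger
  show "outer_pair i \<inter> inner_pair j = {} \<longleftrightarrow> 5 dvd i - j"
    unfolding unfold by presburger
  show "inner_pair i \<inter> inner_pair j = {} \<longleftrightarrow> 5 dvd i - j - 2 \<or> 5 dvd i - j + 2"
    unfolding unfold by presburger
  show "outer_pair i = outer_pair j \<longleftrightarrow> 5 dvd i - j"
    unfolding unfold by presburger
  show "inner_pair i = inner_pair j \<longleftrightarrow> 5 dvd i - j"
    unfolding unfold by presburger
  show "outer_pair i \<noteq> inner_pair j"
    unfolding unfold by presburger
qed

lemma pairs_petersen: "outer_pair i \<in> petersen_V" "inner_pair i \<in> petersen_V"
proof -
  have "nat (2 * i mod 5) \<noteq> nat ((2 * i + 1) mod 5)" "nat ((2 * i + 2) mod 5) \<noteq> nat ((2 * i + 4) mod 5)"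
    unfolding nat_mod_5_eq_iff by presburger+
  moreover have "{a, b} \<in> petersen_V" if "a < 5" "b < 5" "a \<noteq> b" for a b
    using that by (simp add: petersen_V_def)
  moreover have "nat (k mod 5) < 5" for k :: int by (simp add: nat_less_iff)
  ultimately show "outer_pair i \<in> petersen_V" "inner_pair i \<in> petersen_V"
    unfolding outer_pair_def inner_pair_def by blast+
qed

context subcubic begin

text \<open>Of the two arcs between the matched vertices the even one, of length \<open>k\<close>
  say, gives an odd cycle of length \<open>k + 3\<close>. So the odd arc has at most 3 edges, and 1
  is excluded since parallel edges between the cycles do not occur.\<close>

lemma spoke_step:
  assumes opt: "optimal \<phi>" and v: "fcyc \<phi> c l v e" and u: "fcyc \<phi> c l u f" and ef: "e \<noteq> f"
    and l: "l = odd_girth E" and s: "{v i, u j} \<in> E" "{v (i + 1), u j'} \<in> E"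
  shows "int l dvd j' - j - 3 \<or> int l dvd j' - j + 3"
proof -
  note cv = fcycD(1)[OF v] and cu = fcycD(1)[OF u]
  have dis: "range v \<inter> range u = {}" by (rule fcyc_disjoint[OF opt v u ef])
  then have vu: "v n \<notin> range u" for n by blast
  have par: "{u j, u j'} \<notin> cedges u" by (rule no_parallel_spokes[OF opt v u ef cedge_in(1) s])
  have lo: "odd l" "3 \<le> l" using cu by (auto simp: cyc_def)
  define k where "k = nat ((j' - j) mod int l)"
  have k: "int k = (j' - j) mod int l" "k < l" using lo by (auto simp: k_def nat_less_iff)
  have dk: "int l dvd j' - j - int k" unfolding k(1) by (rule dvd_minus_mod)
  have uj': "u (j + int k) = u j'"
  proof -
    have "int l dvd - (j' - j - int k)" using dk by (simp only: dvd_minus_iff)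
    then show ?thesis using cyc_eq_dvd[OF cu, of "j + int k" j'] by (simp add: algebra_simps)
  qed
  have uj: "u (j' + int (l - k)) = u j"
  proof -
    have "int l dvd (j' - j - int k) + int l" using dk by (rule dvd_add) simp
    then show ?thesis using cyc_eq_dvd[OF cu, of "j' + int (l - k)" j] k(2) by (simp add: algebra_simps of_nat_diff)
  qed
  have "k \<noteq> 0"
  proof
    assume "k = 0"
    then have "u j' = u j" using uj' by simp
    then have "v i = v (i + 1)"
      using cross_unique[OF cu, of v j i "i + 1"] s dis by (simp add: insert_commute Int_commute)
    then show False using cyc_neq1[OF cv, of i] by simp
  qed
  moreover have "k \<noteq> 1" using par uj' cedge_in(1)[of u j] by auto
  moreover have "l - k \<noteq> 1" using par uj cedge_in(1)[of u j'] by (auto simp: insert_commute)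
  moreover have "l \<le> k + 3" if "even k"
    using detour_odd_girth[OF cu that k(2) cycD(4)[OF cv, of i] s(1)] s(2) uj' vu l by simp
  moreover have "k \<le> 3" if "odd k"
  proof -
    have "even (l - k)" "l - k < l" using that lo k(2) \<open>k \<noteq> 0\<close> by auto
    moreover have "{v (i + 1), v i} \<in> E" using cycD(4)[OF cv, of i] by (simp add: insert_commute)
    ultimately have "l \<le> l - k + 3"
      using detour_odd_girth[OF cu, of "l - k" "v (i + 1)" "v i" j'] s uj vu l by simp
    then show ?thesis using k(2) by simp
  qed
  ultimately have "k = 3 \<or> k = l - 3"
    using lo k(2) by (cases "even k") presburger+
  then show ?thesis
  proof
    assume "k = l - 3"
    then have "j' - j + 3 = (j' - j - int k) + int l" using lo by (simp add: of_nat_diff)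
    moreover have "int l dvd (j' - j - int k) + int l" by (rule dvd_add[OF dk dvd_refl])
    ultimately show ?thesis by metis
  qed (use dk in simp)
qed

text \<open>Each step along \<open>v\<close> moves the partner by 3 in one of the two directions.
  The direction never changes, and choosing origin and orientation of \<open>u\<close> accordingly
  gives the index \<open>3 * i\<close>.\<close>

lemma linked_cycles:
  assumes opt: "optimal \<phi>" and v: "fcyc \<phi> c l v e" and u: "fcyc \<phi> c l u f" and ef: "e \<noteq> f"
    and l: "l = odd_girth E" and mates: "\<And>i. \<exists>j. {v i, u j} \<in> E"
  obtains w where "cyc l w" "range w = range u" "cedges w = cedges u" "\<forall>i. {v i, w (3 * i)} \<in> E"
proof -
  note cv = fcycD(1)[OF v] and cu = fcycD(1)[OF u]
  have dis: "range v \<inter> range u = {}" by (rule fcyc_disjoint[OF opt v u ef])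
  obtain q where q: "\<And>i. {v i, u (q i)} \<in> E" using mates by metis
  have step: "int l dvd q (i + 1) - q i - 3 \<or> int l dvd q (i + 1) - q i + 3" for i
    using spoke_step[OF opt v u ef l q q] .
  \<comment> \<open>A change of direction would return to the partner of \<open>i - 1\<close>,
    contradicting that partners are unique.\<close>
  have turn: "\<not> int l dvd q (i + 1) - q (i - 1)" for i
  proof
    assume "int l dvd q (i + 1) - q (i - 1)"
    then have "u (q (i + 1)) = u (q (i - 1))" using cyc_eq_dvd[OF cu] by blast
    then have "v (i - 1) = v (i + 1)"
      using cross_unique[OF cu, of v "q (i - 1)" "i - 1" "i + 1"] q[of "i - 1"] q[of "i + 1"] dis
      by (simp add: insert_commute Int_commute)
    then show False using cyc_neq2[OF cv, of i] by simp
  qed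
  define D where "D i \<longleftrightarrow> int l dvd q (i + 1) - q i - 3" for i
  have D_Suc: "D (i + 1) \<longleftrightarrow> D i" for i
  proof -
    have *: "\<not> int l dvd q (i + 1 + 1) - q i" using turn[of "i + 1"] by simp
    have "\<not> (D i \<and> \<not> D (i + 1))"
    proof
      assume h: "D i \<and> \<not> D (i + 1)"
      have "int l dvd q (i + 1 + 1) - q (i + 1) + 3" "int l dvd q (i + 1) - q i - 3"
        using h step[of "i + 1"] unfolding D_def by blast+
      then have "int l dvd (q (i + 1 + 1) - q (i + 1) + 3) + (q (i + 1) - q i - 3)"
        by (rule dvd_add)
      then show False using * by simp
    qed
    moreover have "\<not> (\<not> D i \<and> D (i + 1))"
    proof
      assume h: "\<not> D i \<and> D (i + 1)"
      have "int l dvd q (i + 1 + 1) - q (i + 1) - 3" "int l dvd q (i + 1) - q i + 3"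
        using h step[of i] unfolding D_def by blast+
      then have "int l dvd (q (i + 1 + 1) - q (i + 1) - 3) + (q (i + 1) - q i + 3)"
        by (rule dvd_add)
      then show False using * by simp
    qed
    ultimately show ?thesis by blast
  qed
  have D0: "D i \<longleftrightarrow> D 0" for i
  proof (induction i rule: int_induct[where k = 0])
    case (step2 i)
    then show ?case using D_Suc[of "i - 1"] by simp
  qed (simp_all add: D_Suc)
  define s where "s = (if D 0 then 1 else - 1 :: int)"
  have s_step: "int l dvd q (i + 1) - q i - 3 * s" for i
    using step[of i] D0[of i] unfolding D_def s_def by auto
  have lin: "int l dvd q i - q 0 - 3 * s * i" for i
  proof (induction i rule: int_induct[where k = 0])
    case (step1 i)
    have "int l dvd (q i - q 0 - 3 * s * i) + (q (i + 1) - q i - 3 * s)"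
      by (rule dvd_add[OF step1(2) s_step])
    then show ?case by (simp add: algebra_simps)
  next
    case (step2 i)
    have "int l dvd (q i - q 0 - 3 * s * i) - (q (i - 1 + 1) - q (i - 1) - 3 * s)"
      by (rule dvd_diff[OF step2(2) s_step])
    then show ?case by (simp add: algebra_simps)
  qed simp
  have mate: "{v i, u (s * (3 * i) + q 0)} \<in> E" for i
  proof -
    have "u (q i) = u (s * (3 * i) + q 0)"
      using lin[of i] cyc_eq_dvd[OF cu, of "q i" "s * (3 * i) + q 0"] by (simp add: algebra_simps)
    then show ?thesis using q[of i] by simp
  qed
  have sh: "cyc l (\<lambda>j. u (j + q 0))" "range (\<lambda>j. u (j + q 0)) = range u" "cedges (\<lambda>j. u (j + q 0)) = cedges u"
    using cyc_shift[OF cu] by auto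
  show ?thesis
  proof (cases "D 0")
    case True
    then show ?thesis using that[OF sh] mate by (simp add: s_def)
  next
    case False
    then show ?thesis using that[of "\<lambda>j. u (- j + q 0)"] cyc_reflect[OF sh(1)] sh(2,3) mate by (simp add: s_def)
  qed
qed

text \<open>The distance condition also holds from \<open>u\<close> to \<open>v\<close>. The partner
  \<open>v i\<close> of \<open>u 1\<close> satisfies \<open>3 * i = 1\<close> and
  \<open>i = 3\<close> or \<open>i = -3\<close> modulo \<open>l\<close>, so the odd number
  \<open>l\<close> divides \<open>9 - 1\<close> or \<open>9 + 1\<close>.\<close>

lemma linked_girth_5:
  assumes opt: "optimal \<phi>" and v: "fcyc \<phi> c l v e" and u: "fcyc \<phi> c l u f" and ef: "e \<noteq> f"
    and l: "l = odd_girth E" and s: "\<And>i. {v i, u (3 * i)} \<in> E"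
    and mates: "\<And>j. \<exists>i. {v i, u j} \<in> E"
  shows "l = 5"
proof -
  note cv = fcycD(1)[OF v] and cu = fcycD(1)[OF u]
  have dis: "range v \<inter> range u = {}" by (rule fcyc_disjoint[OF opt v u ef])
  obtain i where i: "{u 1, v i} \<in> E" using mates[of 1] by (auto simp: insert_commute)
  have "{u 0, v 0} \<in> E" using s[of 0] by (simp add: insert_commute)
  then have *: "int l dvd i - 3 \<or> int l dvd i + 3"
    using spoke_step[OF opt u v ef[symmetric] l, of 0 0 i] i by simp
  have "u (3 * i) = u 1"
    using cross_unique[OF cv dis s, of i 1] i by (simp add: insert_commute)
  then have d: "int l dvd 3 * i - 1" using cyc_eq_dvd[OF cu] by blast
  have "int l dvd 8 \<or> int l dvd 10"
    using *
  proof
    assume "int l dvd i - 3"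
    then have "int l dvd (3 * i - 1) - 3 * (i - 3)" by (rule dvd_diff[OF d dvd_mult])
    then show ?thesis by simp
  next
    assume "int l dvd i + 3"
    then have "int l dvd 3 * (i + 3) - (3 * i - 1)" by (rule dvd_diff[OF dvd_mult d])
    then show ?thesis by simp
  qed
  then have d8: "l dvd 8 \<or> l dvd 10"
    using int_dvd_int_iff[of l 8] int_dvd_int_iff[of l 10] by simp
  then have "l \<le> 10" using dvd_imp_le[of l 8] dvd_imp_le[of l 10] by linarith
  moreover have "odd l" "3 \<le> l" using cu by (auto simp: cyc_def)
  ultimately have "l = 3 \<or> l = 5 \<or> l = 7 \<or> l = 9" by presburger
  then show ?thesis using d8 by auto
qed

text \<open>Renumbering the second cycle by \<open>y i = u (3 * i)\<close> gives partners equal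
  indices. As 2 is inverse to 3 modulo 5, neighbours on the second cycle have indices differing by
  2, which is the pentagram. All degrees are then exhausted, and by connectedness there are no
  further vertices.\<close>

lemma petersen_iso:
  assumes con: "connected_graph V E" and cv: "cyc 5 v" and cu: "cyc 5 u" and dis: "range v \<inter> range u = {}"
    and s: "\<And>i. {v i, u (3 * i)} \<in> E"
  shows "graph_iso V E petersen_V petersen_E"
proof -
  define y where "y i = u (3 * i)" for i
  have veq: "v i = v j \<longleftrightarrow> 5 dvd i - j" for i j
    using cyc_eq_dvd[OF cv, of i j] by simp
  have ueq: "u i = u j \<longleftrightarrow> 5 dvd i - j" for i j
    using cyc_eq_dvd[OF cu, of i j] by simp
  have yeq: "y i = y j \<longleftrightarrow> 5 dvd i - j" for i j
    unfolding y_def ueq by presburger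
  have uy: "u i = y (2 * i)" for i unfolding y_def ueq by presburger
  have yr: "range y = range u"
  proof
    show "range y \<subseteq> range u" unfolding y_def by auto
    show "range u \<subseteq> range y" using uy by (metis image_subsetI rangeI)
  qed
  have vy: "v i \<noteq> y j" for i j using dis yr by (metis disjoint_iff rangeI)
  have spoke: "{v i, y i} \<in> E" for i using s by (simp add: y_def)
  have inner: "{y i, y (i + 2)} \<in> E" for i
  proof -
    have "y (i + 2) = u (3 * i + 1)" unfolding y_def ueq by presburger
    then show ?thesis using cycD(4)[OF cu, of "3 * i"] by (simp add: y_def)
  qed
  have nv: "t \<in> {v (i + 1), v (i - 1), y i}" if "{v i, t} \<in> E" for i t
  proof -
    have "{v i, t} \<in> {{v i, v (i + 1)}, {v (i - 1), v i}, {v i, y i}}"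
    proof (rule three_edges[of _ _ _ _ "v i"])
      show "distinct [{v i, v (i + 1)}, {v (i - 1), v i}, {v i, y i}]"
        using vy veq by (auto simp: doubleton_eq_iff)
    qed (use that cycD(4,5)[OF cv] spoke in auto)
    then show ?thesis by (auto simp: doubleton_eq_iff)
  qed
  have ny: "t \<in> {y (i + 2), y (i - 2), v i}" if "{y i, t} \<in> E" for i t
  proof -
    have "{y i, t} \<in> {{y i, y (i + 2)}, {y (i - 2), y i}, {v i, y i}}"
    proof (rule three_edges[of _ _ _ _ "y i"])
      show "distinct [{y i, y (i + 2)}, {y (i - 2), y i}, {v i, y i}]"
        using vy[of i, symmetric] yeq by (auto simp: doubleton_eq_iff)
    qed (use that inner[of i] inner[of "i - 2"] spoke in auto)
    then show ?thesis by (auto simp: doubleton_eq_iff)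
  qed
  have Evv: "{v i, v j} \<in> E \<longleftrightarrow> 5 dvd i - j - 1 \<or> 5 dvd i - j + 1" for i j
  proof
    assume "{v i, v j} \<in> E"
    then have "v j = v (i + 1) \<or> v j = v (i - 1)" using nv[of i "v j"] vy by auto
    then show "5 dvd i - j - 1 \<or> 5 dvd i - j + 1" unfolding veq by presburger
  next
    assume "5 dvd i - j - 1 \<or> 5 dvd i - j + 1"
    then have "v j = v (i + 1) \<or> v j = v (i - 1)" unfolding veq by presburger
    then show "{v i, v j} \<in> E" using cycD(4,5)[OF cv, of i] by (auto simp: insert_commute)
  qed
  have Eyy: "{y i, y j} \<in> E \<longleftrightarrow> 5 dvd i - j - 2 \<or> 5 dvd i - j + 2" for i j
  proof
    assume "{y i, y j} \<in> E"
    then have "y j = y (i + 2) \<or> y j = y (i - 2)" using ny[of i "y j"] vy[of i j] by auto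
    then show "5 dvd i - j - 2 \<or> 5 dvd i - j + 2" unfolding yeq by presburger
  next
    assume "5 dvd i - j - 2 \<or> 5 dvd i - j + 2"
    then have "y j = y (i + 2) \<or> y j = y (i - 2)" unfolding yeq by presburger
    then show "{y i, y j} \<in> E" using inner[of i] inner[of "i - 2"] by (auto simp: insert_commute)
  qed
  have Evy: "{v i, y j} \<in> E \<longleftrightarrow> 5 dvd i - j" for i j
  proof
    assume "{v i, y j} \<in> E"
    then have "y j = y i" using nv[of i "y j"] vy by (metis insertE singletonD)
    then show "5 dvd i - j" unfolding yeq by presburger
  next
    assume "5 dvd i - j"
    then have "y j = y i" unfolding yeq by presburger
    then show "{v i, y j} \<in> E" using spoke by simp
  qed
  have V: "V = range v \<union> range y"
  proof
    show "range v \<union> range y \<subseteq> V" using range_cyc_V cv cu yr by blast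
    show "V \<subseteq> range v \<union> range y"
    proof
      fix z assume "z \<in> V"
      moreover have "v 0 \<in> V" using range_cyc_V[OF cv] by blast
      ultimately have "(adj E)\<^sup>*\<^sup>* (v 0) z" using con by (simp add: connected_graph_def)
      then show "z \<in> range v \<union> range y"
      proof (induction rule: rtranclp_induct)
        case (step a b)
        then have "{a, b} \<in> E" by (simp add: adj_def)
        then show ?case using step(3) nv ny by blast
      qed simp
    qed
  qed
  define F where "F z = (if z \<in> range v then outer_pair (SOME i. z = v i) else inner_pair (SOME i. z = y i))" for z
  have Fv: "F (v i) = outer_pair i" for i
  proof -
    have "v i = v (SOME j. v i = v j)" by (rule someI_ex) blast
    then have "outer_pair (SOME j. v i = v j) = outer_pair i" unfolding pairs_table(4) veq by presburger
    then show ?thesis by (simp add: F_def)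
  qed
  have Fy: "F (y i) = inner_pair i" for i
  proof -
    have "y i = y (SOME j. y i = y j)" by (rule someI_ex) blast
    then have "inner_pair (SOME j. y i = y j) = inner_pair i" unfolding pairs_table(5) yeq by presburger
    moreover have "y i \<notin> range v" using vy by (metis rangeE)
    ultimately show ?thesis by (simp add: F_def)
  qed
  note tab = pairs_table
  have inV: "F z \<in> petersen_V" if "z \<in> V" for z using that V Fv Fy pairs_petersen by auto
  have inj: "inj_on F V"
  proof (rule inj_onI)
    fix a b assume ab: "a \<in> V" "b \<in> V" "F a = F b"
    then show "a = b" unfolding V using Fv Fy tab(4-6) veq yeq by (auto; metis)
  qed
  have cardV: "card V = 10"
  proof -
    have "card (range v \<union> range u) = card (range v) + card (range u)"
      by (rule card_Un_disjoint) (use finite_range_cyc cv cu dis in auto)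
    then show ?thesis using V yr card_range_cyc[OF cv] card_range_cyc[OF cu] by simp
  qed
  have "card petersen_V = 10"
    unfolding petersen_V_def using n_subsets[of "{0..<5::nat}" 2] by (simp add: choose_two)
  moreover have fin: "finite petersen_V" unfolding petersen_V_def by (rule finite_subset[of _ "Pow {0..<5}"]) auto
  ultimately have "F ` V = petersen_V"
    using card_subset_eq[OF fin, of "F ` V"] inV card_image[OF inj] cardV by auto
  then have bij: "bij_betw F V petersen_V" using inj by (simp add: bij_betw_def)
  have pE: "{P, Q} \<in> petersen_E \<longleftrightarrow> P \<inter> Q = {}" if "P \<in> petersen_V" "Q \<in> petersen_V" for P Q
    using that unfolding petersen_E_def by (auto simp: doubleton_eq_iff)
  have "{a, b} \<in> E \<longleftrightarrow> {F a, F b} \<in> petersen_E" if ab: "a \<in> V" "b \<in> V" for a b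
  proof -
    have "{a, b} \<in> E \<longleftrightarrow> F a \<inter> F b = {}"
    proof -
      consider i j where "a = v i" "b = v j" | i j where "a = v i" "b = y j"
        | i j where "a = y i" "b = v j" | i j where "a = y i" "b = y j" using ab V by blast
      then show ?thesis
      proof cases
        case 1
        then show ?thesis using Evv tab(1) Fv by simp
      next
        case 2
        then show ?thesis using Evy tab(2) Fv Fy by simp
      next
        case (3 i j)
        then have "{a, b} \<in> E \<longleftrightarrow> {v j, y i} \<in> E" by (simp add: insert_commute)
        then show ?thesis using 3 Evy[of j i] tab(2)[of j i] Fv Fy by (simp add: Int_commute)
      next
        case 4
        then show ?thesis using Eyy tab(3) Fy by simp
      qed
    qed
    then show ?thesis using pE[OF inV[OF ab(1)] inV[OF ab(2)]] by simp
  qed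
  then show ?thesis using bij unfolding graph_iso_def by blast
qed

text \<open>The matching is injective between cycles of equal length, so every vertex of the second
  cycle has a partner too; this is what forces girth 5.\<close>

lemma two_tight_cycles:
  assumes con: "connected_graph V E" and opt: "optimal \<phi>" and v: "fcyc \<phi> c l v e" and u: "fcyc \<phi> c l u f"
    and ef: "e \<noteq> f" and l: "l = odd_girth E" and mates: "\<And>i. \<exists>j. {v i, u j} \<in> E"
  shows "graph_iso V E petersen_V petersen_E"
proof -
  note cv = fcycD(1)[OF v] and cu = fcycD(1)[OF u]
  have dis: "range v \<inter> range u = {}" by (rule fcyc_disjoint[OF opt v u ef])
  obtain w where w: "cyc l w" "range w = range u" "cedges w = cedges u" "\<forall>i. {v i, w (3 * i)} \<in> E"
    by (rule linked_cycles[OF opt v u ef l mates])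
  then have fw: "fcyc \<phi> c l w f" using u unfolding fcyc_def by simp
  have inj: "inj_on (\<lambda>i. w (3 * i)) {0..<int l}"
  proof (rule inj_onI)
    fix i j assume ij: "i \<in> {0..<int l}" "j \<in> {0..<int l}" "w (3 * i) = w (3 * j)"
    have "{w (3 * i), v i} \<in> E" "{w (3 * i), v j} \<in> E"
      using w(4) ij(3) by (metis insert_commute)+
    then have "v i = v j" using cross_unique[OF w(1), of v "3 * i" i j] dis w(2) by (simp add: Int_commute)
    then show "i = j" using inj_onD[OF inj_on_cyc[OF cv]] ij(1,2) by blast
  qed
  have "(\<lambda>i. w (3 * i)) ` {0..<int l} = range w"
    by (rule card_subset_eq)
      (use card_image[OF inj] card_range_cyc[OF w(1)] finite_range_cyc[OF w(1)] in auto)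
  then have "\<exists>i. {v i, w j} \<in> E" for j
  proof -
    have "w j \<in> (\<lambda>i. w (3 * i)) ` {0..<int l}" using \<open>_ = range w\<close> by simp
    then obtain i where "w j = w (3 * i)" by blast
    then show ?thesis using w(4) by metis
  qed
  then have "l = 5" by (rule linked_girth_5[OF opt v fw ef l w(4)[rule_format]])
  then show ?thesis using petersen_iso[OF con, of v w] cv w dis by simp
qed


subsection \<open>Discharging\<close>

lemma sum_degree: "(\<Sum>v\<in>V. degree E v) = 2 * card E"
proof -
  have "card {v \<in> V. v \<in> e} = 2" if e: "e \<in> E" for e
  proof -
    obtain u w where uw: "u \<noteq> w" "e = {u, w}" "u \<in> V" "w \<in> V" by (rule edgeE[OF e])
    then have "{v \<in> V. v \<in> e} = {u, w}" by auto
    then show ?thesis using uw(1) by simp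
  qed
  then have "(\<Sum>v\<in>V. card {e \<in> E. v \<in> e}) = (\<Sum>e\<in>E. 2)"
    by (intro sum_multicount_gen finite_V finite_E) auto
  then show ?thesis by (simp add: degree_def mult.commute)
qed

lemma card_neighbours: "card {x. {w, x} \<in> E} = degree E w" and finite_neighbours: "finite {x. {w, x} \<in> E}"
proof -
  have "bij_betw (\<lambda>x. {w, x}) {x. {w, x} \<in> E} {e \<in> E. w \<in> e}"
  proof (rule bij_betwI')
    fix x y assume "x \<in> {x. {w, x} \<in> E}" "y \<in> {x. {w, x} \<in> E}"
    then show "({w, x} = {w, y}) = (x = y)" by (auto simp: doubleton_eq_iff)
  next
    fix e assume "e \<in> {e \<in> E. w \<in> e}"
    then show "\<exists>x\<in>{x. {w, x} \<in> E}. e = {w, x}" using edge_at by (metis mem_Collect_eq)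
  qed auto
  then show "card {x. {w, x} \<in> E} = degree E w" "finite {x. {w, x} \<in> E}"
    unfolding degree_def using finite_E by (auto dest: bij_betw_same_card bij_betw_finite)
qed

lemma odd_girth_odd: assumes "has_odd_cycle E" shows "odd (odd_girth E)" "3 \<le> odd_girth E"
proof -
  have "\<exists>k cs. is_cycle E cs \<and> length cs = k \<and> odd k" using assms by (auto simp: has_odd_cycle_def)
  then have "\<exists>cs. is_cycle E cs \<and> length cs = odd_girth E \<and> odd (odd_girth E)"
    unfolding odd_girth_def by (rule LeastI_ex)
  then show "odd (odd_girth E)" "3 \<le> odd_girth E" by (auto simp: is_cycle_def)
qed

text \<open>Two forms a support can take. In the first, no edge leaves \<open>T\<close> at the three
  vertices of \<open>I\<close>, so no other cycle is attached to them. In the second, a surplus can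
  only come from a length exceeding the odd girth.\<close>

definition strong_support :: "('a set \<Rightarrow> nat) \<Rightarrow> 'a set \<Rightarrow> 'a set \<Rightarrow> bool" where
  "strong_support \<phi> e T \<longleftrightarrow> supported \<phi> e T \<and>
    ((3 * odd_girth E + 2 \<le> (\<Sum>z\<in>T. degree E z) \<and>
        (\<exists>I\<subseteq>T. card I = 3 \<and> (\<forall>z\<in>I. \<forall>t\<in>E. z \<in> t \<longrightarrow> t \<subseteq> T))) \<or>
      (\<exists>c l v. fcyc \<phi> c l v e \<and> T = range v \<and> (\<forall>z\<in>range v. degree E z = 3)))"

end

locale discharging = charged +
  assumes con: "connected_graph V E" and odd_cyc: "has_odd_cycle E"
    and not_petersen: "\<not> graph_iso V E petersen_V petersen_E"
    and strong: "e \<in> uncoloured \<phi> \<Longrightarrow> strong_support \<phi> e (S e)"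
begin

abbreviation "U \<equiv> uncoloured \<phi>"
abbreviation "g \<equiv> odd_girth E"

definition tight :: "'a set \<Rightarrow> bool" where
  "tight e \<longleftrightarrow> (\<exists>c v. fcyc \<phi> c g v e \<and> S e = range v \<and> (\<forall>z\<in>range v. degree E z = 3))"

definition nb :: "'a set \<Rightarrow> 'a \<Rightarrow> nat" where
  "nb e w = card {x \<in> S e. {w, x} \<in> E}"

text \<open>A vertex \<open>w\<close> outside all supports gives a supporting neighbour one unit per edge, but gives its
  whole degree to \<open>e\<close> if all its neighbours in supports belong to \<open>S e\<close>.\<close>

definition contrib :: "'a set \<Rightarrow> 'a \<Rightarrow> nat" where
  "contrib e w = (if nb e w > 0 \<and> (\<forall>h\<in>U. h \<noteq> e \<longrightarrow> nb h w = 0) then degree E w else nb e w)"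

definition charge :: "'a set \<Rightarrow> nat" where
  "charge e = (\<Sum>z\<in>S e. degree E z) + (\<Sum>w\<in>rest. contrib e w)"

lemma finite_S: "e \<in> U \<Longrightarrow> finite (S e)"
  using S_subset_V finite_V finite_subset by blast

lemma supports_disjoint: "\<lbrakk>e \<in> U; f \<in> U; e \<noteq> f\<rbrakk> \<Longrightarrow> S e \<inter> S f = {}"
  using S_disjoint by blast

lemma finite_rest: "finite rest"
  unfolding rest_def using finite_V by simp

lemma nb_le_contrib: "nb e w \<le> contrib e w"
proof -
  have "nb e w \<le> card {x. {w, x} \<in> E}"
    unfolding nb_def by (rule card_mono[OF finite_neighbours]) auto
  then show ?thesis by (simp add: contrib_def card_neighbours)
qed

text \<open>If one support receives the whole degree, no other contains a neighbour of
  \<open>w\<close>. Otherwise the contributions count neighbours in pairwise disjoint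
  supports.\<close>

lemma sum_contrib: "(\<Sum>e\<in>U. contrib e w) \<le> degree E w"
proof (cases "\<exists>e\<in>U. nb e w > 0 \<and> (\<forall>h\<in>U. h \<noteq> e \<longrightarrow> nb h w = 0)")
  case True
  then obtain e where e: "e \<in> U" "nb e w > 0" "\<And>h. \<lbrakk>h \<in> U; h \<noteq> e\<rbrakk> \<Longrightarrow> nb h w = 0" by blast
  have "(\<Sum>h\<in>U - {e}. contrib h w) = 0"
    by (rule sum.neutral) (use e(3) in \<open>auto simp: contrib_def\<close>)
  then have "(\<Sum>e\<in>U. contrib e w) = contrib e w"
    using sum.remove[OF finite_uncoloured e(1), of "\<lambda>h. contrib h w"] by simp
  then show ?thesis using e by (simp add: contrib_def)
next
  case False
  have "contrib e w = nb e w" if "e \<in> U" for e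
  proof -
    have "\<not> (nb e w > 0 \<and> (\<forall>h\<in>U. h \<noteq> e \<longrightarrow> nb h w = 0))" using False that by blast
    then show ?thesis by (simp only: contrib_def if_False)
  qed
  then have "(\<Sum>e\<in>U. contrib e w) = (\<Sum>e\<in>U. nb e w)" by (rule sum.cong[OF refl])
  also have "\<dots> = card (\<Union>e\<in>U. {x \<in> S e. {w, x} \<in> E})"
    unfolding nb_def
  proof (rule card_UN_disjoint[symmetric])
    show "\<forall>e\<in>U. \<forall>f\<in>U. e \<noteq> f \<longrightarrow> {x \<in> S e. {w, x} \<in> E} \<inter> {x \<in> S f. {w, x} \<in> E} = {}"
      using supports_disjoint by blast
  qed (simp_all add: finite_uncoloured finite_S)
  also have "\<dots> \<le> card {x. {w, x} \<in> E}"
    by (rule card_mono[OF finite_neighbours]) auto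
  finally show ?thesis by (simp add: card_neighbours)
qed

lemma sum_charge: "(\<Sum>e\<in>U. charge e) \<le> 2 * card E"
proof -
  have V: "V = (\<Union>e\<in>U. S e) \<union> rest" using S_subset_V by (auto simp: rest_def)
  have "(\<Sum>e\<in>U. charge e) = (\<Sum>e\<in>U. \<Sum>z\<in>S e. degree E z) + (\<Sum>e\<in>U. \<Sum>w\<in>rest. contrib e w)"
    by (simp add: charge_def sum.distrib)
  also have "(\<Sum>e\<in>U. \<Sum>w\<in>rest. contrib e w) = (\<Sum>w\<in>rest. \<Sum>e\<in>U. contrib e w)" by (rule sum.swap)
  also have "\<dots> \<le> (\<Sum>w\<in>rest. degree E w)" by (rule sum_mono) (rule sum_contrib)
  also have "(\<Sum>e\<in>U. \<Sum>z\<in>S e. degree E z) = (\<Sum>z\<in>(\<Union>e\<in>U. S e). degree E z)"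
    by (rule sum.UNION_disjoint[symmetric]) (simp_all add: finite_uncoloured finite_S supports_disjoint)
  also have "(\<Sum>z\<in>(\<Union>e\<in>U. S e). degree E z) + (\<Sum>w\<in>rest. degree E w) =
      (\<Sum>z\<in>(\<Union>e\<in>U. S e) \<union> rest. degree E z)"
    by (rule sum.union_disjoint[symmetric])
      (use finite_uncoloured finite_S finite_rest in \<open>auto simp: rest_def\<close>)
  also have "(\<Union>e\<in>U. S e) \<union> rest = V" by (rule V[symmetric])
  finally show ?thesis by (simp add: sum_degree)
qed

lemma degree_S: "\<lbrakk>e \<in> U; z \<in> S e\<rbrakk> \<Longrightarrow> 2 \<le> degree E z"
  by (rule S_cyc) (auto intro: cyc_two_le_degree dest: fcycD(1))

definition attached :: "'a set \<Rightarrow> 'a set \<Rightarrow> 'a set" where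
  "attached e f = {y \<in> S f. \<exists>x\<in>S e. {y, x} \<in> E}"

text \<open>\<open>s\<close> counts the cycle vertices with a neighbour in \<open>rest\<close>; each
  yields a unit, so there is at most one. The other edges leaving the cycle all reach one support,
  because consecutive ones do. If \<open>f\<close> were tight, then \<open>s = 0\<close> would give
  the Petersen graph, and for \<open>s = 1\<close> the neighbour in \<open>rest\<close> would
  contribute 3 units.\<close>

lemma poor_tight_partner:
  assumes e: "e \<in> U" "tight e" "charge e < 3 * g + 2"
  obtains f s where "f \<in> U" "\<not> tight f" "s \<le> 1" "3 * g + s \<le> charge e" "g \<le> card (attached e f) + s"
proof -
  define X where "X = {x \<in> S e. \<exists>w\<in>rest. {x, w} \<in> E}"
  obtain c v0 where v0: "fcyc \<phi> c g v0 e" "S e = range v0" "\<forall>z\<in>range v0. degree E z = 3"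
    using e(2) by (auto simp: tight_def)
  have cardS: "card (S e) = g" using card_range_cyc fcycD(1)[OF v0(1)] v0(2) by simp
  have "(\<Sum>z\<in>S e. degree E z) = (\<Sum>z\<in>S e. 3)" by (rule sum.cong) (use v0 in auto)
  then have ch: "charge e = 3 * g + (\<Sum>w\<in>rest. contrib e w)" by (simp add: charge_def cardS)
  have "card X \<le> card (\<Union>w\<in>rest. {x \<in> S e. {w, x} \<in> E})"
    by (rule card_mono) (use finite_rest finite_S[OF e(1)] in \<open>auto simp: X_def insert_commute\<close>)
  also have "\<dots> \<le> (\<Sum>w\<in>rest. nb e w)" unfolding nb_def by (rule card_UN_le[OF finite_rest])
  also have "\<dots> \<le> (\<Sum>w\<in>rest. contrib e w)" by (rule sum_mono) (rule nb_le_contrib)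
  finally have chX: "3 * g + card X \<le> charge e" using ch by simp
  then have X1: "card X \<le> 1" using e(3) by simp
  have finX: "finite X" using finite_S[OF e(1)] by (simp add: X_def)
  \<comment> \<open>The possible exceptional vertex is moved to index 0, so that indices 1 to
    \<open>g - 1\<close> are an interval on which the support can be propagated by
    induction.\<close>
  obtain i0 where "X \<subseteq> {v0 i0}"
  proof (cases "X = {}")
    case True
    then show ?thesis using that by simp
  next
    case False
    then have "card X = 1" using X1 finX by (simp add: card_gt_0_iff le_antisym Suc_leI)
    then obtain x where "X = {x}" by (auto simp: card_1_singleton_iff)
    moreover from this have "x \<in> range v0" using v0(2) X_def by blast
    ultimately show ?thesis using that by auto
  qed
  define v where "v = (\<lambda>i. v0 (i + i0))"
  have vX: "X \<subseteq> {v 0}" using \<open>X \<subseteq> {v0 i0}\<close> by (simp add: v_def)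
  have v: "fcyc \<phi> c g v e" "S e = range v" "\<forall>z\<in>range v. degree E z = 3"
    using v0 cyc_shift[OF fcycD(1)[OF v0(1)], of i0] unfolding v_def fcyc_def by simp_all
  note vD = fcycD[OF v(1)]
  have g: "3 \<le> g" using vD(1) by (simp add: cyc_def)
  have "\<exists>w. {v i, w} \<in> E \<and> w \<notin> range v" for i
  proof -
    obtain w where w: "{v i, w} \<in> E - cedges v"
      using spoke_iff_degree[OF vD(1), of "v i"] v(3) by blast
    moreover have "w \<notin> range v" using w cyc_chordless[OF vD(1) refl, of i] by blast
    ultimately show ?thesis by blast
  qed
  then obtain m where m: "\<And>i. {v i, m i} \<in> E" "\<And>i. m i \<notin> range v" by metis
  have loc: "\<exists>h\<in>U. h \<noteq> e \<and> m i \<in> S h" if "v i \<notin> X" for i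
  proof -
    have "m i \<in> V" using m(1)[of i] edge_in_V by (metis insert_commute)
    moreover have "m i \<notin> rest" using that m(1)[of i] v(2) by (auto simp: X_def)
    ultimately obtain h where "h \<in> U" "m i \<in> S h" by (auto simp: rest_def)
    then show ?thesis using m(2)[of i] v(2) by auto
  qed
  have notX: "v i \<notin> X" if "0 < i" "i < int g" for i
    using cyc_neq[OF vD(1) that, of 0] vX by auto
  obtain f where f: "f \<in> U" "f \<noteq> e" "m 1 \<in> S f" using loc[OF notX[of 1]] g by auto
  have pos: "i < int g \<longrightarrow> m i \<in> S f" if "1 \<le> i" for i
    using that
  proof (induction i rule: int_ge_induct)
    case (step i)
    show ?case
    proof
      assume i: "i + 1 < int g"
      then obtain h where h: "h \<in> U" "h \<noteq> e" "m (i + 1) \<in> S h" using loc[OF notX[of "i + 1"]] step(1) by auto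
      have "h = f"
        by (rule spokes_same_support[OF e(1) v(1) v(2)[symmetric] cedge_in(1)[of v i] m(1) f(1) _ f(2) m(1) h(1,3,2)])
          (use step i in auto)
      then show "m (i + 1) \<in> S f" using h by simp
    qed
  qed (use f in simp)
  have mS: "m i \<in> S f" if i: "v i \<notin> X" "0 \<le> i" "i < int g" for i
  proof (cases "i = 0")
    case True
    then obtain h where h: "h \<in> U" "h \<noteq> e" "m 0 \<in> S h" using loc i(1) by blast
    have "{v 1, v 0} \<in> cedges v" using cedge_in(1)[of v 0] by (simp add: insert_commute)
    from spokes_same_support[OF e(1) v(1) v(2)[symmetric] this m(1) f(1,3,2) m(1) h(1,3,2)]
    show ?thesis using h True by simp
  qed (use pos i in auto)
  have nt: "\<not> tight f"
  proof
    assume "tight f"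
    then obtain d u where u: "fcyc \<phi> d g u f" "S f = range u" by (auto simp: tight_def)
    have dis: "range v \<inter> range u = {}" by (rule fcyc_disjoint[OF opt v(1) u(1) f(2)[symmetric]])
    obtain j where j: "m 1 = u j" using f(3) u(2) by auto
    have "\<phi> {v 1, m 1} = c" using vD(7)[OF m(1)[of 1], of "v 1"] cross_not_cedge(1)[OF dis] j by simp
    moreover have "\<phi> {v 1, m 1} = d"
      using fcycD(7)[OF u(1) m(1)[of 1], of "u j"] cross_not_cedge(2)[OF dis] j by simp
    ultimately have dc: "d = c" by simp
    show False
    proof (cases "X = {}")
      case True
      have "\<exists>j. {v i, u j} \<in> E" for i
      proof -
        have "m (i mod int g) \<in> S f" using mS[of "i mod int g"] True g by simp
        then obtain j where "m (i mod int g) = u j" using u(2) by blast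
        then have "{v (i mod int g), u j} \<in> E" using m(1)[of "i mod int g"] by simp
        then show ?thesis using cyc_mod[OF vD(1)] by metis
      qed
      then show False
        using two_tight_cycles[OF con opt v(1) _ f(2)[symmetric] refl, of u] u(1) dc not_petersen by blast
    next
      case False
      then have "v 0 \<in> X" using vX by blast
      then obtain w where w: "w \<in> rest" "{v 0, w} \<in> E" by (auto simp: X_def)
      have ce: "{v 0, v 1} \<in> cedges v" using cedge_in(1)[of v 0] by simp
      note ex = rest_exclusive[OF e(1) v(1) v(2)[symmetric] ce w(2,1) m(1) f(1,3,2) u(1) u(2)[symmetric]]
      have "v 0 \<in> {x \<in> S e. {w, x} \<in> E}" using w(2) v(2) by (simp add: insert_commute)
      then have "nb e w > 0" unfolding nb_def using finite_S[OF e(1)] by (auto simp: card_gt_0_iff)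
      \<comment> \<open>All neighbours of \<open>w\<close> other than \<open>v 0\<close> lie in
        \<open>rest\<close>, so \<open>e\<close> alone receives the degree of
        \<open>w\<close>.\<close>
      moreover have "nb h w = 0" if h: "h \<in> U" "h \<noteq> e" for h
      proof -
        have "z \<notin> S h" if "{w, z} \<in> E" for z
        proof
          assume z: "z \<in> S h"
          then have "z = v 0" using ex(2)[OF that] h by (auto simp: rest_def)
          then show False using S_disjoint[OF h(1) e(1) z] v(2) h(2) by simp
        qed
        then show ?thesis unfolding nb_def by (metis (no_types, lifting) Collect_empty_eq card.empty)
      qed
      ultimately have "contrib e w = 3" using ex(1) by (simp add: contrib_def)
      then have "3 \<le> (\<Sum>w\<in>rest. contrib e w)" using member_le_sum[OF w(1) _ finite_rest, of "contrib e"] by simp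
      then show False using ch e(3) by simp
    qed
  qed
  define J where "J = {i \<in> {0..<int g}. v i \<notin> X}"
  have "v ` J = S e - X" unfolding J_def v(2) range_cyc[OF vD(1)] by auto
  moreover have "inj_on v J" by (rule inj_on_subset[OF inj_on_cyc[OF vD(1)]]) (auto simp: J_def)
  ultimately have "card J = card (S e - X)" using card_image by metis
  also have "\<dots> = g - card X" using card_Diff_subset[OF finX, of "S e"] cardS by (auto simp: X_def)
  finally have cJ: "card J = g - card X" .
  have mf: "m i \<in> S f" if "i \<in> J" for i using that mS by (simp add: J_def)
  have mE: "{m i, v i} \<in> E" for i using m(1)[of i] by (simp add: insert_commute)
  have vf: "v i \<notin> S f" for i using S_disjoint[OF e(1) f(1), of "v i"] v(2) f(2) by auto
  \<comment> \<open>Only one edge leaves \<open>S f\<close> at a given vertex, so distinct cycle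
    vertices are attached at distinct places.\<close>
  have "inj_on m J"
  proof (rule inj_onI)
    fix i j assume ij: "i \<in> J" "j \<in> J" "m i = m j"
    have "{m i, v j} \<in> E" using mE[of j] ij(3) by simp
    then have "v j = v i" using leaving_edge(2)[OF f(1) mf[OF ij(1)] mE vf] vf by blast
    then show "i = j" using \<open>inj_on v J\<close> ij by (auto dest: inj_onD)
  qed
  moreover have "m ` J \<subseteq> attached e f"
    using mf mE v(2) by (auto simp: attached_def)
  moreover have "finite (attached e f)" using finite_S[OF f(1)] by (simp add: attached_def)
  ultimately have "g - card X \<le> card (attached e f)" using cJ card_inj_on_le by metis
  then show ?thesis using that[OF f(1) nt X1 chX] by simp
qed

text \<open>Attached vertices are distinct for distinct members of \<open>B\<close> and have degree
  3, so about \<open>g * card B\<close> vertices of \<open>S f\<close> are available to pay at most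
  2 units to each member.\<close>

lemma donation:
  assumes f: "f \<in> U" "\<not> tight f" and B: "B \<subseteq> U" "f \<notin> B"
    and s: "\<And>e. e \<in> B \<Longrightarrow> s e \<le> 1 \<and> g \<le> card (attached e f) + s e"
  shows "3 * g + 2 + 2 * card B \<le> (\<Sum>z\<in>S f. degree E z) + sum s B"
proof -
  note odd = odd_girth_odd[OF odd_cyc]
  have finB: "finite B" using B(1) finite_uncoloured finite_subset by blast
  define N where "N = (\<Union>e\<in>B. attached e f)"
  have NS: "N \<subseteq> S f" by (auto simp: N_def attached_def)
  then have finN: "finite N" using finite_S[OF f(1)] finite_subset by blast
  have leave: "x \<notin> S f" if "x \<in> S e" "e \<in> B" for x e
    using S_disjoint[OF f(1), of e x] that B by blast
  have Ndeg: "degree E y = 3" if y: "y \<in> N" for y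
  proof -
    obtain e x where x: "e \<in> B" "y \<in> S f" "x \<in> S e" "{y, x} \<in> E" using y by (auto simp: N_def attached_def)
    then show ?thesis using leaving_edge(1)[OF f(1) x(2,4)] leave by blast
  qed
  have dis: "attached e f \<inter> attached e' f = {}" if "e \<in> B" "e' \<in> B" "e \<noteq> e'" for e e'
  proof (rule ccontr)
    assume "attached e f \<inter> attached e' f \<noteq> {}"
    then obtain y x x' where y: "y \<in> S f" "x \<in> S e" "{y, x} \<in> E" "x' \<in> S e'" "{y, x'} \<in> E"
      by (auto simp: attached_def)
    then have "x' = x" using leaving_edge(2)[OF f(1) y(1,3) _ y(5)] leave that by blast
    then show False using S_disjoint[of e e' x] that B y by blast
  qed
  have "card N = (\<Sum>e\<in>B. card (attached e f))"
    unfolding N_def by (rule card_UN_disjoint) (use finB dis finite_S[OF f(1)] in \<open>auto simp: attached_def\<close>)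
  moreover have "(\<Sum>e\<in>B. g) \<le> (\<Sum>e\<in>B. card (attached e f) + s e)" by (rule sum_mono) (use s in auto)
  ultimately have N1: "card B * g \<le> card N + sum s B" by (simp add: sum.distrib)
  have N2: "sum s B \<le> card B" using sum_bounded_above[of B s 1] s by simp
  have mult: "g + 3 * t \<le> card B * g" if "card B = Suc t" for t
    using that odd(2) by (simp add: mult.commute)
  from strong[OF f(1)] show ?thesis
    unfolding strong_support_def
  proof (elim conjE disjE)
    assume A: "3 * g + 2 \<le> (\<Sum>z\<in>S f. degree E z)"
    assume "\<exists>I\<subseteq>S f. card I = 3 \<and> (\<forall>z\<in>I. \<forall>t\<in>E. z \<in> t \<longrightarrow> t \<subseteq> S f)"
    then obtain I where I: "I \<subseteq> S f" "card I = 3" "\<forall>z\<in>I. \<forall>t\<in>E. z \<in> t \<longrightarrow> t \<subseteq> S f" by blast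
    have "I \<inter> N = {}"
    proof (rule ccontr)
      assume "I \<inter> N \<noteq> {}"
      then obtain y e x where "y \<in> I" "e \<in> B" "x \<in> S e" "{y, x} \<in> E" by (auto simp: N_def attached_def)
      then show False using I(3) leave by blast
    qed
    have finI: "finite I" using I(2) card_gt_0_iff by fastforce
    have "(\<Sum>z\<in>N \<union> I. degree E z) \<le> (\<Sum>z\<in>S f. degree E z)"
      by (rule sum_mono2) (use finite_S[OF f(1)] NS I in auto)
    moreover have "(\<Sum>z\<in>N \<union> I. degree E z) = (\<Sum>z\<in>N. degree E z) + (\<Sum>z\<in>I. degree E z)"
      by (rule sum.union_disjoint) (use finN finI \<open>I \<inter> N = {}\<close> in auto)
    moreover have "3 * card N \<le> (\<Sum>z\<in>N. degree E z)" by (rule sum_degree_ge) (use finN Ndeg in auto)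
    moreover have "2 * card I \<le> (\<Sum>z\<in>I. degree E z)"
      by (rule sum_degree_ge) (use finI degree_S[OF f(1)] I(1) in auto)
    \<comment> \<open>The 6 units are 2 for each vertex of \<open>I\<close>. They are exactly
      sufficient when \<open>B\<close> has one member and its \<open>s\<close> is 1.\<close>
    ultimately have D: "3 * card N + 6 \<le> (\<Sum>z\<in>S f. degree E z)" using I(2) by linarith
    show ?thesis
    proof (cases "card B")
      case 0
      then show ?thesis using A by simp
    next
      case (Suc t)
      then show ?thesis using D N1 N2 mult[OF Suc] by linarith
    qed
  next
    assume "\<exists>c l v. fcyc \<phi> c l v f \<and> S f = range v \<and> (\<forall>z\<in>range v. degree E z = 3)"
    then obtain c l v where v: "fcyc \<phi> c l v f" "S f = range v" "\<forall>z\<in>range v. degree E z = 3" by blast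
    have cv: "cyc l v" by (rule fcycD(1)[OF v(1)])
    have "l \<noteq> g" using f(2) v by (auto simp: tight_def)
    moreover have "g \<le> l" by (rule cyc_odd_girth[OF cv])
    moreover have "odd l" using cv by (simp add: cyc_def)
    \<comment> \<open>Two extra vertices of degree 3 give 6 units: 2 for \<open>f\<close> itself and
      2 for each of up to two members of \<open>B\<close>. Three or more members force a much longer
      cycle, which has to hold all their attached vertices.\<close>
    ultimately have l: "g + 2 \<le> l" using odd(1) by presburger
    have cS: "card (S f) = l" using card_range_cyc[OF cv] v(2) by simp
    have "(\<Sum>z\<in>S f. degree E z) = (\<Sum>z\<in>S f. 3)" by (rule sum.cong) (use v in auto)
    then have D: "(\<Sum>z\<in>S f. degree E z) = 3 * l" using cS by simp
    have Nl: "card N \<le> l" using card_mono[OF finite_S[OF f(1)] NS] cS by simp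
    show ?thesis
    proof (cases "card B \<le> 2")
      case True
      then show ?thesis using D l by linarith
    next
      case False
      then obtain t where t: "card B = Suc t" "2 \<le> t" by (cases "card B") auto
      then show ?thesis using D Nl N1 N2 mult[OF t(1)] by linarith
    qed
  qed
qed

text \<open>Each poor tight edge joins the group of the partner that pays for it. Partners are not
  tight and hence not poor, so every group contains exactly one edge outside \<open>P\<close>, and
  its total charge is at least \<open>3 * g + 2\<close> per member.\<close>

lemma uncoloured_bound: "(3 * g + 2) * card U \<le> 2 * card E"
proof -
  define P where "P = {e \<in> U. tight e \<and> charge e < 3 * g + 2}"
  define R where "R = U - P"
  have fin: "finite P" "finite R" using finite_uncoloured by (auto simp: P_def R_def)
  have "\<forall>e\<in>P. \<exists>fs. fst fs \<in> U \<and> \<not> tight (fst fs) \<and> snd fs \<le> 1 \<and> 3 * g + snd fs \<le> charge e \<and>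
      g \<le> card (attached e (fst fs)) + snd fs"
  proof
    fix e assume "e \<in> P"
    then have e: "e \<in> U" "tight e" "charge e < 3 * g + 2" by (auto simp: P_def)
    obtain f s where "f \<in> U" "\<not> tight f" "s \<le> 1" "3 * g + s \<le> charge e" "g \<le> card (attached e f) + s"
      by (rule poor_tight_partner[OF e])
    then show "\<exists>fs. fst fs \<in> U \<and> \<not> tight (fst fs) \<and> snd fs \<le> 1 \<and> 3 * g + snd fs \<le> charge e \<and>
      g \<le> card (attached e (fst fs)) + snd fs" by (intro exI[of _ "(f, s)"]) simp
  qed
  from bchoice[OF this] obtain fs where fs: "\<forall>e\<in>P. fst (fs e) \<in> U \<and> \<not> tight (fst (fs e)) \<and>
    snd (fs e) \<le> 1 \<and> 3 * g + snd (fs e) \<le> charge e \<and> g \<le> card (attached e (fst (fs e))) + snd (fs e)" ..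
  define p where "p e = fst (fs e)" for e
  define s where "s e = snd (fs e)" for e
  have ps: "p e \<in> U" "\<not> tight (p e)" "s e \<le> 1" "3 * g + s e \<le> charge e" "g \<le> card (attached e (p e)) + s e"
    if "e \<in> P" for e using fs that unfolding p_def s_def by blast+
  have pR: "p ` P \<subseteq> R" using ps by (auto simp: R_def P_def)
  define B where "B f = {e \<in> P. p e = f}" for f
  have local: "(3 * g + 2) * (1 + card (B f)) \<le> charge f + (\<Sum>e\<in>B f. charge e)" if f: "f \<in> R" for f
  proof (cases "tight f")
    case True
    then have "B f = {}" using ps(2) by (auto simp: B_def)
    moreover have "3 * g + 2 \<le> charge f" using f True by (auto simp: R_def P_def)
    ultimately show ?thesis by simp
  next
    case False
    have "3 * g + 2 + 2 * card (B f) \<le> (\<Sum>z\<in>S f. degree E z) + sum s (B f)"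
    proof (rule donation)
      show "f \<in> U" "f \<notin> B f" using f by (auto simp: R_def B_def)
      show "B f \<subseteq> U" by (auto simp: B_def P_def)
      show "s e \<le> 1 \<and> g \<le> card (attached e f) + s e" if "e \<in> B f" for e
        using ps(3,5)[of e] that by (auto simp: B_def)
    qed (rule False)
    also have "\<dots> \<le> charge f + sum s (B f)" by (simp add: charge_def)
    finally have 1: "3 * g + 2 + 2 * card (B f) \<le> charge f + sum s (B f)" .
    have "(\<Sum>e\<in>B f. 3 * g + s e) \<le> (\<Sum>e\<in>B f. charge e)"
      by (rule sum_mono) (use ps(4) in \<open>auto simp: B_def\<close>)
    then have 2: "card (B f) * (3 * g) + sum s (B f) \<le> (\<Sum>e\<in>B f. charge e)" by (simp add: sum.distrib)
    have "(3 * g + 2) * (1 + card (B f)) = 3 * g + 2 + 2 * card (B f) + card (B f) * (3 * g)"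
      by (simp add: algebra_simps)
    then show ?thesis using 1 2 by linarith
  qed
  have group: "(\<Sum>f\<in>R. \<Sum>e\<in>B f. h e) = sum h P" for h :: "'a set \<Rightarrow> nat"
    unfolding B_def by (rule sum.group[OF fin pR])
  have UPR: "U = R \<union> P" "R \<inter> P = {}" by (auto simp: R_def P_def)
  have split: "sum h U = sum h R + sum h P" for h :: "'a set \<Rightarrow> nat"
    unfolding UPR(1) by (rule sum.union_disjoint[OF fin(2,1) UPR(2)])
  have "(3 * g + 2) * card U = (\<Sum>e\<in>U. 3 * g + 2)" by (simp add: mult.commute)
  also have "\<dots> = (\<Sum>f\<in>R. 3 * g + 2) + (\<Sum>f\<in>R. \<Sum>e\<in>B f. 3 * g + 2)"
    unfolding split group ..
  also have "\<dots> = (\<Sum>f\<in>R. 3 * g + 2 + (\<Sum>e\<in>B f. 3 * g + 2))"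
    by (rule sum.distrib[symmetric])
  also have "\<dots> = (\<Sum>f\<in>R. (3 * g + 2) * (1 + card (B f)))"
    by (rule sum.cong) (simp_all add: algebra_simps)
  also have "\<dots> \<le> (\<Sum>f\<in>R. charge f + (\<Sum>e\<in>B f. charge e))"
    by (rule sum_mono) (rule local)
  also have "\<dots> = (\<Sum>e\<in>U. charge e)" unfolding split sum.distrib group ..
  also have "\<dots> \<le> 2 * card E" by (rule sum_charge)
  finally show ?thesis .
qed


end

section \<open>From supports to the bound on \<open>gamma\<close>\<close>

context subcubic begin

lemma good_support:
  assumes "good \<phi>" "e \<in> uncoloured \<phi>"
  shows "\<exists>T. strong_support \<phi> e T"
proof (cases "\<exists>u\<in>e. degree E u \<noteq> 3")
  case True
  then obtain u where u: "u \<in> e" "degree E u \<noteq> 3" by blast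
  have "optimal \<phi>" using assms(1) by (simp add: good_def)
  then obtain T I where "supported \<phi> e T"
    "3 * odd_girth E + 2 \<le> (\<Sum>z\<in>T. degree E z)" "I \<subseteq> T" "card I = 3"
    "\<forall>z\<in>I. \<forall>t\<in>E. z \<in> t \<longrightarrow> t \<subseteq> T"
    by (rule low_degree_support[OF _ assms(2) u])
  then show ?thesis unfolding strong_support_def by blast
next
  case False
  have opt: "optimal \<phi>" using assms(1) by (simp add: good_def)
  obtain x y where e: "e = {x, y}" using assms(2) by (auto simp: uncoloured_def elim: edgeE)
  have xy: "{x, y} \<in> uncoloured \<phi>" using assms(2) e by simp
  obtain a where a: "a < 3" "missing \<phi> x a" using exists_missing[OF xy, of x] by auto
  obtain b where b: "b < 3" "missing \<phi> y b" using exists_missing[OF xy, of y] by auto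
  have "a \<noteq> b" using no_common_missing[OF opt xy a(2)] a(1) b(2) by blast
  then obtain c where c: "c < 3" "distinct [a, c, b]"
    using a(1) b(1) that[of 0] that[of 1] that[of 2] by fastforce
  then obtain l v where "fcyc \<phi> c l v {x, y}"
    using fcyc_exists[OF opt xy a(2) b(2) a(1) b(1) c(1)] by auto
  then have v: "fcyc \<phi> c l v e" using e by simp
  moreover have "\<forall>z\<in>range v. degree E z = 3" using assms(1) False v unfolding good_def by blast
  moreover have "supported \<phi> e (range v)" unfolding supported_def using v by blast
  ultimately show ?thesis unfolding strong_support_def by blast
qed

lemma optimal_gamma:
  assumes "optimal \<phi>" "E \<noteq> {}"
  shows "1 - card (uncoloured \<phi>) / card E \<le> gamma E"
proof -
  let ?F = "E - uncoloured \<phi>"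
  have U: "uncoloured \<phi> \<subseteq> E" by (auto simp: uncoloured_def)
  have "three_edge_colourable ?F"
    unfolding three_edge_colourable_def
  proof (intro exI[of _ \<phi>] conjI ballI impI)
    fix e e' assume e: "e \<in> ?F" "e' \<in> ?F" "e \<noteq> e' \<and> e \<inter> e' \<noteq> {}"
    then obtain v where "v \<in> e" "v \<in> e'" by blast
    then show "\<phi> e \<noteq> \<phi> e'"
      using proper_at[OF optimal_proper[OF assms(1)], of e e' v] e by (auto simp: uncoloured_def)
  qed (auto simp: uncoloured_def)
  then have "real (card ?F) / real (card E) \<in> {real (card F) / real (card E) | F. F \<subseteq> E \<and> three_edge_colourable F}"
    by blast
  moreover have "finite {real (card F) / real (card E) | F. F \<subseteq> E \<and> three_edge_colourable F}"
    by (rule finite_subset[of _ "(\<lambda>F. real (card F) / real (card E)) ` Pow E"]) (auto simp: finite_E)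
  ultimately have "real (card ?F) / real (card E) \<le> gamma E" unfolding gamma_def by (intro Max_ge)
  moreover have "real (card ?F) = real (card E) - real (card (uncoloured \<phi>))"
    using card_Diff_subset[OF finite_uncoloured U] card_mono[OF finite_E U] by (simp add: of_nat_diff)
  moreover have "card E > 0" using assms(2) finite_E by (simp add: card_gt_0_iff)
  ultimately show ?thesis by (simp add: diff_divide_distrib)
qed

end

theorem theorem1:
  fixes V :: "'a set" and E :: "'a set set"
  assumes "simple_graph V E"
    and "connected_graph V E"
    and "max_degree V E = 3"
    and "has_odd_cycle E"
    and "\<not> graph_iso V E petersen_V petersen_E"
  shows "gamma E \<ge> 1 - 2 / (3 * real (odd_girth E) + 2)"
proof -
  \<comment> \<open>The locale asks for the bound at every element of the type; outside
    \<open>V\<close> the degree is 0.\<close>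
  have "degree E v \<le> 3" for v
  proof (cases "v \<in> V")
    case True
    then show ?thesis
      using assms(1,3) Max_ge[of "degree E ` V" "degree E v"] by (simp add: max_degree_def simple_graph_def)
  next
    case False
    then have "{e \<in> E. v \<in> e} = {}" using assms(1) unfolding simple_graph_def by fastforce
    then show ?thesis unfolding degree_def by (metis card.empty zero_le)
  qed
  then interpret subcubic V E using assms(1) by unfold_locales
  obtain \<phi> where good: "good \<phi>" using ex_good by blast
  then have opt: "optimal \<phi>" by (simp add: good_def)
  have "\<forall>e\<in>uncoloured \<phi>. \<exists>T. strong_support \<phi> e T" using good_support[OF good] by blast
  from bchoice[OF this] obtain S where S: "\<forall>e\<in>uncoloured \<phi>. strong_support \<phi> e (S e)" ..
  interpret discharging V E \<phi> S
    by unfold_locales (use opt S assms in \<open>auto simp: strong_support_def\<close>)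
  obtain cs where "is_cycle E cs" using assms(4) by (auto simp: has_odd_cycle_def)
  then have "0 < length cs" "\<forall>i<length cs. adj E (cs ! i) (cs ! ((i + 1) mod length cs))"
    by (auto simp: is_cycle_def)
  then have "E \<noteq> {}" by (auto simp: adj_def)
  then have m: "card E > 0" using finite_E by (simp add: card_gt_0_iff)
  have "real ((3 * odd_girth E + 2) * card (uncoloured \<phi>)) \<le> real (2 * card E)"
    using uncoloured_bound by (rule of_nat_mono)
  then have "real (card (uncoloured \<phi>)) / real (card E) \<le> 2 / (3 * real (odd_girth E) + 2)"
    using m by (simp add: field_simps)
  then show ?thesis using optimal_gamma[OF opt \<open>E \<noteq> {}\<close>] by linarith
qed

end
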